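(* Let $\alpha\in\mathbb{T}^d$ with $(1,\alpha)$ rationally independent, let $0<R<1$ satisfy $R>3\beta(\alpha)\ge0$, let $\kappa\in(0,\frac14)$, and let $V\in C^\omega(\mathbb{T}^d,\mathbb{R})$ be a non-constant function. Let $E$ be an edge point of a spectral gap $G(V)$ of $H_{V,\alpha,\theta}$. Assume that there are $\zeta\in(0,\frac12)$ and $X\in C_R^\omega(\mathbb{T}^d,\mathrm{PSL}(2,\mathbb{R}))$ such that $$X(\cdot+\alpha)^{-1}S_E^V(\cdot)X(\cdot)=\begin{pmatrix}1&\zeta\\0&1\end{pmatrix}.$$ Then the following holds: (1) If $|X|_R^{14}\zeta^\kappa\le10^{-5}D_{\alpha,R}^{-4}$, then $\zeta^{1+\kappa}\le|G(V)|\le\zeta^{1-\kappa}$. (2) In particular, for $\alpha\in\mathrm{DC}_d(\gamma,\tau)$, if $|X|_R^{14}\zeta^\kappa\le10^{-5}D_\tau^{-4}\gamma^{12}R^{4(4\tau+1)}$, then $\zeta^{1+\kappa}\le|G(V)|\le\zeta^{1-\kappa}$.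
   Context: $\mathbb{T}^d=(\mathbb{R}/\mathbb{Z})^d$; $(H_{V,\alpha,\theta}u)_n=u_{n+1}+u_{n-1}+V(\theta+n\alpha)u_n$ on $\ell^2(\mathbb{Z})$, with $\theta$-independent spectrum $\Sigma_{V,\alpha}$. A spectral gap is a bounded connected component $G(V)$ of $\mathbb{R}\setminus\Sigma_{V,\alpha}$; $|G(V)|$ is its length. $S_E^V(x)=\begin{pmatrix}E-V(x)&-1\\1&0\end{pmatrix}$. $C_R^\omega(\mathbb{T}^d,\cdot)$: analytic maps on $\mathbb{T}^d$ with bounded analytic extension to $\{|\Im x|<R\}$ (each coordinate); $|X|_R=\sup_{|\Im x|<R}|X(x)|$ (matrix operator norm). $|n|=\sum_j|n_j|$, $\|x\|_{\mathbb{T}}=\inf_{j\in\mathbb{Z}}|x-j|$. $\beta(\alpha)=\limsup_{|k|\to\infty}\frac1{|k|}\ln\frac1{\|\langle k,\alpha\rangle\|_{\mathbb{T}}}$, $k\in\mathbb{Z}^d\setminus\{0\}$. With $\beta=\beta(\alpha)$, $$D_{\alpha,R}=2+40\sum_{n\in\mathbb{Z}^d\setminus\{0\}}\frac{e^{-(R+3\beta)|n|/2}}{|e^{2\pi\mathrm{i}\langle n,\alpha\rangle}-1|^3},\qquad D_\tau=2^{4\tau+9}\,\Gamma(4\tau+2)$$ ($\Gamma$ is the Gamma function; $D_{\alpha,R}$ is finite when $R>3\beta$). $\mathrm{DC}_d(\gamma,\tau)=\{x\in\mathbb{R}^d:\inf_{j\in\mathbb{Z}}|\langle n,x\rangle-j|>\gamma|n|^{-\tau}\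 \forall n\in\mathbb{Z}^d\setminus\{0\}\}$, $\gamma>0,\tau>d-1$. *)

theory Defs
  imports "HOL-Analysis.Analysis"
begin

text \<open>Functions on the torus \<open>(R/Z)^d\<close> are functions on \<open>real^'d\<close> that are invariant under
  integer translations, where \<open>d = CARD('d) \<ge> 1\<close>.\<close>

definition int_vec :: "int^'d \<Rightarrow> real^'d" where
  "int_vec n = (\<chi> j. real_of_int (n $ j))"

definition l1_norm :: "int^'d \<Rightarrow> int" where
  "l1_norm n = (\<Sum>j\<in>UNIV. \<bar>n $ j\<bar>)"

definition torus_dist :: "real \<Rightarrow> real" where
  "torus_dist x = (INF j::int. \<bar>x - real_of_int j\<bar>)"

definition rationally_independent_with_one :: "real^'d \<Rightarrow> bool" where
  "rationally_independent_with_one \<alpha> \<longleftrightarrow>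
     (\<forall>(q0::rat) (q::rat^'d).
        of_rat q0 + (\<Sum>j\<in>UNIV. of_rat (q $ j) * \<alpha> $ j) = (0::real) \<longrightarrow> q0 = 0 \<and> q = 0)"

text \<open>The limes superior along \<open>l1_norm k \<longrightarrow> \<infinity>\<close>; it may be infinite. The index \<open>k = 0\<close> is
  irrelevant to the limit.\<close>

definition beta :: "real^'d \<Rightarrow> ereal" where
  "beta \<alpha> = Limsup (filtercomap l1_norm at_top)
     (\<lambda>k. ereal (1 / real_of_int (l1_norm k) * ln (1 / torus_dist (int_vec k \<bullet> \<alpha>))))"

text \<open>Only meaningful for \<open>3 * beta \<alpha> < R\<close> and \<open>\<alpha>\<close> rationally independent with 1; then \<open>beta \<alpha>\<close>
  is finite and the series converges.\<close>

definition D_alpha :: "real^'d \<Rightarrow> real \<Rightarrow> real" where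
  "D_alpha \<alpha> R = 2 + 40 * (\<Sum>\<^sub>\<infinity>n\<in>UNIV - {0::int^'d}.
     exp (- (R + 3 * real_of_ereal (beta \<alpha>)) * real_of_int (l1_norm n) / 2)
       / cmod (exp (2 * of_real pi * \<i> * of_real (int_vec n \<bullet> \<alpha>)) - 1) ^ 3)"

definition D_tau :: "real \<Rightarrow> real" where
  "D_tau \<tau> = 2 powr (4 * \<tau> + 9) * Gamma (4 * \<tau> + 2)"

definition DC :: "real \<Rightarrow> real \<Rightarrow> (real^'d) set" where
  "DC \<gamma> \<tau> = {x. \<forall>n::int^'d. n \<noteq> 0 \<longrightarrow>
     torus_dist (int_vec n \<bullet> x) > \<gamma> * real_of_int (l1_norm n) powr (- \<tau>)}"


definition strip :: "real \<Rightarrow> (complex^'d) set" where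
  "strip R = {z. \<forall>j. \<bar>Im (z $ j)\<bar> < R}"

text \<open>Holomorphy in several variables: the Frechet derivative exists and is complex linear.\<close>

definition holomorphic_several :: "(complex^'d \<Rightarrow> complex) \<Rightarrow> (complex^'d) set \<Rightarrow> bool" where
  "holomorphic_several f S \<longleftrightarrow>
     (\<forall>z\<in>S. \<exists>D. (f has_derivative D) (at z) \<and> (\<forall>c v. D (c *s v) = c * D v))"

definition analytic_extension ::
    "real \<Rightarrow> (real^'d \<Rightarrow> real) \<Rightarrow> (complex^'d \<Rightarrow> complex) \<Rightarrow> bool" where
  "analytic_extension R f F \<longleftrightarrow>
     holomorphic_several F (strip R) \<and> bounded (F ` strip R) \<and>
     (\<forall>x. F (\<chi> j. of_real (x $ j)) = of_real (f x))"

text \<open>Real analytic functions on the torus: the union over \<open>h > 0\<close> of the functions with a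
  bounded analytic extension to the strip of width \<open>h\<close>.\<close>

definition C_omega_real :: "(real^'d \<Rightarrow> real) set" where
  "C_omega_real = {V. (\<forall>x n. V (x + int_vec n) = V x) \<and> (\<exists>h>0. \<exists>F. analytic_extension h V F)}"

definition matrix_analytic_extension ::
    "real \<Rightarrow> (real^'d \<Rightarrow> real^2^2) \<Rightarrow> (complex^'d \<Rightarrow> complex^2^2) \<Rightarrow> bool" where
  "matrix_analytic_extension R X F \<longleftrightarrow>
     (\<forall>i j. analytic_extension R (\<lambda>x. X x $ i $ j) (\<lambda>z. F z $ i $ j))"

text \<open>The class of a matrix of \<open>SL(2,R)\<close> in \<open>PSL(2,R) = SL(2,R)/{1,-1}\<close>.\<close>

definition PSL_class :: "real^2^2 \<Rightarrow> (real^2^2) set" where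
  "PSL_class A = {A, - A}"

text \<open>An analytic map from the torus to \<open>PSL(2,R)\<close> is given by a lift \<open>X\<close> to a map from
  \<open>real^'d\<close> to \<open>SL(2,R)\<close>. Such a lift exists since \<open>real^'d\<close> is simply connected, it is unique up
  to a global sign, and it is periodic in \<open>PSL(2,R)\<close>, that is, up to sign.\<close>

definition C_omega_PSL :: "real \<Rightarrow> (real^'d \<Rightarrow> real^2^2) set" where
  "C_omega_PSL R = {X. (\<forall>x. det (X x) = 1) \<and>
     (\<forall>x n. PSL_class (X (x + int_vec n)) = PSL_class (X x)) \<and>
     (\<exists>F. matrix_analytic_extension R X F)}"

text \<open>For \<open>R > 0\<close> the extension is determined on the strip by the identity theorem, hence the
  norm does not depend on the choice. Nor does it depend on the sign of the lift.\<close>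

definition strip_norm :: "real \<Rightarrow> (real^'d \<Rightarrow> real^2^2) \<Rightarrow> real" where
  "strip_norm R X =
     (let F = (SOME F. matrix_analytic_extension R X F) in SUP z\<in>strip R. onorm ((*v) (F z)))"


definition ell2 :: "(int \<Rightarrow> complex) set" where
  "ell2 = {u. (\<lambda>n. (cmod (u n))\<^sup>2) summable_on UNIV}"

definition ell2_norm :: "(int \<Rightarrow> complex) \<Rightarrow> real" where
  "ell2_norm u = sqrt (\<Sum>\<^sub>\<infinity>n. (cmod (u n))\<^sup>2)"

definition bounded_operator_ell2 :: "((int \<Rightarrow> complex) \<Rightarrow> int \<Rightarrow> complex) \<Rightarrow> bool" where
  "bounded_operator_ell2 T \<longleftrightarrow>
     (\<forall>u\<in>ell2. T u \<in> ell2) \<and>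
     (\<forall>u\<in>ell2. \<forall>v\<in>ell2. \<forall>a b. T (\<lambda>n. a * u n + b * v n) = (\<lambda>n. a * T u n + b * T v n)) \<and>
     (\<exists>C. \<forall>u\<in>ell2. ell2_norm (T u) \<le> C * ell2_norm u)"

definition spectrum_ell2 :: "((int \<Rightarrow> complex) \<Rightarrow> int \<Rightarrow> complex) \<Rightarrow> complex set" where
  "spectrum_ell2 A = {z. \<not> (\<exists>T. bounded_operator_ell2 T \<and>
     (\<forall>u\<in>ell2. T (\<lambda>n. A u n - z * u n) = u \<and> (\<lambda>n. A (T u) n - z * T u n) = u))}"

definition schroedinger ::
    "(real^'d \<Rightarrow> real) \<Rightarrow> real^'d \<Rightarrow> real^'d \<Rightarrow> (int \<Rightarrow> complex) \<Rightarrow> int \<Rightarrow> complex" where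
  "schroedinger V \<alpha> \<theta> u =
     (\<lambda>n. u (n + 1) + u (n - 1) + of_real (V (\<theta> + real_of_int n *\<^sub>R \<alpha>)) * u n)"

text \<open>The operator is self-adjoint, so its spectrum is real. For continuous \<open>V\<close> and rationally
  independent \<open>(1, \<alpha>)\<close> the spectrum does not depend on \<open>\<theta>\<close>.\<close>

definition Sigma_spec :: "(real^'d \<Rightarrow> real) \<Rightarrow> real^'d \<Rightarrow> real^'d \<Rightarrow> real set" where
  "Sigma_spec V \<alpha> \<theta> = {E. complex_of_real E \<in> spectrum_ell2 (schroedinger V \<alpha> \<theta>)}"

definition spectral_gap :: "(real^'d \<Rightarrow> real) \<Rightarrow> real^'d \<Rightarrow> real^'d \<Rightarrow> real set \<Rightarrow> bool" where
  "spectral_gap V \<alpha> \<theta> G \<longleftrightarrow> G \<in> components (- Sigma_spec V \<alpha> \<theta>) \<and> bounded G"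

definition cocycle_matrix :: "(real^'d \<Rightarrow> real) \<Rightarrow> real \<Rightarrow> real^'d \<Rightarrow> real^2^2" where
  "cocycle_matrix V E x = vector [vector [E - V x, - 1], vector [1, 0]]"

end

theory Submission
  imports Defs "HOL-Complex_Analysis.Complex_Analysis"
begin

text \<open>Along an orbit, \<open>X\<close> conjugates the cocycle at energy \<open>E + \<epsilon>\<close> to \<open>B + \<epsilon> P\<close> with
  \<open>B = [[1, \<zeta>], [0, 1]]\<close>. Solving the cohomological equation for the adjoint action of \<open>B\<close> costs at
  most three small divisors, and a conjugation by \<open>1 + \<epsilon> Y\<close> replaces \<open>P\<close> by its mean up to
  \<open>O(\<epsilon>\<^sup>2)\<close>. With \<open>p\<close>, \<open>q\<close>, \<open>r\<close> the means of \<open>X\<^sub>1\<^sub>1\<^sup>2\<close>, \<open>X\<^sub>1\<^sub>1 X\<^sub>1\<^sub>2\<close>, \<open>X\<^sub>1\<^sub>2\<^sup>2\<close>, the averaged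
  matrix is hyperbolic essentially for \<open>- \<zeta> p / (p r - q\<^sup>2) < \<epsilon> < 0\<close>, and \<open>p\<close> and \<open>p r - q\<^sup>2\<close> are bounded
  below since \<open>det X = 1\<close>. Where it is hyperbolic (\<open>- \<zeta>\<^sup>1\<^sup>+\<^sup>\<kappa> < \<epsilon> < 0\<close>), the increments of the quadratic form
  \<open>w\<^sub>1 w\<^sub>2\<close> along solutions bound the operator from below, so \<open>E + \<epsilon>\<close> is outside the spectrum. Where it
  is elliptic, its eigenvectors give bounded approximate eigenfunctions with error \<open>O(\<epsilon>\<^sup>2)\<close>,
  so there is spectrum within \<open>\<bar>\<epsilon>\<bar>\<close> of \<open>E + \<epsilon>\<close>; applied to small \<open>\<epsilon> > 0\<close> this shows that the gap lies to the left
  of \<open>E\<close>, and applied to \<open>\<epsilon> = - \<zeta>\<^sup>1\<^sup>-\<^sup>\<kappa> / 2\<close> it bounds the length of the gap from above.\<close>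

text \<open>The averaged matrix has trace \<open>2 - \<epsilon> * \<zeta> * p\<close> and
  determinant \<open>1 + \<epsilon>\<^sup>2 * (p * r - q\<^sup>2)\<close>; comparing the squared
  trace with four times the determinant gives the stated threshold. It equals \<zeta> up to powers
  of the norm of \<open>X\<close>, and the factor \<open>\<zeta> powr \<kappa>\<close> in either
  bound outweighs these powers. Hence one averaging step with crude constants is enough. Three small
  divisors occur because a unipotent matrix acts on traceless 2x2 matrices by a unipotent map of
  order three: the equation is triangular, the lower left entry feeds the diagonal, the diagonal
  feeds the upper right entry, and each level is divided once more. No integral over the torus
  appears. Means are limits of Birkhoff averages, and bounded solutions of the cohomological
  equation let pointwise inequalities pass to means along one orbit. Symmetry of the operator enters
  twice: a lower bound implies invertibility, and absence of spectrum within |\<epsilon>| of an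
  energy yields the lower bound |\<epsilon>| there, which an error of second order
  contradicts.\<close>

no_notation fps_nth (infixl "$" 75)

section \<open>Spectrum of symmetric operators\<close>

text \<open>Squaring makes the operator positive: the inner product of \<open>w\<close> with
  \<open>A (A w)\<close> is the squared norm of \<open>A w\<close>, so a small multiple of
  \<open>A (A w)\<close> subtracted from \<open>w\<close> shrinks norms. The contraction principle
  then solves \<open>A (A x) = y\<close>, and \<open>A x\<close> is the preimage.\<close>

lemma symmetric_bounded_below_surj:
  fixes A :: "'a::{real_inner, complete_space} \<Rightarrow> 'a"
  assumes "bounded_linear A" and sym: "\<And>x y. A x \<bullet> y = x \<bullet> A y"
    and "c > 0" and below: "\<And>x. c * norm x \<le> norm (A x)"
  shows "\<exists>x. A x = y"
proof -
  interpret bounded_linear A by fact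
  obtain K where K: "K > 0" "\<And>x. norm (A x) \<le> norm x * K"
    using pos_bounded by blast
  define L where "L = max K c"
  have L: "L > 0" "c \<le> L" "norm (A x) \<le> L * norm x" for x
  proof -
    show "L > 0" "c \<le> L" using K by (auto simp: L_def)
    have "norm (A x) \<le> K * norm x" using K(2)[of x] by (simp add: mult.commute)
    also have "\<dots> \<le> L * norm x" by (rule mult_right_mono) (auto simp: L_def)
    finally show "norm (A x) \<le> L * norm x" .
  qed
  \<comment> \<open>With this step size the quadratic term of the squared norm takes back at most
    half of the gain \<open>2 * t\<close> times the squared norm of \<open>A w\<close>.\<close>
  define t where "t = 1 / L\<^sup>2"
  have t: "t > 0" "t * L\<^sup>2 = 1" "t * c\<^sup>2 > 0" "t * c\<^sup>2 \<le> 1"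
    using L \<open>c > 0\<close> by (auto simp: t_def divide_simps power_mono)
  define \<Phi> where "\<Phi> w = w - t *\<^sub>R (A (A w) - y)" for w
  have contr: "norm (w - t *\<^sub>R A (A w)) \<le> sqrt (1 - t * c\<^sup>2) * norm w" for w
  proof -
    have "norm (A (A w)) \<le> L * norm (A w)" by (rule L)
    hence "(norm (A (A w)))\<^sup>2 \<le> L\<^sup>2 * (norm (A w))\<^sup>2"
      by (metis norm_ge_zero power_mono power_mult_distrib)
    hence "t\<^sup>2 * (norm (A (A w)))\<^sup>2 \<le> t\<^sup>2 * (L\<^sup>2 * (norm (A w))\<^sup>2)"
      by (rule mult_left_mono) simp
    also have "\<dots> = t * (t * L\<^sup>2) * (norm (A w))\<^sup>2" by (simp add: power2_eq_square)
    also have "\<dots> = t * (norm (A w))\<^sup>2" using t by simp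
    finally have 1: "t\<^sup>2 * (norm (A (A w)))\<^sup>2 \<le> t * (norm (A w))\<^sup>2" .
    have "(c * norm w)\<^sup>2 \<le> (norm (A w))\<^sup>2"
      using below[of w] \<open>c > 0\<close> by (intro power_mono) auto
    hence 2: "t * (c\<^sup>2 * (norm w)\<^sup>2) \<le> t * (norm (A w))\<^sup>2"
      using t(1) by (simp add: power_mult_distrib)
    have "(norm (w - t *\<^sub>R A (A w)))\<^sup>2 = (norm w)\<^sup>2 - 2 * t * (w \<bullet> A (A w)) + t\<^sup>2 * (norm (A (A w)))\<^sup>2"
      unfolding power2_norm_eq_inner by (simp add: inner_diff inner_commute[of "A (A w)" w] power2_eq_square algebra_simps)
    also have "w \<bullet> A (A w) = (norm (A w))\<^sup>2"
      using sym[of w "A w"] by (simp add: power2_norm_eq_inner)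
    finally have "(norm (w - t *\<^sub>R A (A w)))\<^sup>2 \<le> (norm w)\<^sup>2 - t * (c\<^sup>2 * (norm w)\<^sup>2)"
      using 1 2 by linarith
    also have "\<dots> = (sqrt (1 - t * c\<^sup>2) * norm w)\<^sup>2"
      using t by (simp add: power_mult_distrib algebra_simps)
    finally show ?thesis
      by (rule power2_le_imp_le) (use t in simp)
  qed
  have "\<exists>!x. \<Phi> x = x"
  proof (rule banach_fix_type)
    show "0 \<le> sqrt (1 - t * c\<^sup>2)" "sqrt (1 - t * c\<^sup>2) < 1" using t by auto
    show "\<forall>x z. dist (\<Phi> x) (\<Phi> z) \<le> sqrt (1 - t * c\<^sup>2) * dist x z"
    proof (intro allI)
      fix x z
      have "\<Phi> x - \<Phi> z = (x - z) - t *\<^sub>R A (A (x - z))"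
        by (simp add: \<Phi>_def diff algebra_simps)
      thus "dist (\<Phi> x) (\<Phi> z) \<le> sqrt (1 - t * c\<^sup>2) * dist x z"
        using contr[of "x - z"] by (simp add: dist_norm)
    qed
  qed
  then obtain x where "\<Phi> x = x" by blast
  hence "A (A x) = y" using t(1) by (simp add: \<Phi>_def)
  thus ?thesis by blast
qed

text \<open>With \<open>m\<close> the best lower bound of \<open>A\<close>, the nonnegative operator \<open>B = (A - m) (A + m)\<close> satisfies
  \<open>\<parallel>B x\<parallel>\<^sup>2 \<le> K \<langle>B x, x\<rangle>\<close>; if \<open>A - m\<close> and \<open>A + m\<close> are bounded below, then so is \<open>\<langle>B x, x\<rangle>\<close>,
  which contradicts the choice of \<open>m\<close>.\<close>

lemma symmetric_bounded_below_interval: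
  fixes A :: "'a::real_inner \<Rightarrow> 'a"
  assumes "bounded_linear A" and sym: "\<And>x y. A x \<bullet> y = x \<bullet> A y"
    and below: "\<And>t. \<bar>t\<bar> < r \<Longrightarrow> \<exists>c>0. \<forall>x. c * norm x \<le> norm (A x - t *\<^sub>R x)"
  shows "r * norm x \<le> norm (A x)"
proof (rule ccontr)
  assume contra: "\<not> r * norm x \<le> norm (A x)"
  interpret bounded_linear A by fact
  define m where "m = Inf ((\<lambda>x. norm (A x) / norm x) ` (UNIV - {0}))"
  have x: "x \<noteq> 0" using contra by (auto simp: zero)
  have bdd: "bdd_below ((\<lambda>x. norm (A x) / norm x) ` (UNIV - {0}))"
    by (rule bdd_belowI2[of _ 0]) auto
  have "m \<le> norm (A x) / norm x"
    unfolding m_def using x by (intro cInf_lower bdd) auto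
  also have "\<dots> < r" using contra x by (simp add: divide_simps not_le mult.commute)
  finally have "m < r" .
  have m0: "m \<ge> 0" unfolding m_def using x by (intro cInf_greatest) auto
  have mle: "m * norm z \<le> norm (A z)" for z
  proof (cases "z = 0")
    case False
    hence "m \<le> norm (A z) / norm z"
      unfolding m_def by (intro cInf_lower bdd) auto
    thus ?thesis using False by (simp add: divide_simps)
  qed simp
  obtain c1 where c1: "c1 > 0" "\<And>x. c1 * norm x \<le> norm (A x - m *\<^sub>R x)"
    using below[of m] \<open>m < r\<close> m0 by auto
  obtain c2 where c2: "c2 > 0" "\<And>x. c2 * norm x \<le> norm (A x - (- m) *\<^sub>R x)"
    using below[of "- m"] \<open>m < r\<close> m0 by auto
  define B where "B x = A (A x) - m\<^sup>2 *\<^sub>R x" for x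
  have Blow: "c1 * c2 * norm z \<le> norm (B z)" for z
  proof -
    have "c1 * (c2 * norm z) \<le> c1 * norm (A z - (- m) *\<^sub>R z)"
      using c1 c2 by (intro mult_left_mono) auto
    also have "\<dots> \<le> norm (A (A z - (- m) *\<^sub>R z) - m *\<^sub>R (A z - (- m) *\<^sub>R z))"
      by (rule c1)
    also have "A (A z - (- m) *\<^sub>R z) - m *\<^sub>R (A z - (- m) *\<^sub>R z) = B z"
      by (simp add: B_def add diff scaleR algebra_simps power2_eq_square)
    finally show ?thesis by (simp add: mult.assoc)
  qed
  have Bin: "B z \<bullet> z = (norm (A z))\<^sup>2 - m\<^sup>2 * (norm z)\<^sup>2" for z
    using sym[of "A z" z] by (simp add: B_def inner_diff power2_norm_eq_inner)
  have Bpos: "B z \<bullet> z \<ge> 0" for z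
    unfolding Bin using power_mono[OF mle[of z], of 2] m0 by (simp add: power_mult_distrib)
  have Bsym: "B z \<bullet> w = z \<bullet> B w" for z w
    by (simp add: B_def inner_diff sym)
  have "bounded_linear B"
    unfolding B_def using \<open>bounded_linear A\<close>
    by (intro bounded_linear_sub bounded_linear_compose[OF \<open>bounded_linear A\<close>]) (auto intro: bounded_linear_scaleR_right)
  then interpret B: bounded_linear B .
  obtain K where K: "K > 0" "\<And>x. norm (B x) \<le> norm x * K" using B.pos_bounded by blast
  have BK: "(norm (B z))\<^sup>2 \<le> K * (B z \<bullet> z)" for z
  proof -
    \<comment> \<open>The nonnegative form is tested at the gradient step
      \<open>z - s *\<^sub>R B z\<close>; \<open>s = 1 / K\<close> balances the linear gain against
      the quadratic loss.\<close>
    define s where "s = 1 / K"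
    have s: "s > 0" "s * K = 1" using K by (auto simp: s_def)
    have "0 \<le> B (z - s *\<^sub>R B z) \<bullet> (z - s *\<^sub>R B z)" by (rule Bpos)
    also have "\<dots> = B z \<bullet> z - 2 * s * (norm (B z))\<^sup>2 + s\<^sup>2 * (B (B z) \<bullet> B z)"
      using Bsym[of "B z" z]
      unfolding power2_norm_eq_inner
      by (simp add: B.diff B.scaleR inner_diff power2_eq_square algebra_simps)
    also have "B (B z) \<bullet> B z \<le> norm (B (B z)) * norm (B z)" by (rule norm_cauchy_schwarz)
    also have "\<dots> \<le> (norm (B z) * K) * norm (B z)" using K by (intro mult_right_mono) auto
    also have "\<dots> = K * (norm (B z))\<^sup>2" by (simp add: power2_eq_square)
    finally have "0 \<le> B z \<bullet> z - 2 * s * (norm (B z))\<^sup>2 + s\<^sup>2 * (K * (norm (B z))\<^sup>2)"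
      by (simp add: mult_left_mono)
    also have "s\<^sup>2 * (K * (norm (B z))\<^sup>2) = s * (s * K) * (norm (B z))\<^sup>2"
      by (simp add: power2_eq_square)
    finally have "s * (norm (B z))\<^sup>2 \<le> B z \<bullet> z" using s by simp
    hence "K * (s * (norm (B z))\<^sup>2) \<le> K * (B z \<bullet> z)" using K by (intro mult_left_mono) auto
    thus ?thesis using s by (simp add: mult.assoc[symmetric] mult.commute)
  qed
  define d where "d = (c1 * c2)\<^sup>2 / K"
  have d: "d > 0" using c1 c2 K by (simp add: d_def)
  have "(m\<^sup>2 + d) * (norm z)\<^sup>2 \<le> (norm (A z))\<^sup>2" for z
  proof -
    have "(c1 * c2 * norm z)\<^sup>2 \<le> (norm (B z))\<^sup>2" using Blow[of z] c1 c2 by (intro power_mono) auto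
    also note BK[of z]
    finally have "d * (norm z)\<^sup>2 \<le> B z \<bullet> z"
      using K by (simp add: d_def divide_simps power_mult_distrib mult.commute)
    thus ?thesis by (simp add: Bin algebra_simps)
  qed
  hence le: "sqrt (m\<^sup>2 + d) * norm z \<le> norm (A z)" for z
    by (metis norm_ge_zero real_sqrt_abs real_sqrt_le_iff real_sqrt_mult abs_of_nonneg)
  have "sqrt (m\<^sup>2 + d) \<le> m"
    unfolding m_def
  proof (rule cInf_greatest)
    show "(\<lambda>x. norm (A x) / norm x) ` (UNIV - {0}) \<noteq> {}" using x by auto
    fix y assume "y \<in> (\<lambda>x. norm (A x) / norm x) ` (UNIV - {0})"
    then obtain z where "z \<noteq> 0" and y: "y = norm (A z) / norm z" by auto
    thus "sqrt ((Inf ((\<lambda>x. norm (A x) / norm x) ` (UNIV - {0})))\<^sup>2 + d) \<le> y"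
      using le[of z] unfolding y by (simp add: pos_le_divide_eq m_def)
  qed
  moreover have "m < sqrt (m\<^sup>2 + d)" using d m0 by (intro real_less_rsqrt) auto
  ultimately show False by simp
qed

section \<open>Square summable sequences as a complete inner product space\<close>

lemma ell2_zero: "(\<lambda>_. 0) \<in> ell2"
  by (simp add: ell2_def)

lemma ell2_cmult:
  assumes "u \<in> ell2"
  shows "(\<lambda>n. c * u n) \<in> ell2"
  using summable_on_cmult_right[of "\<lambda>n. (cmod (u n))\<^sup>2" UNIV "(cmod c)\<^sup>2"] assms
  by (simp add: ell2_def norm_mult power_mult_distrib)

lemma ell2_bounded_mult:
  assumes "u \<in> ell2" and "\<And>n. cmod (h n) \<le> B"
  shows "(\<lambda>n. h n * u n) \<in> ell2"
proof -
  have "(\<lambda>n. (cmod (h n * u n))\<^sup>2) summable_on UNIV"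
  proof (rule summable_on_comparison_test)
    show "(\<lambda>n. B\<^sup>2 * (cmod (u n))\<^sup>2) summable_on UNIV"
      using assms(1) by (intro summable_on_cmult_right) (simp add: ell2_def)
    show "(cmod (h n * u n))\<^sup>2 \<le> B\<^sup>2 * (cmod (u n))\<^sup>2" for n
      using assms(2)[of n] by (simp add: norm_mult power_mult_distrib mult_right_mono power_mono)
  qed simp
  thus ?thesis by (simp add: ell2_def)
qed

lemma ell2_add:
  assumes "u \<in> ell2" "v \<in> ell2"
  shows "(\<lambda>n. u n + v n) \<in> ell2"
proof -
  have "(\<lambda>n. (cmod (u n + v n))\<^sup>2) summable_on UNIV"
  proof (rule summable_on_comparison_test)
    show "(\<lambda>n. 2 * ((cmod (u n))\<^sup>2 + (cmod (v n))\<^sup>2)) summable_on UNIV"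
      using assms by (intro summable_on_cmult_right summable_on_add) (simp_all add: ell2_def)
    show "(cmod (u n + v n))\<^sup>2 \<le> 2 * ((cmod (u n))\<^sup>2 + (cmod (v n))\<^sup>2)" for n
    proof -
      have "(cmod (u n + v n))\<^sup>2 \<le> (cmod (u n) + cmod (v n))\<^sup>2"
        by (intro power_mono norm_triangle_ineq) simp
      also have "\<dots> \<le> 2 * ((cmod (u n))\<^sup>2 + (cmod (v n))\<^sup>2)"
        using sum_squares_bound[of "cmod (u n)" "cmod (v n)"] by (simp add: power2_sum)
      finally show ?thesis .
    qed
  qed simp
  thus ?thesis by (simp add: ell2_def)
qed

lemma ell2_shift:
  assumes "u \<in> ell2"
  shows "(\<lambda>n. u (n + k)) \<in> ell2"
proof -
  have "bij (\<lambda>n::int. n + k)"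
    by (rule bijI') (auto intro: exI[of _ "_ - k"])
  thus ?thesis
    using assms summable_on_reindex_bij_betw[of "\<lambda>n. n + k" UNIV UNIV "\<lambda>n. (cmod (u n))\<^sup>2"]
    by (simp add: ell2_def)
qed

lemma infsum_shift_int:
  fixes f :: "int \<Rightarrow> 'b::{comm_monoid_add, t2_space}"
  shows "(\<Sum>\<^sub>\<infinity>n. f (n + k)) = (\<Sum>\<^sub>\<infinity>n. f n)"
proof -
  have "bij (\<lambda>n::int. n + k)"
    by (rule bijI') (auto intro: exI[of _ "_ - k"])
  thus ?thesis
    using infsum_reindex_bij_betw[of "\<lambda>n. n + k" UNIV UNIV f] by simp
qed

lemma ell2_finite_support:
  assumes "finite {n. u n \<noteq> 0}"
  shows "u \<in> ell2"
proof -
  have "(\<lambda>n. (cmod (u n))\<^sup>2) summable_on UNIV \<longleftrightarrow> (\<lambda>n. (cmod (u n))\<^sup>2) summable_on {n. u n \<noteq> 0}"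
    by (rule summable_on_cong_neutral) auto
  thus ?thesis using assms by (simp add: ell2_def)
qed

text \<open>\<open>ell2\<close> is treated as a real Hilbert space, whose inner product is the real part of the complex one;
  this suffices since only real energies occur.\<close>

typedef l2seq = ell2
  morphisms seq_of of_seq
  using ell2_zero by blast

setup_lifting type_definition_l2seq

lemma l2_inner_summable:
  assumes "u \<in> ell2" "v \<in> ell2"
  shows "(\<lambda>n. u n \<bullet> v n) summable_on UNIV"
proof (rule abs_summable_summable, rule summable_on_comparison_test)
  show "(\<lambda>n. (cmod (u n))\<^sup>2 + (cmod (v n))\<^sup>2) summable_on UNIV"
    using assms by (intro summable_on_add) (simp_all add: ell2_def)
  show "norm (u n \<bullet> v n) \<le> (cmod (u n))\<^sup>2 + (cmod (v n))\<^sup>2" for n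
  proof -
    have "\<bar>u n \<bullet> v n\<bar> \<le> cmod (u n) * cmod (v n)" by (rule Cauchy_Schwarz_ineq2)
    also have "\<dots> \<le> (cmod (u n))\<^sup>2 + (cmod (v n))\<^sup>2"
      using sum_squares_bound[of "cmod (u n)" "cmod (v n)"]
            mult_nonneg_nonneg[OF norm_ge_zero[of "u n"] norm_ge_zero[of "v n"]]
      unfolding mult.assoc by linarith
    finally show ?thesis by simp
  qed
qed auto

instantiation l2seq :: real_vector
begin

lift_definition zero_l2seq :: l2seq is "\<lambda>_. 0" by (rule ell2_zero)
lift_definition plus_l2seq :: "l2seq \<Rightarrow> l2seq \<Rightarrow> l2seq" is "\<lambda>u v n. u n + v n" by (rule ell2_add)
lift_definition uminus_l2seq :: "l2seq \<Rightarrow> l2seq" is "\<lambda>u n. - u n"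
  by (simp add: ell2_def)
lift_definition minus_l2seq :: "l2seq \<Rightarrow> l2seq \<Rightarrow> l2seq" is "\<lambda>u v n. u n - v n"
  using ell2_add[OF _ ell2_cmult[where c = "-1"]] by simp
lift_definition scaleR_l2seq :: "real \<Rightarrow> l2seq \<Rightarrow> l2seq" is "\<lambda>c u n. of_real c * u n"
  by (rule ell2_cmult)
instance
proof
  fix x y z :: l2seq and a b :: real
  show "x + y + z = x + (y + z)" by transfer (simp add: add.assoc)
  show "x + y = y + x" by transfer (simp add: add.commute)
  show "0 + x = x" by transfer simp
  show "- x + x = 0" by transfer simp
  show "x - y = x + - y" by transfer simp
  show "a *\<^sub>R (x + y) = a *\<^sub>R x + a *\<^sub>R y" by transfer (simp add: distrib_left)
  show "(a + b) *\<^sub>R x = a *\<^sub>R x + b *\<^sub>R x" by transfer (simp add: distrib_right)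
  show "a *\<^sub>R b *\<^sub>R x = (a * b) *\<^sub>R x" by transfer (simp add: mult.assoc)
  show "1 *\<^sub>R x = x" by transfer simp
qed

end

instantiation l2seq :: real_inner
begin

lift_definition inner_l2seq :: "l2seq \<Rightarrow> l2seq \<Rightarrow> real" is "\<lambda>u v. \<Sum>\<^sub>\<infinity>n. u n \<bullet> v n" .
lift_definition norm_l2seq :: "l2seq \<Rightarrow> real" is ell2_norm .
definition dist_l2seq :: "l2seq \<Rightarrow> l2seq \<Rightarrow> real" where "dist_l2seq x y = norm (x - y)"
definition sgn_l2seq :: "l2seq \<Rightarrow> l2seq" where "sgn_l2seq x = x /\<^sub>R norm x"
definition uniformity_l2seq :: "(l2seq \<times> l2seq) filter" where
  "uniformity_l2seq = (INF e\<in>{0 <..}. principal {(x, y). dist x y < e})"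
definition open_l2seq :: "l2seq set \<Rightarrow> bool" where
  "open_l2seq U = (\<forall>x\<in>U. eventually (\<lambda>(x', y). x' = x \<longrightarrow> y \<in> U) uniformity)"

instance
proof
  fix x y z :: l2seq and a b :: real
  show "dist x y = norm (x - y)" by (rule dist_l2seq_def)
  show "sgn x = x /\<^sub>R norm x" by (rule sgn_l2seq_def)
  show "uniformity = (INF e\<in>{0 <..}. principal {(x, y::l2seq). dist x y < e})"
    by (rule uniformity_l2seq_def)
  show "open U = (\<forall>x\<in>U. eventually (\<lambda>(x', y). x' = x \<longrightarrow> y \<in> U) uniformity)" for U :: "l2seq set"
    by (rule open_l2seq_def)
  show "x \<bullet> y = y \<bullet> x" by transfer (simp add: inner_commute)
  show "(x + y) \<bullet> z = x \<bullet> z + y \<bullet> z"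
    by transfer (simp add: inner_add_left infsum_add l2_inner_summable)
  show "(a *\<^sub>R x) \<bullet> y = a * (x \<bullet> y)"
    by transfer (simp add: infsum_cmult_right' flip: scaleR_conv_of_real)
  show "0 \<le> x \<bullet> x" by transfer (simp add: infsum_nonneg)
  show "x \<bullet> x = 0 \<longleftrightarrow> x = 0"
  proof (transfer, safe)
    fix u assume u: "u \<in> ell2" and 0: "(\<Sum>\<^sub>\<infinity>n. u n \<bullet> u n) = 0"
    have "u n \<bullet> u n = 0" for n
      by (rule nonneg_infsum_le_0D[where A = UNIV and f = "\<lambda>n. u n \<bullet> u n"])
         (use 0 l2_inner_summable[OF u u] in auto)
    thus "u = (\<lambda>_. 0)" by auto
  qed simp
  show "norm x = sqrt (x \<bullet> x)"
    by transfer (simp add: ell2_norm_def power2_norm_eq_inner)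
qed

end

lemma norm_seq_of_le: "cmod (seq_of x n) \<le> norm x"
proof (transfer fixing: n)
  fix u assume u: "u \<in> ell2"
  have "(cmod (u n))\<^sup>2 = (\<Sum>\<^sub>\<infinity>k\<in>{n}. (cmod (u k))\<^sup>2)" by simp
  also have "\<dots> \<le> (\<Sum>\<^sub>\<infinity>k. (cmod (u k))\<^sup>2)"
    using u by (intro infsum_mono_neutral) (auto simp: ell2_def)
  finally show "cmod (u n) \<le> ell2_norm u"
    by (simp add: ell2_norm_def real_le_rsqrt)
qed

lemma ell2_norm_power2: "u \<in> ell2 \<Longrightarrow> (ell2_norm u)\<^sup>2 = (\<Sum>\<^sub>\<infinity>n. (cmod (u n))\<^sup>2)"
  by (simp add: ell2_norm_def infsum_nonneg)

lemma sum_le_ell2_norm: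
  assumes "u \<in> ell2" "finite F"
  shows "(\<Sum>n\<in>F. (cmod (u n))\<^sup>2) \<le> (ell2_norm u)\<^sup>2"
  using assms unfolding ell2_norm_power2[OF assms(1)]
  by (intro finite_sum_le_infsum) (auto simp: ell2_def)

lemma ell2_by_finite_sums:
  assumes "\<And>F. finite F \<Longrightarrow> (\<Sum>n\<in>F. (cmod (u n))\<^sup>2) \<le> B\<^sup>2" "B \<ge> 0"
  shows "u \<in> ell2" "ell2_norm u \<le> B"
proof -
  have s: "(\<lambda>n. (cmod (u n))\<^sup>2) summable_on UNIV"
    by (rule nonneg_bdd_above_summable_on) (use assms in \<open>auto intro!: bdd_aboveI2\<close>)
  thus "u \<in> ell2" by (simp add: ell2_def)
  have "(\<Sum>\<^sub>\<infinity>n. (cmod (u n))\<^sup>2) \<le> B\<^sup>2"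
    by (rule infsum_le_finite_sums) (use s assms in auto)
  thus "ell2_norm u \<le> B"
    using assms(2) by (simp add: ell2_norm_def real_le_lsqrt)
qed

instance l2seq :: complete_space
proof
  fix X :: "nat \<Rightarrow> l2seq" assume X: "Cauchy X"
  have "Cauchy (\<lambda>k. seq_of (X k) n)" for n
  proof (rule metric_CauchyI)
    fix e :: real assume "e > 0"
    then obtain M where M: "\<And>k l. k \<ge> M \<Longrightarrow> l \<ge> M \<Longrightarrow> dist (X k) (X l) < e"
      using X by (meson metric_CauchyD)
    have "dist (seq_of (X k) n) (seq_of (X l) n) \<le> dist (X k) (X l)" for k l
      using norm_seq_of_le[of "X k - X l" n] by (simp add: dist_norm minus_l2seq.rep_eq)
    thus "\<exists>M. \<forall>k\<ge>M. \<forall>l\<ge>M. dist (seq_of (X k) n) (seq_of (X l) n) < e"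
      using M by (meson le_less_trans)
  qed
  hence "\<forall>n. \<exists>l. (\<lambda>k. seq_of (X k) n) \<longlonglongrightarrow> l"
    by (simp add: Cauchy_convergent_iff convergent_def)
  then obtain u where u: "\<And>n. (\<lambda>k. seq_of (X k) n) \<longlonglongrightarrow> u n" by metis
  \<comment> \<open>Only pointwise limits are available so far. The Cauchy estimate is therefore
    passed to the limit in finite partial sums, with a bound that does not depend on the finite
    set.\<close>
  have fatou: "(\<Sum>n\<in>F. (cmod (seq_of (X k) n - u n))\<^sup>2) \<le> e\<^sup>2"
    if M: "\<And>k l. k \<ge> M \<Longrightarrow> l \<ge> M \<Longrightarrow> dist (X k) (X l) < e" and "k \<ge> M" "finite F" for M k e F
  proof (rule LIMSEQ_le_const2)
    show "(\<lambda>l. \<Sum>n\<in>F. (cmod (seq_of (X k) n - seq_of (X l) n))\<^sup>2)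
            \<longlonglongrightarrow> (\<Sum>n\<in>F. (cmod (seq_of (X k) n - u n))\<^sup>2)"
      by (intro tendsto_intros u)
    have "(\<Sum>n\<in>F. (cmod (seq_of (X k) n - seq_of (X l) n))\<^sup>2) \<le> e\<^sup>2" if "l \<ge> M" for l
    proof -
      have "(\<Sum>n\<in>F. (cmod (seq_of (X k - X l) n))\<^sup>2) \<le> (ell2_norm (seq_of (X k - X l)))\<^sup>2"
        by (rule sum_le_ell2_norm) (use \<open>finite F\<close> seq_of in auto)
      also have "\<dots> \<le> e\<^sup>2"
        using M[OF \<open>k \<ge> M\<close> \<open>l \<ge> M\<close>]
        by (intro power_mono) (auto simp: dist_norm norm_l2seq.rep_eq[symmetric])
      finally show ?thesis by (simp add: minus_l2seq.rep_eq)
    qed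
    thus "\<exists>N. \<forall>l\<ge>N. (\<Sum>n\<in>F. (cmod (seq_of (X k) n - seq_of (X l) n))\<^sup>2) \<le> e\<^sup>2" by blast
  qed
  obtain M1 where M1: "\<And>k l. k \<ge> M1 \<Longrightarrow> l \<ge> M1 \<Longrightarrow> dist (X k) (X l) < 1"
    using X by (meson metric_CauchyD zero_less_one)
  have "(\<lambda>n. seq_of (X M1) n - u n) \<in> ell2"
    by (rule ell2_by_finite_sums(1)[of _ 1]) (use fatou[OF M1] in auto)
  hence "(\<lambda>n. seq_of (X M1) n + (-1) * (seq_of (X M1) n - u n)) \<in> ell2"
    by (intro ell2_add ell2_cmult seq_of)
  hence u2: "u \<in> ell2" by simp
  have "X \<longlonglongrightarrow> of_seq u"
  proof (rule metric_LIMSEQ_I)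
    fix e :: real assume e: "e > 0"
    then obtain M where M: "\<And>k l. k \<ge> M \<Longrightarrow> l \<ge> M \<Longrightarrow> dist (X k) (X l) < e / 2"
      using X by (meson metric_CauchyD half_gt_zero)
    have "dist (X k) (of_seq u) < e" if "k \<ge> M" for k
    proof -
      have "ell2_norm (\<lambda>n. seq_of (X k) n - u n) \<le> e / 2"
        by (rule ell2_by_finite_sums(2)) (use fatou[OF M that] e in auto)
      thus ?thesis
        using e u2 by (simp add: dist_norm norm_l2seq.rep_eq minus_l2seq.rep_eq of_seq_inverse)
    qed
    thus "\<exists>M. \<forall>k\<ge>M. dist (X k) (of_seq u) < e" by blast
  qed
  thus "convergent X" by (auto simp: convergent_def)
qed

section \<open>Jacobi operators with bounded potential\<close>

definition jacobi :: "(int \<Rightarrow> real) \<Rightarrow> (int \<Rightarrow> complex) \<Rightarrow> int \<Rightarrow> complex" where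
  "jacobi W u = (\<lambda>n. u (n + 1) + u (n - 1) + of_real (W n) * u n)"

text \<open>For a symmetric operator this characterises the real energies outside the spectrum,
  without mention of an inverse.\<close>

definition bounded_below_at :: "(int \<Rightarrow> real) \<Rightarrow> real \<Rightarrow> bool" where
  "bounded_below_at W E \<longleftrightarrow>
     (\<exists>c>0. \<forall>u\<in>ell2. c * ell2_norm u \<le> ell2_norm (\<lambda>n. jacobi W u n - of_real E * u n))"

lemma not_in_spectrum_bounded_below:
  assumes "complex_of_real E \<notin> spectrum_ell2 (jacobi W)"
    and ell2: "\<And>u. u \<in> ell2 \<Longrightarrow> (\<lambda>n. jacobi W u n - of_real E * u n) \<in> ell2"
  shows "bounded_below_at W E"
proof -
  obtain T where T: "bounded_operator_ell2 T"
    and inv: "\<And>u. u \<in> ell2 \<Longrightarrow> T (\<lambda>n. jacobi W u n - of_real E * u n) = u"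
    using assms(1) by (auto simp: spectrum_ell2_def)
  obtain C where C: "\<And>u. u \<in> ell2 \<Longrightarrow> ell2_norm (T u) \<le> C * ell2_norm u"
    using T unfolding bounded_operator_ell2_def by blast
  define c where "c = 1 / (\<bar>C\<bar> + 1)"
  have "c * ell2_norm u \<le> ell2_norm (\<lambda>n. jacobi W u n - of_real E * u n)" if u: "u \<in> ell2" for u
  proof -
    let ?f = "\<lambda>n. jacobi W u n - of_real E * u n"
    have "ell2_norm u \<le> C * ell2_norm ?f"
      using C[OF ell2[OF u]] inv[OF u] by simp
    also have "\<dots> \<le> (\<bar>C\<bar> + 1) * ell2_norm ?f"
      by (rule mult_right_mono) (auto simp: ell2_norm_def infsum_nonneg)
    finally show ?thesis by (simp add: c_def divide_simps mult.commute)
  qed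
  thus ?thesis unfolding bounded_below_at_def by (intro exI[of _ c]) (auto simp: c_def)
qed

locale bounded_potential =
  fixes W :: "int \<Rightarrow> real" and B :: real
  assumes W_le: "\<And>n. \<bar>W n\<bar> \<le> B"
begin

lemma jacobi_minus_ell2:
  assumes u: "u \<in> ell2"
  shows "(\<lambda>n. jacobi W u n - of_real E * u n) \<in> ell2"
proof -
  have "(\<lambda>n. u (n + 1) + u (n + (-1)) + of_real (W n) * u n + (- of_real E) * u n) \<in> ell2"
    by (intro ell2_add ell2_shift ell2_cmult u ell2_bounded_mult[where B = B]) (simp add: W_le)
  thus ?thesis by (simp add: jacobi_def)
qed

definition op :: "real \<Rightarrow> l2seq \<Rightarrow> l2seq" where
  "op E x = of_seq (\<lambda>n. jacobi W (seq_of x) n - of_real E * seq_of x n)"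

lemma seq_of_op: "seq_of (op E x) = (\<lambda>n. jacobi W (seq_of x) n - of_real E * seq_of x n)"
  unfolding op_def by (rule of_seq_inverse) (rule jacobi_minus_ell2[OF seq_of])

lemma norm_op: "norm (op E x) = ell2_norm (\<lambda>n. jacobi W (seq_of x) n - of_real E * seq_of x n)"
  by (simp add: norm_l2seq.rep_eq seq_of_op)

lemma op_eq: "op E x = op F x + (F - E) *\<^sub>R x"
  by (subst seq_of_inject[symmetric])
     (simp only: seq_of_op plus_l2seq.rep_eq scaleR_l2seq.rep_eq, simp add: fun_eq_iff algebra_simps)

lemma W_minus_le: "cmod (of_real (W n - E)) \<le> B + \<bar>E\<bar>"
  unfolding norm_of_real using W_le[of n] by linarith

lemma bounded_below_at_iff:
  "bounded_below_at W E \<longleftrightarrow> (\<exists>c>0. \<forall>x. c * norm x \<le> norm (op E x))"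
proof -
  have "(\<forall>u\<in>ell2. P u) \<longleftrightarrow> (\<forall>x. P (seq_of x))" for P
    by (metis seq_of of_seq_inverse)
  thus ?thesis unfolding bounded_below_at_def by (simp add: seq_of_op norm_l2seq.rep_eq)
qed

text \<open>The two shifts are adjoint to each other, and the potential and the energy are
  real.\<close>

lemma op_symmetric: "op E x \<bullet> y = x \<bullet> op E y"
proof -
  define u v where "u = seq_of x" and "v = seq_of y"
  have [simp]: "u \<in> ell2" "v \<in> ell2" by (simp_all add: u_def v_def seq_of)
  have sh: "(\<lambda>n. u (n + k)) \<in> ell2" "(\<lambda>n. v (n + k)) \<in> ell2" for k
    by (simp_all add: ell2_shift)
  note sh' = sh[of "-1", simplified] sh[of 1]
  have W: "(\<lambda>n. of_real (W n - E) * u n) \<in> ell2" "(\<lambda>n. of_real (W n - E) * v n) \<in> ell2"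
    by (rule ell2_bounded_mult[OF _ W_minus_le]; simp)+
  have s: "(\<lambda>n. u (n + 1) \<bullet> v n) summable_on UNIV" "(\<lambda>n. u (n - 1) \<bullet> v n) summable_on UNIV"
     "(\<lambda>n. u n \<bullet> v (n + 1)) summable_on UNIV" "(\<lambda>n. u n \<bullet> v (n - 1)) summable_on UNIV"
     "(\<lambda>n. (of_real (W n - E) * u n) \<bullet> v n) summable_on UNIV"
     "(\<lambda>n. u n \<bullet> (of_real (W n - E) * v n)) summable_on UNIV"
    by (intro l2_inner_summable sh' W; simp)+
  have "op E x \<bullet> y = (\<Sum>\<^sub>\<infinity>n. u (n + 1) \<bullet> v n + u (n - 1) \<bullet> v n + (of_real (W n - E) * u n) \<bullet> v n)"
    unfolding inner_l2seq.rep_eq seq_of_op u_def v_def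
    by (intro infsum_cong) (simp add: jacobi_def algebra_simps flip: inner_add_left)
  also have "\<dots> = (\<Sum>\<^sub>\<infinity>n. u (n + 1) \<bullet> v n) + (\<Sum>\<^sub>\<infinity>n. u (n - 1) \<bullet> v n)
                  + (\<Sum>\<^sub>\<infinity>n. (of_real (W n - E) * u n) \<bullet> v n)"
    by (simp only: infsum_add summable_on_add s)
  also have "(\<Sum>\<^sub>\<infinity>n. u (n + 1) \<bullet> v n) = (\<Sum>\<^sub>\<infinity>n. u n \<bullet> v (n - 1))"
    using infsum_shift_int[of "\<lambda>n. u n \<bullet> v (n - 1)" 1] by simp
  also have "(\<Sum>\<^sub>\<infinity>n. u (n - 1) \<bullet> v n) = (\<Sum>\<^sub>\<infinity>n. u n \<bullet> v (n + 1))"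
    using infsum_shift_int[of "\<lambda>n. u n \<bullet> v (n + 1)" "-1"] by simp
  also have "(\<lambda>n. (of_real (W n - E) * u n) \<bullet> v n) = (\<lambda>n. u n \<bullet> (of_real (W n - E) * v n))"
    by (simp only: scaleR_conv_of_real[symmetric] inner_scaleR_left inner_scaleR_right)
  also have "(\<Sum>\<^sub>\<infinity>n. u n \<bullet> v (n - 1)) + (\<Sum>\<^sub>\<infinity>n. u n \<bullet> v (n + 1))
                  + (\<Sum>\<^sub>\<infinity>n. u n \<bullet> (of_real (W n - E) * v n))
      = (\<Sum>\<^sub>\<infinity>n. u n \<bullet> v (n - 1) + u n \<bullet> v (n + 1) + u n \<bullet> (of_real (W n - E) * v n))"
    by (simp only: infsum_add summable_on_add s)
  also have "\<dots> = x \<bullet> op E y"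
    unfolding inner_l2seq.rep_eq seq_of_op u_def v_def
    by (intro infsum_cong) (simp add: jacobi_def algebra_simps flip: inner_add_right)
  finally show ?thesis .
qed

lemma bounded_linear_op: "bounded_linear (op E)"
proof -
  define K where "K = 2 + (B + \<bar>E\<bar>)"
  have nshift: "ell2_norm (\<lambda>n. u (n + k)) = ell2_norm u" for u k
    using infsum_shift_int[of "\<lambda>n. (cmod (u n))\<^sup>2" k] by (simp add: ell2_norm_def)
  have nadd: "ell2_norm (\<lambda>n. u n + v n) \<le> ell2_norm u + ell2_norm v" if "u \<in> ell2" "v \<in> ell2" for u v
    using that
  proof -
    have "norm (of_seq u + of_seq v) \<le> norm (of_seq u) + norm (of_seq v)" by (rule norm_triangle_ineq)
    thus ?thesis using that by (simp add: norm_l2seq.rep_eq plus_l2seq.rep_eq of_seq_inverse)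
  qed
  show ?thesis
  proof (rule bounded_linear_intro)
    fix x y :: l2seq and r :: real
    show "op E (x + y) = op E x + op E y"
      by (subst seq_of_inject[symmetric])
         (simp add: seq_of_op plus_l2seq.rep_eq jacobi_def fun_eq_iff algebra_simps)
    show "op E (r *\<^sub>R x) = r *\<^sub>R op E x"
      by (subst seq_of_inject[symmetric])
         (simp add: seq_of_op scaleR_l2seq.rep_eq jacobi_def fun_eq_iff algebra_simps)
    define u where "u = seq_of x"
    have u: "u \<in> ell2" by (simp add: u_def seq_of)
    have W2: "(\<lambda>n. of_real (W n - E) * u n) \<in> ell2"
      by (rule ell2_bounded_mult[OF u W_minus_le])
    have B0: "B \<ge> 0" using W_le[of 0] by linarith
    have W3: "ell2_norm (\<lambda>n. of_real (W n - E) * u n) \<le> (B + \<bar>E\<bar>) * ell2_norm u"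
    proof (rule ell2_by_finite_sums(2))
      fix F :: "int set" assume "finite F"
      have "(\<Sum>n\<in>F. (cmod (of_real (W n - E) * u n))\<^sup>2) \<le> (\<Sum>n\<in>F. (B + \<bar>E\<bar>)\<^sup>2 * (cmod (u n))\<^sup>2)"
        unfolding norm_mult power_mult_distrib
        by (intro sum_mono mult_right_mono power_mono W_minus_le) auto
      also have "\<dots> = (B + \<bar>E\<bar>)\<^sup>2 * (\<Sum>n\<in>F. (cmod (u n))\<^sup>2)" by (simp add: sum_distrib_left)
      also have "\<dots> \<le> (B + \<bar>E\<bar>)\<^sup>2 * (ell2_norm u)\<^sup>2"
        by (intro mult_left_mono sum_le_ell2_norm u \<open>finite F\<close>) simp
      finally show "(\<Sum>n\<in>F. (cmod (of_real (W n - E) * u n))\<^sup>2) \<le> ((B + \<bar>E\<bar>) * ell2_norm u)\<^sup>2"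
        by (simp add: power_mult_distrib)
    qed (use B0 in \<open>simp add: ell2_norm_def infsum_nonneg\<close>)
    have "norm (op E x) = ell2_norm (\<lambda>n. (u (n + 1) + u (n + (-1))) + of_real (W n - E) * u n)"
      by (simp add: norm_op jacobi_def u_def algebra_simps)
    also have "\<dots> \<le> ell2_norm (\<lambda>n. u (n + 1) + u (n + (-1))) + ell2_norm (\<lambda>n. of_real (W n - E) * u n)"
      by (intro nadd ell2_add ell2_shift u W2)
    also have "ell2_norm (\<lambda>n. u (n + 1) + u (n + (-1))) \<le> ell2_norm (\<lambda>n. u (n + 1)) + ell2_norm (\<lambda>n. u (n + (-1)))"
      by (intro nadd ell2_shift u)
    finally have "norm (op E x) \<le> 2 * ell2_norm u + (B + \<bar>E\<bar>) * ell2_norm u"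
      unfolding nshift using W3 by linarith
    thus "norm (op E x) \<le> norm x * K"
      by (simp add: K_def norm_l2seq.rep_eq u_def algebra_simps)
  qed
qed

text \<open>A lower bound gives injectivity and bounds the inverse; surjectivity comes from
  symmetry. The Hilbert space in use is only real, so complex linearity of the inverse is recovered
  from its uniqueness.\<close>

lemma spectrum_iff: "complex_of_real E \<in> spectrum_ell2 (jacobi W) \<longleftrightarrow> \<not> bounded_below_at W E"
proof
  assume E: "complex_of_real E \<in> spectrum_ell2 (jacobi W)"
  show "\<not> bounded_below_at W E"
  proof
    assume "bounded_below_at W E"
    then obtain c where c: "c > 0" "\<And>x. c * norm x \<le> norm (op E x)"
      by (auto simp: bounded_below_at_iff)
    interpret A: bounded_linear "op E" by (rule bounded_linear_op)
    have "\<exists>x. op E x = y" for y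
      by (rule symmetric_bounded_below_surj[OF bounded_linear_op op_symmetric c])
    then obtain S where S: "\<And>y. op E (S y) = y" by metis
    have inj: "x = y" if "op E x = op E y" for x y
      using c(2)[of "x - y"] c(1) that by (simp add: A.diff mult_le_0_iff)
    define T where "T u = seq_of (S (of_seq u))" for u
    have SA: "S (op E x) = x" for x by (rule inj) (rule S)
    have T1: "T (\<lambda>n. jacobi W u n - of_real E * u n) = u" if u: "u \<in> ell2" for u
    proof -
      have "of_seq (\<lambda>n. jacobi W u n - of_real E * u n) = op E (of_seq u)"
        by (simp add: op_def of_seq_inverse u)
      thus ?thesis by (simp add: T_def SA of_seq_inverse u)
    qed
    have T2: "(\<lambda>n. jacobi W (T u) n - of_real E * T u n) = u" if u: "u \<in> ell2" for u
      using S[of "of_seq u"] seq_of_op[of E "S (of_seq u)"] by (simp add: T_def of_seq_inverse u)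
    have T3: "T u \<in> ell2" for u by (simp add: T_def seq_of)
    have lin: "T (\<lambda>n. a * u n + b * v n) = (\<lambda>n. a * T u n + b * T v n)"
      if u: "u \<in> ell2" and v: "v \<in> ell2" for u v a b
    proof -
      have w: "(\<lambda>n. a * T u n + b * T v n) \<in> ell2" by (intro ell2_add ell2_cmult T3)
      have "(\<lambda>n. jacobi W (\<lambda>n. a * T u n + b * T v n) n - of_real E * (a * T u n + b * T v n))
          = (\<lambda>n. a * (jacobi W (T u) n - of_real E * T u n) + b * (jacobi W (T v) n - of_real E * T v n))"
        by (simp add: jacobi_def fun_eq_iff algebra_simps)
      also have "\<dots> = (\<lambda>n. a * u n + b * v n)"
        using fun_cong[OF T2[OF u]] fun_cong[OF T2[OF v]] by simp
      finally show ?thesis using T1[OF w] by simp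
    qed
    have "bounded_operator_ell2 T"
      unfolding bounded_operator_ell2_def
    proof (intro conjI ballI allI)
      show "\<exists>C. \<forall>u\<in>ell2. ell2_norm (T u) \<le> C * ell2_norm u"
      proof (intro exI[of _ "1 / c"] ballI)
        fix u assume "u \<in> ell2"
        thus "ell2_norm (T u) \<le> 1 / c * ell2_norm u"
          using c(2)[of "S (of_seq u)"] c(1)
          by (simp add: S T_def norm_l2seq.rep_eq of_seq_inverse divide_simps mult.commute)
      qed
    qed (use T3 lin in auto)
    thus False using E T1 T2 by (auto simp: spectrum_ell2_def)
  qed
next
  show "complex_of_real E \<in> spectrum_ell2 (jacobi W)" if "\<not> bounded_below_at W E"
    using not_in_spectrum_bounded_below[OF _ jacobi_minus_ell2] that by blast
qed

lemma bounded_below_at_open: "open {E. bounded_below_at W E}"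
proof (rule openI, clarify)
  fix E assume "bounded_below_at W E"
  then obtain c where c: "c > 0" "\<And>x. c * norm x \<le> norm (op E x)"
    by (auto simp: bounded_below_at_iff)
  have "bounded_below_at W F" if "F \<in> ball E (c / 2)" for F
    unfolding bounded_below_at_iff
  proof (intro exI[of _ "c / 2"] conjI allI)
    fix x
    have "c * norm x \<le> norm (op F x) + norm ((F - E) *\<^sub>R x)"
      using c(2)[of x] norm_triangle_ineq[of "op F x" "(F - E) *\<^sub>R x"] unfolding op_eq[of E x F] by linarith
    also have "norm ((F - E) *\<^sub>R x) \<le> c / 2 * norm x"
      unfolding norm_scaleR using that
      by (intro mult_right_mono) (auto simp: dist_real_def abs_minus_commute)
    finally show "c / 2 * norm x \<le> norm (op F x)" by linarith
  qed (use c in simp)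
  thus "\<exists>e>0. ball E e \<subseteq> {E. bounded_below_at W E}" using c by (intro exI[of _ "c / 2"]) auto
qed

lemma bounded_below_interval:
  assumes "\<And>t. \<bar>t\<bar> < r \<Longrightarrow> bounded_below_at W (E + t)" and u: "u \<in> ell2"
  shows "r * ell2_norm u \<le> ell2_norm (\<lambda>n. jacobi W u n - of_real E * u n)"
proof -
  have "r * norm (of_seq u) \<le> norm (op E (of_seq u))"
  proof (rule symmetric_bounded_below_interval[OF bounded_linear_op op_symmetric])
    fix t assume "\<bar>t\<bar> < r"
    moreover have "op E x - t *\<^sub>R x = op (E + t) x" for x
      using op_eq[of E x "E + t"] by simp
    ultimately show "\<exists>c>0. \<forall>x. c * norm x \<le> norm (op E x - t *\<^sub>R x)"
      using assms(1) by (simp add: bounded_below_at_iff)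
  qed
  thus ?thesis using u unfolding norm_op by (simp add: norm_l2seq.rep_eq of_seq_inverse)
qed

text \<open>Sharp truncation to \<open>[-L, L]\<close> spoils the equation at four sites only, which is negligible
  against the square norm of order \<open>L\<close>.\<close>

lemma approximate_eigenfunction:
  assumes below: "\<And>t. \<bar>t\<bar> < r \<Longrightarrow> bounded_below_at W (E + t)" and "r > 0"
    and bdd: "\<And>n. cmod (u n) \<le> C"
    and approx: "\<And>n. cmod (jacobi W u n - of_real E * u n) \<le> \<eta>"
    and low: "\<And>n. (cmod (u n))\<^sup>2 + (cmod (u (n - 1)))\<^sup>2 \<ge> \<mu>"
  shows "r\<^sup>2 * \<mu> \<le> 2 * \<eta>\<^sup>2"
proof -
  define D where "D = (2 + (B + \<bar>E\<bar>)) * C"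
  have C0: "C \<ge> 0" using bdd[of 0] norm_ge_zero order_trans by blast
  have B0: "B \<ge> 0" using W_le[of 0] by linarith
  have main: "r\<^sup>2 * (real L * \<mu>) \<le> real (2 * L + 1) * \<eta>\<^sup>2 + 4 * D\<^sup>2" if L: "L \<ge> 1" for L :: nat
  proof -
    define I where "I = {- int L..int L}"
    define w where "w n = (if n \<in> I then u n else 0)" for n
    have w: "w \<in> ell2" by (rule ell2_finite_support) (rule finite_subset[of _ I], auto simp: w_def I_def)
    have wC: "cmod (w n) \<le> C" for n using bdd C0 by (simp add: w_def)
    let ?f = "\<lambda>n. jacobi W w n - of_real E * w n"
    have fell: "?f \<in> ell2" by (rule jacobi_minus_ell2[OF w])
    have fD: "cmod (?f n) \<le> D" for n
    proof -
      have "cmod (?f n) = cmod (w (n + 1) + w (n - 1) + of_real (W n - E) * w n)"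
        by (simp add: jacobi_def algebra_simps)
      also have "\<dots> \<le> cmod (w (n + 1)) + cmod (w (n - 1)) + \<bar>W n - E\<bar> * cmod (w n)"
        using norm_triangle_ineq[of "w (n + 1) + w (n - 1)" "of_real (W n - E) * w n"]
              norm_triangle_ineq[of "w (n + 1)" "w (n - 1)"]
        unfolding norm_mult norm_of_real by linarith
      also have "\<dots> \<le> C + C + (B + \<bar>E\<bar>) * C"
        using W_le[of n] B0 by (intro add_mono wC mult_mono) auto
      finally show ?thesis by (simp add: D_def algebra_simps)
    qed
    define J where "J = {- int L - 1, - int L, int L, int L + 1}"
    have in_eq: "?f n = jacobi W u n - of_real E * u n" if "n \<in> I - J" for n
      using that by (auto simp: jacobi_def w_def I_def J_def)
    have out: "?f n = 0" if "n \<notin> I \<union> J" for n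
      using that by (auto simp: jacobi_def w_def I_def J_def)
    have fin: "finite I" "finite J" by (auto simp: I_def J_def)
    have "(ell2_norm ?f)\<^sup>2 = (\<Sum>\<^sub>\<infinity>n. (cmod (?f n))\<^sup>2)" by (rule ell2_norm_power2[OF fell])
    also have "\<dots> = (\<Sum>\<^sub>\<infinity>n\<in>(I - J) \<union> J. (cmod (?f n))\<^sup>2)"
      by (rule infsum_cong_neutral) (use out in auto)
    also have "\<dots> = (\<Sum>n\<in>(I - J) \<union> J. (cmod (?f n))\<^sup>2)" using fin by simp
    also have "\<dots> = (\<Sum>n\<in>I - J. (cmod (?f n))\<^sup>2) + (\<Sum>n\<in>J. (cmod (?f n))\<^sup>2)"
      using fin by (intro sum.union_disjoint) auto
    also have "(\<Sum>n\<in>I - J. (cmod (?f n))\<^sup>2) \<le> (\<Sum>n\<in>I - J. \<eta>\<^sup>2)"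
      by (intro sum_mono power_mono) (use in_eq approx in auto)
    also have "\<dots> \<le> real (card I) * \<eta>\<^sup>2"
      using fin card_mono[of I "I - J"] by (simp add: mult_right_mono)
    also have "(\<Sum>n\<in>J. (cmod (?f n))\<^sup>2) \<le> (\<Sum>n\<in>J. D\<^sup>2)"
      by (intro sum_mono power_mono fD) simp
    also have "\<dots> \<le> 4 * D\<^sup>2"
      using L by (simp add: J_def card_insert_if mult_right_mono)
    finally have up: "(ell2_norm ?f)\<^sup>2 \<le> real (2 * L + 1) * \<eta>\<^sup>2 + 4 * D\<^sup>2"
      by (simp add: I_def add.commute)
    have low': "\<mu> \<le> (cmod (u (m + 1)))\<^sup>2 + (cmod (u m))\<^sup>2" for m
      using low[of "m + 1"] by simp
    \<comment> \<open>The pairs \<open>g k\<close>, \<open>g k + 1\<close> with \<open>k < L\<close>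
      are disjoint and cover all of \<open>I\<close> except its right end, so the lower bound for
      neighbours adds up to \<open>L * \<mu>\<close>.\<close>
    define g where "g k = 2 * int k - int L" for k
    have inj: "inj_on g {..<L}" "inj_on (\<lambda>k. g k + 1) {..<L}" by (auto simp: inj_on_def g_def)
    have disj: "(\<lambda>k. g k + 1) ` {..<L} \<inter> g ` {..<L} = {}"
    proof -
      have "g k + 1 \<noteq> g l" for k l unfolding g_def by presburger
      thus ?thesis by blast
    qed
    have "real L * \<mu> = (\<Sum>k<L. \<mu>)" by simp
    also have "\<dots> \<le> (\<Sum>k<L. (cmod (u (g k + 1)))\<^sup>2 + (cmod (u (g k)))\<^sup>2)"
      by (intro sum_mono low')
    also have "\<dots> = (\<Sum>n\<in>(\<lambda>k. g k + 1) ` {..<L}. (cmod (u n))\<^sup>2) + (\<Sum>n\<in>g ` {..<L}. (cmod (u n))\<^sup>2)"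
      by (simp add: sum.distrib sum.reindex inj)
    also have "\<dots> = (\<Sum>n\<in>(\<lambda>k. g k + 1) ` {..<L} \<union> g ` {..<L}. (cmod (u n))\<^sup>2)"
      by (rule sum.union_disjoint[symmetric]) (use disj in auto)
    also have "\<dots> \<le> (\<Sum>n\<in>I. (cmod (u n))\<^sup>2)"
      by (intro sum_mono2) (auto simp: I_def g_def)
    also have "\<dots> = (\<Sum>n\<in>I. (cmod (w n))\<^sup>2)" by (intro sum.cong) (auto simp: w_def)
    also have "\<dots> \<le> (ell2_norm w)\<^sup>2" by (intro sum_le_ell2_norm w fin)
    finally have "r\<^sup>2 * (real L * \<mu>) \<le> r\<^sup>2 * (ell2_norm w)\<^sup>2" by (intro mult_left_mono) auto
    also have "\<dots> = (r * ell2_norm w)\<^sup>2" by (simp add: power_mult_distrib)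
    also have "\<dots> \<le> (ell2_norm ?f)\<^sup>2"
      using bounded_below_interval[OF below w] \<open>r > 0\<close>
      by (intro power_mono) (auto simp: ell2_norm_def infsum_nonneg)
    also note up
    finally show ?thesis .
  qed
  \<comment> \<open>After division by the length, the boundary term vanishes in the limit. The
    factor 2 remains because there are about two sites for each pair.\<close>
  have "r\<^sup>2 * \<mu> \<le> 2 * \<eta>\<^sup>2 + (\<eta>\<^sup>2 + 4 * D\<^sup>2) * inverse (real (Suc L))" for L :: nat
    using main[of "Suc L"] by (simp add: field_simps)
  moreover have "(\<lambda>L. 2 * \<eta>\<^sup>2 + (\<eta>\<^sup>2 + 4 * D\<^sup>2) * inverse (real (Suc L))) \<longlonglongrightarrow> 2 * \<eta>\<^sup>2 + (\<eta>\<^sup>2 + 4 * D\<^sup>2) * 0"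
    by (intro tendsto_intros LIMSEQ_inverse_real_of_nat)
  ultimately show ?thesis
    by (metis (no_types, lifting) LIMSEQ_le_const add.right_neutral mult_zero_right)
qed

end

section \<open>Perturbation of a parabolic cocycle\<close>

lemma norm_of_real_combination_le:
  assumes "\<bar>s\<bar> \<le> B" "\<bar>t\<bar> \<le> B"
  shows "cmod (of_real s * x + of_real t * y) \<le> B * (cmod x + cmod y)"
proof -
  have "cmod (of_real s * x + of_real t * y) \<le> \<bar>s\<bar> * cmod x + \<bar>t\<bar> * cmod y"
    using norm_triangle_ineq[of "of_real s * x" "of_real t * y"] by (simp add: norm_mult)
  also have "\<dots> \<le> B * cmod x + B * cmod y" by (intro add_mono mult_right_mono assms) auto
  finally show ?thesis by (simp add: distrib_left)
qed

text \<open>The letters \<open>a\<close>, \<open>a'\<close>, \<open>a''\<close> are consecutive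
  values. With \<open>A'\<close> the frame at the current and \<open>A''\<close> the frame at the
  next site, the two conclusions are the rows of \<open>S A' v = A'' (B + e P) v\<close>, where
  \<open>S\<close> is the transfer matrix at energy \<open>E + e\<close>. Here \<open>P\<close> is
  the inverse of \<open>A''\<close> times the corner matrix unit times \<open>A'\<close>; by the
  determinant identity its entries are quadratic in \<open>a'\<close>, \<open>b'\<close>
  alone.\<close>

lemma frame_step:
  fixes a a' a'' b b' b'' :: complex
  assumes det: "a'' * (b' - z * a') - b'' * a' = 1"
    and sa: "a'' = (E - W) * a' - a"
    and sb: "b'' = (E - W) * b' - b + z * a - z * a''"
  shows "a'' * ((1 + e * (a' * b' - z * (a' * a'))) * v1 + (z + e * (b' * b' - z * (a' * b'))) * v2)
          + b'' * (- e * (a' * a') * v1 + (1 - e * (a' * b')) * v2)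
        = (E + e - W) * (a' * v1 + b' * v2) - (a * v1 + (b - z * a) * v2)"
    (is "?l = ?r")
    and "a' * ((1 + e * (a' * b' - z * (a' * a'))) * v1 + (z + e * (b' * b' - z * (a' * b'))) * v2)
          + (b' - z * a') * (- e * (a' * a') * v1 + (1 - e * (a' * b')) * v2)
        = a' * v1 + b' * v2"
proof -
  have "?l = (a'' + e * a' * (a'' * (b' - z * a') - b'' * a')) * v1
           + (z * a'' + b'' + e * b' * (a'' * (b' - z * a') - b'' * a')) * v2"
    by (simp add: algebra_simps)
  also have "\<dots> = (a'' + e * a') * v1 + (z * a'' + b'' + e * b') * v2"
    unfolding det by simp
  also have "\<dots> = ?r" unfolding sb by (simp add: sa algebra_simps)
  finally show "?l = ?r" .
qed (simp add: algebra_simps)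

text \<open>The opposite passage, for an equation with forcing \<open>f\<close>:
  \<open>(v1, v2)\<close> is the inverse of the current frame applied to \<open>(u', u)\<close>, and
  \<open>f\<close> enters through the first column of the inverse of the next frame.\<close>

lemma frame_step_inverse:
  fixes a a' a'' b b' b'' :: complex
  assumes det: "a'' * (b' - z * a') - b'' * a' = 1"
    and det': "a' * (b - z * a) - b' * a = 1"
    and sa: "a'' = (E - W) * a' - a"
    and sb: "b'' = (E - W) * b' - b + z * a - z * a''"
    and u: "u'' = (E + e - W) * u' - u + f"
    and v1: "v1 = (b - z * a) * u' - b' * u"
    and v2: "v2 = - a * u' + a' * u"
  shows "a' * v1 + b' * v2 = u'"
    and "(b' - z * a') * u'' - b'' * u' = (1 + e * (a' * b' - z * (a' * a'))) * v1
            + (z + e * (b' * b' - z * (a' * b'))) * v2 + (b' - z * a') * f"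
    and "- a' * u'' + a'' * u' = - e * (a' * a') * v1 + (1 - e * (a' * b')) * v2 - a' * f"
proof -
  have "a' * v1 + b' * v2 = (a' * (b - z * a) - b' * a) * u'"
    by (simp add: v1 v2 algebra_simps)
  thus u': "a' * v1 + b' * v2 = u'" by (simp add: det')
  have "a * v1 + (b - z * a) * v2 = (a' * (b - z * a) - b' * a) * u"
    by (simp add: v1 v2 algebra_simps)
  hence u0: "a * v1 + (b - z * a) * v2 = u" by (simp add: det')
  define w1 where "w1 = (1 + e * (a' * b' - z * (a' * a'))) * v1 + (z + e * (b' * b' - z * (a' * b'))) * v2"
  define w2 where "w2 = - e * (a' * a') * v1 + (1 - e * (a' * b')) * v2"
  have 1: "u'' = a'' * w1 + b'' * w2 + f"
    using frame_step(1)[OF det sa sb, of e v1 v2] unfolding u' u0 w1_def w2_def u by simp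
  have 2: "u' = a' * w1 + (b' - z * a') * w2"
    using frame_step(2)[OF det sa sb, of e v1 v2] unfolding u' w1_def w2_def by simp
  have "(b' - z * a') * u'' - b'' * u' = (a'' * (b' - z * a') - b'' * a') * w1 + (b' - z * a') * f"
    unfolding 1 by (subst 2) (simp add: algebra_simps)
  thus "(b' - z * a') * u'' - b'' * u' = (1 + e * (a' * b' - z * (a' * a'))) * v1
            + (z + e * (b' * b' - z * (a' * b'))) * v2 + (b' - z * a') * f"
    by (simp only: det w1_def mult_1_left)
  have "- a' * u'' + a'' * u' = (a'' * (b' - z * a') - b'' * a') * w2 - a' * f"
    unfolding 1 by (subst 2) (simp add: algebra_simps)
  thus "- a' * u'' + a'' * u' = - e * (a' * a') * v1 + (1 - e * (a' * b')) * v2 - a' * f"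
    by (simp only: det w2_def mult_1_left)
qed

text \<open>With \<open>Y = [[y1, y2], [y3, - y1]]\<close> solving the cohomological equation
  \<open>Y\<^sup>+ B - B Y = P\<^sub>m - P\<close> for \<open>B = [[1, z], [0, 1]]\<close>, the conjugation by \<open>1 + e Y\<close> replaces
  \<open>B + e P\<close> by \<open>B + e P\<^sub>m\<close> up to \<open>e\<^sup>2 (Y\<^sup>+ P - P\<^sub>m Y)\<close>, and that by \<open>1 - e Y\<close> does the converse.\<close>

lemma conjugation_step:
  fixes y1 :: complex
  assumes "y1' = y1 + z * y3 - (q - z * p) + (qm - z * pm)"
    and "y2' = y2 - z * (y1' + y1) - (r - z * q) + (rm - z * qm)"
    and "y3' = y3 + p - pm"
  shows "(1 + e * y1') * ((1 + e * (q - z * p)) * v1 + (z + e * (r - z * q)) * v2)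
           + e * y2' * (- e * p * v1 + (1 - e * q) * v2)
       = (1 + e * (qm - z * pm)) * (v1 + e * (y1 * v1 + y2 * v2))
           + (z + e * (rm - z * qm)) * (v2 + e * (y3 * v1 - y1 * v2))
           + e\<^sup>2 * ((y1' * (q - z * p) - y2' * p - (qm - z * pm) * y1 - (rm - z * qm) * y3) * v1
                 + (y1' * (r - z * q) - y2' * q - (qm - z * pm) * y2 + (rm - z * qm) * y1) * v2)"
    and "e * y3' * ((1 + e * (q - z * p)) * v1 + (z + e * (r - z * q)) * v2)
           + (1 - e * y1') * (- e * p * v1 + (1 - e * q) * v2)
       = - e * pm * (v1 + e * (y1 * v1 + y2 * v2))
           + (1 - e * qm) * (v2 + e * (y3 * v1 - y1 * v2))
           + e\<^sup>2 * ((y3' * (q - z * p) + y1' * p + pm * y1 + qm * y3) * v1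
                 + (y3' * (r - z * q) + y1' * q + pm * y2 - qm * y1) * v2)"
    and "(1 + e * (q - z * p)) * (v1 - e * (y1 * v1 + y2 * v2))
           + (z + e * (r - z * q)) * (v2 - e * (y3 * v1 - y1 * v2))
       = (1 - e * y1') * ((1 + e * (qm - z * pm)) * v1 + (z + e * (rm - z * qm)) * v2)
           - e * y2' * (- e * pm * v1 + (1 - e * qm) * v2)
           + e\<^sup>2 * ((y1' * (qm - z * pm) - y2' * pm - (q - z * p) * y1 - (r - z * q) * y3) * v1
                 + (y1' * (rm - z * qm) - y2' * qm - (q - z * p) * y2 + (r - z * q) * y1) * v2)"
    and "- e * p * (v1 - e * (y1 * v1 + y2 * v2)) + (1 - e * q) * (v2 - e * (y3 * v1 - y1 * v2))
       = - e * y3' * ((1 + e * (qm - z * pm)) * v1 + (z + e * (rm - z * qm)) * v2)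
           + (1 + e * y1') * (- e * pm * v1 + (1 - e * qm) * v2)
           + e\<^sup>2 * ((y3' * (qm - z * pm) + y1' * pm + p * y1 + q * y3) * v1
                 + (y3' * (rm - z * qm) + y1' * qm + p * y2 - q * y1) * v2)"
  unfolding assms by (simp_all add: algebra_simps power2_eq_square)

text \<open>A matrix close to \<open>[[1, \<zeta>], [h, 1]]\<close> with positive off-diagonal
  entries is hyperbolic, and the form \<open>x \<bullet> y\<close> detects this: its increment is
  \<open>m11 * h\<close> and \<open>m12 * m22\<close> times the squared norms, plus a cross term.
  The increment is positive definite once the cross coefficient is a small multiple of
  \<open>h\<close>, since \<open>m12\<close> is at least of order \<open>h\<close>. Errors
  proportional to \<delta> are absorbed, and the forcing costs a multiple of
  \<open>F\<^sup>2 / h\<close>.\<close>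

lemma lyapunov_increment:
  fixes x y e1 e2 :: "'a::real_inner"
  assumes m11: "9/10 \<le> m11" "m11 \<le> 11/10" and m22: "9/10 \<le> m22" "m22 \<le> 11/10"
    and m12: "9/10 * \<zeta> \<le> m12" "m12 \<le> 11/10 * \<zeta>"
    and h: "0 < h" "h \<le> \<zeta>" "\<zeta> \<le> 1/50"
    and k: "\<bar>m11 * m22 + m12 * h - 1\<bar> \<le> h / 10"
    and e1: "norm e1 \<le> \<delta> * (norm x + norm y) + F" and e2: "norm e2 \<le> \<delta> * (norm x + norm y) + F"
    and \<delta>: "0 \<le> \<delta>" "\<delta> \<le> h / 1000" and "0 \<le> F"
  shows "h / 4 * ((norm x)\<^sup>2 + (norm y)\<^sup>2) - 100 / h * F\<^sup>2
     \<le> (m11 *\<^sub>R x + m12 *\<^sub>R y + e1) \<bullet> (h *\<^sub>R x + m22 *\<^sub>R y + e2) - x \<bullet> y"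
proof -
  define X Y S e where "X = norm x" and "Y = norm y" and "S = X + Y" and "e = \<delta> * S + F"
  have XY: "X \<ge> 0" "Y \<ge> 0" "S \<ge> 0" "e \<ge> 0"
    using \<delta> \<open>0 \<le> F\<close> by (simp_all add: X_def Y_def S_def e_def)
  have S2: "S\<^sup>2 \<le> 2 * (X\<^sup>2 + Y\<^sup>2)"
    using sum_squares_bound[of X Y] by (simp add: S_def power2_sum)
  have e: "norm e1 \<le> e" "norm e2 \<le> e" using e1 e2 by (simp_all add: e_def S_def X_def Y_def)
  have exp: "(m11 *\<^sub>R x + m12 *\<^sub>R y + e1) \<bullet> (h *\<^sub>R x + m22 *\<^sub>R y + e2) - x \<bullet> y
      = m11 * h * X\<^sup>2 + m12 * m22 * Y\<^sup>2 + (m11 * m22 + m12 * h - 1) * (x \<bullet> y)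
        + e1 \<bullet> (h *\<^sub>R x + m22 *\<^sub>R y) + (m11 *\<^sub>R x + m12 *\<^sub>R y) \<bullet> e2 + e1 \<bullet> e2"
    unfolding X_def Y_def power2_norm_eq_inner
    by (simp add: inner_add inner_commute[of y x] algebra_simps)
  have i: "\<bar>c \<bullet> d\<bar> \<le> C * D" if "norm c \<le> C" "norm d \<le> D" for c d :: 'a and C D
    using that Cauchy_Schwarz_ineq2[of c d]
    by (meson mult_mono norm_ge_zero order_trans)
  have n1: "norm (h *\<^sub>R x + m22 *\<^sub>R y) \<le> 11/10 * S"
  proof -
    have "norm (h *\<^sub>R x + m22 *\<^sub>R y) \<le> h * X + m22 * Y"
      using norm_triangle_ineq[of "h *\<^sub>R x" "m22 *\<^sub>R y"] h m22 by (simp add: X_def Y_def)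
    also have "\<dots> \<le> 11/10 * X + 11/10 * Y"
      using h m22 XY by (intro add_mono mult_right_mono) auto
    finally show ?thesis by (simp add: S_def)
  qed
  have n2: "norm (m11 *\<^sub>R x + m12 *\<^sub>R y) \<le> 11/10 * S"
  proof -
    have "norm (m11 *\<^sub>R x + m12 *\<^sub>R y) \<le> m11 * X + m12 * Y"
      using norm_triangle_ineq[of "m11 *\<^sub>R x" "m12 *\<^sub>R y"] m11 m12 h by (simp add: X_def Y_def)
    also have "\<dots> \<le> 11/10 * X + 11/10 * Y"
      using h m11 m12 XY by (intro add_mono mult_right_mono) auto
    finally show ?thesis by (simp add: S_def)
  qed
  have E1: "\<bar>e1 \<bullet> (h *\<^sub>R x + m22 *\<^sub>R y)\<bar> \<le> e * (11/10 * S)" by (rule i[OF e(1) n1])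
  have E2: "\<bar>(m11 *\<^sub>R x + m12 *\<^sub>R y) \<bullet> e2\<bar> \<le> 11/10 * S * e" by (rule i[OF n2 e(2)])
  have E3: "\<bar>e1 \<bullet> e2\<bar> \<le> e * e" by (rule i[OF e])
  have E4: "\<bar>(m11 * m22 + m12 * h - 1) * (x \<bullet> y)\<bar> \<le> h / 10 * (X * Y)"
    unfolding abs_mult
    using h by (intro mult_mono k) (auto simp: X_def Y_def Cauchy_Schwarz_ineq2)
  have E5: "X * Y \<le> (X\<^sup>2 + Y\<^sup>2) / 2" using sum_squares_bound[of X Y] by simp
  have T1: "9/10 * h * X\<^sup>2 \<le> m11 * h * X\<^sup>2"
    using m11 h by (intro mult_right_mono) auto
  have T2: "81/100 * h * Y\<^sup>2 \<le> m12 * m22 * Y\<^sup>2"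
  proof (rule mult_right_mono)
    have "81/100 * h \<le> (9/10 * \<zeta>) * (9/10)" using h by simp
    also have "\<dots> \<le> m12 * m22" using m12 m22 h by (intro mult_mono) auto
    finally show "81/100 * h \<le> m12 * m22" .
  qed simp
  define Q where "Q = X\<^sup>2 + Y\<^sup>2"
  have Q0: "Q \<ge> 0" by (simp add: Q_def)
  have h0: "h * Q \<ge> 0" using h Q0 by simp
  \<comment> \<open>Young's inequality with a weight: the part in \<open>S\<close> must stay a small
    fraction of \<open>h * Q\<close>, which puts a factor \<open>1 / h\<close> on
    \<open>F\<^sup>2\<close>.\<close>
  have SF: "S * F \<le> h / 10 * Q + 5 / h * F\<^sup>2"
  proof -
    have "0 \<le> (h / 10 * S - F)\<^sup>2" by simp
    hence "2 * (h / 10) * (S * F) \<le> (h / 10)\<^sup>2 * S\<^sup>2 + F\<^sup>2"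
      by (simp add: power2_eq_square algebra_simps)
    also have "(h / 10)\<^sup>2 * S\<^sup>2 \<le> (h / 10)\<^sup>2 * (2 * Q)"
      using S2 by (intro mult_left_mono) (auto simp: Q_def)
    finally have "2 * (h / 10) * (S * F) \<le> 2 * (h / 10) * (h / 10 * Q + 5 / h * F\<^sup>2)"
      using h by (simp add: power2_eq_square algebra_simps)
    thus ?thesis using h by (simp add: mult_le_cancel_left)
  qed
  have dS: "\<delta> * S\<^sup>2 \<le> h / 500 * Q"
  proof -
    have "\<delta> * S\<^sup>2 \<le> h / 1000 * (2 * Q)" using \<delta> S2 by (intro mult_mono) (auto simp: Q_def)
    thus ?thesis by (simp add: mult.commute)
  qed
  have eS: "e * S \<le> h / 500 * Q + (h / 10 * Q + 5 / h * F\<^sup>2)"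
  proof -
    have "e * S = \<delta> * S\<^sup>2 + S * F" by (simp add: e_def power2_eq_square algebra_simps)
    thus ?thesis using dS SF by linarith
  qed
  have ee: "e * e \<le> h / 500 * Q + 2 * F\<^sup>2"
  proof -
    have "e * e \<le> 2 * ((\<delta> * S)\<^sup>2 + F\<^sup>2)"
      using sum_squares_bound[of "\<delta> * S" F] by (simp add: e_def power2_eq_square algebra_simps)
    also have "(\<delta> * S)\<^sup>2 = \<delta> * (\<delta> * S\<^sup>2)" by (simp add: power2_eq_square)
    also have "\<dots> \<le> 1 / 2 * (h / 500 * Q)" by (rule mult_mono) (use \<delta> h dS in auto)
    finally show ?thesis by (simp add: mult.commute)
  qed
  have F: "11 / h * F\<^sup>2 + 2 * F\<^sup>2 \<le> 100 / h * F\<^sup>2"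
  proof -
    have "11 / h + 2 \<le> 100 / h" using h by (simp add: field_simps)
    from mult_right_mono[OF this, of "F\<^sup>2"] show ?thesis by (simp add: algebra_simps)
  qed
  have "9/10 * h * X\<^sup>2 + 81/100 * h * Y\<^sup>2 \<ge> 81/100 * (h * Q)"
    using h by (simp add: Q_def algebra_simps)
  moreover have "h / 10 * (X * Y) \<le> h / 10 * (Q / 2)"
    using E5 h by (intro mult_left_mono) (auto simp: Q_def)
  ultimately show ?thesis
    unfolding exp Q_def[symmetric, unfolded X_def Y_def]
    using T1 T2 E1 E2 E3 E4 eS ee F h0 unfolding abs_le_iff by (simp add: algebra_simps)
qed

text \<open>The discriminant is negative, so the eigenvalues are conjugate and the squared modulus
  of each is the determinant. The vector \<open>(l - m22, m21)\<close> is an eigenvector, nonzero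
  because \<open>l\<close> is not real.\<close>

lemma elliptic_eigenvector:
  fixes m11 m12 m21 m22 :: real
  assumes "(m11 + m22)\<^sup>2 < 4 * (m11 * m22 - m12 * m21)"
  obtains l z1 z2 :: complex
    where "(cmod l)\<^sup>2 = m11 * m22 - m12 * m21"
      and "of_real m11 * z1 + of_real m12 * z2 = l * z1"
      and "of_real m21 * z1 + of_real m22 * z2 = l * z2"
      and "cmod z1 + cmod z2 > 0"
proof -
  define d where "d = m11 * m22 - m12 * m21"
  define t where "t = (m11 + m22) / 2"
  define s where "s = sqrt (d - t\<^sup>2)"
  have s2: "s\<^sup>2 = d - t\<^sup>2" "s > 0"
    using assms by (auto simp: s_def d_def t_def power_divide)
  define l where "l = Complex t s"
  have l2: "l * l = of_real (m11 + m22) * l - of_real d"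
  proof -
    have "m11 + m22 = 2 * t" by (simp add: t_def)
    thus ?thesis using s2 by (simp add: l_def complex_eq_iff power2_eq_square)
  qed
  have "(cmod l)\<^sup>2 = d" by (simp add: l_def cmod_power2 s2)
  moreover have "of_real m11 * (l - of_real m22) + of_real m12 * of_real m21 = l * (l - of_real m22)"
    by (simp add: right_diff_distrib l2 d_def algebra_simps)
  moreover have "of_real m21 * (l - of_real m22) + of_real m22 * of_real m21 = l * of_real m21"
    by (simp add: algebra_simps)
  moreover have "cmod (l - of_real m22) > 0"
    using s2(2) by (auto simp: l_def complex_eq_iff)
  ultimately show thesis
    by (intro that[of l "l - of_real m22" "of_real m21"]) (auto simp: d_def add_pos_nonneg)
qed

text \<open>Summed over many sites, a coboundary leaves only its boundary values; being bounded, it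
  cannot make up for a fixed deficit at every site. This is how a pointwise inequality is averaged
  without an integral.\<close>

lemma bounded_telescope_mean:
  fixes c :: real and g :: "int \<Rightarrow> real"
  assumes "\<And>n. 1 \<le> c + (g (n + 1) - g n)" and "\<And>n. \<bar>g n\<bar> \<le> B"
  shows "1 \<le> c"
proof (rule ccontr)
  assume "\<not> 1 \<le> c"
  hence c: "1 - c > 0" by simp
  have "real N * (1 - c) \<le> g (int N) - g 0" for N
  proof (induction N)
    case (Suc N)
    thus ?case using assms(1)[of "int N"] by (simp add: algebra_simps)
  qed simp
  hence "real N * (1 - c) \<le> 2 * B" for N
    using assms(2)[of "int N"] assms(2)[of 0] by (smt (verit))
  thus False using reals_Archimedean3[OF c] by (meson not_le)
qed

text \<open>Splitting the determinant identity by \<open>2 x y \<le> s x\<^sup>2 + y\<^sup>2 / s\<close> and averaging, with \<open>b\<close>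
  replaced by \<open>b - t a\<close>, gives \<open>1 \<le> s p + (r - 2 t q + t\<^sup>2 p) / s + \<zeta> p\<close> for all \<open>s\<close> and \<open>t\<close>.\<close>

lemma mean_lower_bounds:
  fixes a b g1 g2 g3 :: "int \<Rightarrow> real" and \<zeta> K p q r C :: real
  assumes det: "\<And>n. a n * (b (n - 1) - \<zeta> * a (n - 1)) - b n * a (n - 1) = 1"
    and g1: "\<And>n. g1 (n + 1) = g1 n + a n * a n - p"
    and g2: "\<And>n. g2 (n + 1) = g2 n + a n * b n - q"
    and g3: "\<And>n. g3 (n + 1) = g3 n + b n * b n - r"
    and g_bound: "\<And>n. \<bar>g1 n\<bar> \<le> C" "\<And>n. \<bar>g2 n\<bar> \<le> C" "\<And>n. \<bar>g3 n\<bar> \<le> C"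
    and K: "1 \<le> K" "p \<le> K" "r \<le> K" and \<zeta>: "0 < \<zeta>" "\<zeta> * K \<le> 1 / 4"
  shows "1 / (5 * K) \<le> p" and "1 / 8 \<le> p * r - q\<^sup>2"
proof -
  have ineq: "1 \<le> s * p + (r - 2 * t * q + t * t * p) / s + \<zeta> * p" if s: "s > 0" for s t
  proof -
    define h where "h n = (s / 2 + \<zeta> / 2) * g1 n + (g3 n - 2 * t * g2 n + t * t * g1 n) / (2 * s)" for n
    \<comment> \<open>The determinant identity couples the sites \<open>n\<close> and
      \<open>n - 1\<close>, so the corrections of both are added.\<close>
    define G where "G n = h n + h (n - 1)" for n
    define y where "y n = b n - t * a n" for n
    have hstep: "h (n + 1) - h n = (s / 2 + \<zeta> / 2) * (a n * a n - p)
        + (y n * y n - (r - 2 * t * q + t * t * p)) / (2 * s)" for n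
      using s unfolding h_def g1 g2 g3 y_def by (simp add: field_simps)
    show ?thesis
    proof (rule bounded_telescope_mean)
      fix n
      have am: "x * z \<le> s / 2 * (x * x) + z * z / (2 * s)" for x z :: real
      proof -
        have "0 \<le> (s * x - z)\<^sup>2" by simp
        hence "2 * s * (x * z) \<le> s * s * (x * x) + z * z"
          by (simp add: power2_eq_square algebra_simps)
        also have "\<dots> = 2 * s * (s / 2 * (x * x) + z * z / (2 * s))"
          using s by (simp add: field_simps)
        finally show ?thesis using s by (simp add: mult_le_cancel_left)
      qed
      have "1 = a n * y (n - 1) + (- a (n - 1)) * y n - \<zeta> * (a n * a (n - 1))"
        using det[of n] by (simp add: y_def algebra_simps)
      also have "\<dots> \<le> (s / 2 * (a n * a n) + y (n - 1) * y (n - 1) / (2 * s))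
          + (s / 2 * (a (n - 1) * a (n - 1)) + y n * y n / (2 * s))
          + \<zeta> * ((a n * a n + a (n - 1) * a (n - 1)) / 2)"
      proof -
        have "0 \<le> (a n + a (n - 1))\<^sup>2" by simp
        hence "- (a n * a (n - 1)) \<le> (a n * a n + a (n - 1) * a (n - 1)) / 2"
          by (simp add: power2_eq_square algebra_simps)
        hence "\<zeta> * (- (a n * a (n - 1))) \<le> \<zeta> * ((a n * a n + a (n - 1) * a (n - 1)) / 2)"
          using \<zeta> by (intro mult_left_mono) auto
        thus ?thesis
          using am[of "a n" "y (n - 1)"] am[of "- a (n - 1)" "y n"] by simp
      qed
      also have "\<dots> = (s * p + (r - 2 * t * q + t * t * p) / s + \<zeta> * p) + (G (n + 1) - G n)"
      proof -
        have 1: "G (n + 1) - G n = (h (n + 1) - h n) + (h (n - 1 + 1) - h (n - 1))"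
          by (simp add: G_def)
        define c where "c = r - 2 * t * q + t * t * p"
        show ?thesis unfolding 1 hstep c_def[symmetric] using s by (simp add: field_simps)
      qed
      finally show "1 \<le> (s * p + (r - 2 * t * q + t * t * p) / s + \<zeta> * p) + (G (n + 1) - G n)" .
    next
      fix n
      define H where "H = (s / 2 + \<zeta> / 2) * C + (C + 2 * \<bar>t\<bar> * C + \<bar>t * t\<bar> * C) / (2 * s)"
      have hH: "\<bar>h n\<bar> \<le> H" for n
      proof -
        have "\<bar>g3 n - 2 * t * g2 n + t * t * g1 n\<bar> \<le> \<bar>g3 n\<bar> + 2 * \<bar>t\<bar> * \<bar>g2 n\<bar> + \<bar>t * t\<bar> * \<bar>g1 n\<bar>"
        proof -
          have "\<bar>2 * t * g2 n\<bar> = 2 * \<bar>t\<bar> * \<bar>g2 n\<bar>" "\<bar>t * t * g1 n\<bar> = \<bar>t * t\<bar> * \<bar>g1 n\<bar>"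
            by (simp_all add: abs_mult)
          thus ?thesis by linarith
        qed
        also have "\<dots> \<le> C + 2 * \<bar>t\<bar> * C + \<bar>t * t\<bar> * C"
          by (intro add_mono mult_left_mono g_bound) auto
        finally have 1: "\<bar>(g3 n - 2 * t * g2 n + t * t * g1 n) / (2 * s)\<bar>
            \<le> (C + 2 * \<bar>t\<bar> * C + \<bar>t * t\<bar> * C) / (2 * s)"
          using s by (simp add: divide_right_mono)
        have 2: "\<bar>(s / 2 + \<zeta> / 2) * g1 n\<bar> \<le> (s / 2 + \<zeta> / 2) * C"
          unfolding abs_mult using s \<zeta> g_bound(1)[of n] by (intro mult_mono) auto
        show ?thesis unfolding h_def H_def using 1 2 by (rule abs_triangle_ineq[THEN order_trans, OF add_mono, rotated])
      qed
      show "\<bar>G n\<bar> \<le> 2 * H"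
        unfolding G_def using hH[of n] hH[of "n - 1"] by linarith
    qed
  qed
  \<comment> \<open>With \<open>s = 2 * K\<close> the term in \<open>r\<close> takes at most one
    half, and the rest is a multiple of \<open>p\<close>.\<close>
  have "1 \<le> 2 * K * p + r / (2 * K) + \<zeta> * p"
    using ineq[of "2 * K" 0] K by simp
  moreover have "r / (2 * K) \<le> 1 / 2" using K by (simp add: field_simps)
  ultimately have p1: "1 \<le> (4 * K + 2 * \<zeta>) * p" by (simp add: algebra_simps)
  have "\<zeta> \<le> 1 / 4"
    using \<zeta>(2) mult_left_mono[OF K(1), of \<zeta>] \<zeta>(1) by linarith
  hence le: "4 * K + 2 * \<zeta> \<le> 5 * K" using K by simp
  have p0: "p > 0"
  proof (rule ccontr)
    assume "\<not> p > 0"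
    hence "(4 * K + 2 * \<zeta>) * p \<le> 0" using K \<zeta> by (intro mult_nonneg_nonpos) auto
    thus False using p1 by simp
  qed
  have "1 \<le> 5 * K * p" using p1 mult_right_mono[OF le less_imp_le[OF p0]] by linarith
  thus "1 / (5 * K) \<le> p" using K by (simp add: field_simps)
  \<comment> \<open>The choice \<open>t = q / p\<close> minimises the numerator, turning it into
    \<open>(p * r - q\<^sup>2) / p\<close>; \<open>s = 1 / (4 * p)\<close> makes the first term
    equal to 1/4.\<close>
  have "1 \<le> 1 / (4 * p) * p + (r - 2 * (q / p) * q + q / p * (q / p) * p) / (1 / (4 * p)) + \<zeta> * p"
    using ineq[of "1 / (4 * p)" "q / p"] p0 by simp
  also have "\<dots> = 1 / 4 + 4 * (p * r - q\<^sup>2) + \<zeta> * p"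
    using p0 by (simp add: field_simps power2_eq_square)
  also have "\<zeta> * p \<le> 1 / 4"
    using \<zeta>(2) mult_left_mono[OF K(2), of \<zeta>] \<zeta>(1) by linarith
  finally show "1 / 8 \<le> p * r - q\<^sup>2" by simp
qed

text \<open>A reducible cocycle along one orbit: the matrices
  \<open>A\<^sub>n = [[a\<^sub>n, b\<^sub>n], [a\<^sub>n\<^sub>-\<^sub>1, b\<^sub>n\<^sub>-\<^sub>1 - \<zeta> a\<^sub>n\<^sub>-\<^sub>1]]\<close> have determinant 1 and satisfy
  \<open>A\<^sub>n\<^sub>+\<^sub>1 [[1, \<zeta>], [0, 1]] = [[E - W\<^sub>n, -1], [1, 0]] A\<^sub>n\<close>. The numbers \<open>p\<close>, \<open>q\<close>, \<open>r\<close> are the means of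
  \<open>a\<^sup>2\<close>, \<open>a b\<close>, \<open>b\<^sup>2\<close>, and \<open>[[y1, y2], [y3, - y1]]\<close> solves the cohomological equation for the
  first-order term of the perturbation.\<close>

locale averaged_cocycle = bounded_potential W B for W B +
  fixes a b y1 y2 y3 :: "int \<Rightarrow> real" and E \<zeta> N p q r Y :: real
  assumes det: "a n * (b (n - 1) - \<zeta> * a (n - 1)) - b n * a (n - 1) = 1"
    and sol_a: "a (n + 1) = (E - W n) * a n - a (n - 1)"
    and sol_b: "b (n + 1) = (E - W n) * b n - b (n - 1) + \<zeta> * a (n - 1) - \<zeta> * a (n + 1)"
    and bound: "\<bar>a n\<bar> \<le> N" "\<bar>b n\<bar> \<le> N" "\<bar>b n - \<zeta> * a n\<bar> \<le> N"
    and means: "\<bar>p\<bar> \<le> N\<^sup>2" "\<bar>q\<bar> \<le> N\<^sup>2" "\<bar>r\<bar> \<le> N\<^sup>2"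
    and coh1: "y1 (n + 1) = y1 n + \<zeta> * y3 n - (a n * b n - \<zeta> * (a n * a n)) + (q - \<zeta> * p)"
    and coh2: "y2 (n + 1) = y2 n - \<zeta> * (y1 (n + 1) + y1 n) - (b n * b n - \<zeta> * (a n * b n)) + (r - \<zeta> * q)"
    and coh3: "y3 (n + 1) = y3 n + a n * a n - p"
    and Y_bound: "\<bar>y1 n\<bar> \<le> Y" "\<bar>y2 n\<bar> \<le> Y" "\<bar>y3 n\<bar> \<le> Y" "2 * N\<^sup>2 \<le> 3 * Y"
    and p_ge: "1 / (5 * N\<^sup>2) \<le> p" and gram: "1 / 8 \<le> p * r - q\<^sup>2"
    and N1: "1 \<le> N" and \<zeta>: "0 < \<zeta>" "\<zeta> \<le> 1 / 50"
begin

definition "K = N\<^sup>2"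

lemma K1: "1 \<le> K" using N1 by (simp add: K_def)
lemma Y_ge: "2 * K \<le> 3 * Y" using Y_bound(4) by (simp add: K_def)
lemma Y0: "Y > 0" using Y_ge K1 by simp

lemma det_complex:
  "of_real (a n) * (of_real (b (n - 1)) - of_real \<zeta> * of_real (a (n - 1)))
     - of_real (b n) * of_real (a (n - 1)) = (1 :: complex)"
  using arg_cong[OF det[of n], of complex_of_real] by simp

lemma sol_a_complex:
  "complex_of_real (a (n + 1)) = (of_real E - of_real (W n)) * of_real (a n) - of_real (a (n - 1))"
  using arg_cong[OF sol_a[of n], of complex_of_real] by simp

lemma sol_b_complex:
  "complex_of_real (b (n + 1)) = (of_real E - of_real (W n)) * of_real (b n) - of_real (b (n - 1))
     + of_real \<zeta> * of_real (a (n - 1)) - of_real \<zeta> * of_real (a (n + 1))"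
  using arg_cong[OF sol_b[of n], of complex_of_real] by simp

lemma coh_complex:
  "complex_of_real (y1 (n + 1)) = of_real (y1 n) + of_real \<zeta> * of_real (y3 n)
     - (of_real (a n) * of_real (b n) - of_real \<zeta> * (of_real (a n) * of_real (a n)))
     + (of_real q - of_real \<zeta> * of_real p)"
  "complex_of_real (y2 (n + 1)) = of_real (y2 n) - of_real \<zeta> * (of_real (y1 (n + 1)) + of_real (y1 n))
     - (of_real (b n) * of_real (b n) - of_real \<zeta> * (of_real (a n) * of_real (b n)))
     + (of_real r - of_real \<zeta> * of_real q)"
  "complex_of_real (y3 (n + 1)) = of_real (y3 n) + of_real (a n) * of_real (a n) - of_real p"
  using arg_cong[OF coh1[of n], of complex_of_real] arg_cong[OF coh2[of n], of complex_of_real]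
    arg_cong[OF coh3[of n], of complex_of_real] by simp_all

lemma quadratic_le: "\<bar>a n * a n\<bar> \<le> K" "\<bar>a n * b n\<bar> \<le> K" "\<bar>b n * b n\<bar> \<le> K"
proof -
  have "\<bar>x * y\<bar> \<le> K" if "\<bar>x\<bar> \<le> N" "\<bar>y\<bar> \<le> N" for x y
    unfolding K_def power2_eq_square abs_mult by (rule mult_mono) (use that N1 in auto)
  thus "\<bar>a n * a n\<bar> \<le> K" "\<bar>a n * b n\<bar> \<le> K" "\<bar>b n * b n\<bar> \<le> K"
    by (blast intro: bound)+
qed

lemma minus_zeta_le: "\<bar>u - \<zeta> * v\<bar> \<le> 3 / 2 * K" if "\<bar>u\<bar> \<le> K" "\<bar>v\<bar> \<le> K"
proof -
  have "\<bar>\<zeta> * v\<bar> \<le> 1 / 2 * K"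
    unfolding abs_mult using that \<zeta> by (intro mult_mono) auto
  thus ?thesis using that by (simp add: abs_if split: if_splits)
qed

lemma means': "\<bar>p\<bar> \<le> K" "\<bar>q\<bar> \<le> K" "\<bar>r\<bar> \<le> K"
  using means by (simp_all add: K_def)

lemma error_coefficient_le:
  assumes "\<bar>c1\<bar> \<le> 3 / 2 * K" "\<bar>c2\<bar> \<le> 3 / 2 * K" "\<bar>c3\<bar> \<le> 3 / 2 * K" "\<bar>c4\<bar> \<le> 3 / 2 * K"
    and "\<bar>t1\<bar> \<le> Y" "\<bar>t2\<bar> \<le> Y" "\<bar>t3\<bar> \<le> Y" "\<bar>t4\<bar> \<le> Y"
  shows "\<bar>t1 * c1\<bar> + \<bar>t2 * c2\<bar> + \<bar>c3 * t3\<bar> + \<bar>c4 * t4\<bar> \<le> 6 * K * Y"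
proof -
  have m: "\<bar>c * t\<bar> \<le> 3 / 2 * K * Y" "\<bar>t * c\<bar> \<le> 3 / 2 * K * Y" if "\<bar>c\<bar> \<le> 3 / 2 * K" "\<bar>t\<bar> \<le> Y" for c t
    using mult_mono[OF that] K1 by (simp_all add: abs_mult mult.commute)
  show ?thesis
    using m(2)[OF assms(1,5)] m(2)[OF assms(2,6)] m(1)[OF assms(3,7)] m(1)[OF assms(4,8)] by simp
qed

lemma gram_le: "p * r - q\<^sup>2 \<le> K\<^sup>2"
proof -
  have "p * r \<le> \<bar>p\<bar> * \<bar>r\<bar>" by (metis abs_ge_self abs_mult)
  also have "\<dots> \<le> K * K" by (rule mult_mono) (use means' K1 in auto)
  finally show ?thesis unfolding power2_eq_square using zero_le_square[of q] by linarith
qed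

text \<open>The entries of the second-order remainder in \<open>conjugation_step\<close>: the first
  four belong to the conjugation by \<open>1 - e Y\<close>, the last four to that by
  \<open>1 + e Y\<close>. Each consists of four products of an entry of \<open>Y\<close> with an
  entry of \<open>P\<close> or of its mean.\<close>

lemma quadratic_error_le:
  "\<bar>y1 m * (q - \<zeta> * p) - y2 m * p - (a n * b n - \<zeta> * (a n * a n)) * y1 n - (b n * b n - \<zeta> * (a n * b n)) * y3 n\<bar> \<le> 6 * K * Y"
  "\<bar>y1 m * (r - \<zeta> * q) - y2 m * q - (a n * b n - \<zeta> * (a n * a n)) * y2 n + (b n * b n - \<zeta> * (a n * b n)) * y1 n\<bar> \<le> 6 * K * Y"
  "\<bar>y3 m * (q - \<zeta> * p) + y1 m * p + (a n * a n) * y1 n + (a n * b n) * y3 n\<bar> \<le> 6 * K * Y"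
  "\<bar>y3 m * (r - \<zeta> * q) + y1 m * q + (a n * a n) * y2 n - (a n * b n) * y1 n\<bar> \<le> 6 * K * Y"
  "\<bar>y1 m * (a n * b n - \<zeta> * (a n * a n)) - y2 m * (a n * a n) - (q - \<zeta> * p) * y1 n - (r - \<zeta> * q) * y3 n\<bar> \<le> 6 * K * Y"
  "\<bar>y1 m * (b n * b n - \<zeta> * (a n * b n)) - y2 m * (a n * b n) - (q - \<zeta> * p) * y2 n + (r - \<zeta> * q) * y1 n\<bar> \<le> 6 * K * Y"
  "\<bar>y3 m * (a n * b n - \<zeta> * (a n * a n)) + y1 m * (a n * a n) + p * y1 n + q * y3 n\<bar> \<le> 6 * K * Y"
  "\<bar>y3 m * (b n * b n - \<zeta> * (a n * b n)) + y1 m * (a n * b n) + p * y2 n - q * y1 n\<bar> \<le> 6 * K * Y"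
proof -
  have big: "\<bar>c\<bar> \<le> 3 / 2 * K" if "\<bar>c\<bar> \<le> K" for c using that K1 by simp
  note c = big[OF means'(1)] big[OF means'(2)] big[OF means'(3)]
    big[OF quadratic_le(1)[of n]] big[OF quadratic_le(2)[of n]] big[OF quadratic_le(3)[of n]]
    minus_zeta_le[OF means'(2,1)] minus_zeta_le[OF means'(3,2)]
    minus_zeta_le[OF quadratic_le(2)[of n] quadratic_le(1)[of n]]
    minus_zeta_le[OF quadratic_le(3)[of n] quadratic_le(2)[of n]]
  note Yb = Y_bound(1-3)
  show "\<bar>y1 m * (q - \<zeta> * p) - y2 m * p - (a n * b n - \<zeta> * (a n * a n)) * y1 n - (b n * b n - \<zeta> * (a n * b n)) * y3 n\<bar> \<le> 6 * K * Y"
    by (rule order_trans[OF _ error_coefficient_le[OF c(7) c(1) c(9) c(10) Yb(1)[of m] Yb(2)[of m] Yb(1)[of n] Yb(3)[of n]]]) linarith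
  show "\<bar>y1 m * (r - \<zeta> * q) - y2 m * q - (a n * b n - \<zeta> * (a n * a n)) * y2 n + (b n * b n - \<zeta> * (a n * b n)) * y1 n\<bar> \<le> 6 * K * Y"
    by (rule order_trans[OF _ error_coefficient_le[OF c(8) c(2) c(9) c(10) Yb(1)[of m] Yb(2)[of m] Yb(2)[of n] Yb(1)[of n]]]) linarith
  show "\<bar>y3 m * (q - \<zeta> * p) + y1 m * p + (a n * a n) * y1 n + (a n * b n) * y3 n\<bar> \<le> 6 * K * Y"
    by (rule order_trans[OF _ error_coefficient_le[OF c(7) c(1) c(4) c(5) Yb(3)[of m] Yb(1)[of m] Yb(1)[of n] Yb(3)[of n]]]) linarith
  show "\<bar>y3 m * (r - \<zeta> * q) + y1 m * q + (a n * a n) * y2 n - (a n * b n) * y1 n\<bar> \<le> 6 * K * Y"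
    by (rule order_trans[OF _ error_coefficient_le[OF c(8) c(2) c(4) c(5) Yb(3)[of m] Yb(1)[of m] Yb(2)[of n] Yb(1)[of n]]]) linarith
  show "\<bar>y1 m * (a n * b n - \<zeta> * (a n * a n)) - y2 m * (a n * a n) - (q - \<zeta> * p) * y1 n - (r - \<zeta> * q) * y3 n\<bar> \<le> 6 * K * Y"
    by (rule order_trans[OF _ error_coefficient_le[OF c(9) c(4) c(7) c(8) Yb(1)[of m] Yb(2)[of m] Yb(1)[of n] Yb(3)[of n]]]) linarith
  show "\<bar>y1 m * (b n * b n - \<zeta> * (a n * b n)) - y2 m * (a n * b n) - (q - \<zeta> * p) * y2 n + (r - \<zeta> * q) * y1 n\<bar> \<le> 6 * K * Y"
    by (rule order_trans[OF _ error_coefficient_le[OF c(10) c(5) c(7) c(8) Yb(1)[of m] Yb(2)[of m] Yb(2)[of n] Yb(1)[of n]]]) linarith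
  show "\<bar>y3 m * (a n * b n - \<zeta> * (a n * a n)) + y1 m * (a n * a n) + p * y1 n + q * y3 n\<bar> \<le> 6 * K * Y"
    by (rule order_trans[OF _ error_coefficient_le[OF c(9) c(4) c(1) c(2) Yb(3)[of m] Yb(1)[of m] Yb(1)[of n] Yb(3)[of n]]]) linarith
  show "\<bar>y3 m * (b n * b n - \<zeta> * (a n * b n)) + y1 m * (a n * b n) + p * y2 n - q * y1 n\<bar> \<le> 6 * K * Y"
    by (rule order_trans[OF _ error_coefficient_le[OF c(10) c(5) c(1) c(2) Yb(3)[of m] Yb(1)[of m] Yb(2)[of n] Yb(1)[of n]]]) linarith
qed

text \<open>An eigenvector of the elliptic averaged matrix, carried back through the conjugation and
  the frame, solves the equation at \<open>E + \<epsilon>\<close> up to second order and neither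
  grows nor decays. If no spectrum were within |\<epsilon>| of that energy,
  \<open>approximate_eigenfunction\<close> would force
  \<open>1 \<le> 300 * K\<^sup>2 * Y * \<bar>\<epsilon>\<bar>\<close>.\<close>

lemma spectrum_near_elliptic:
  assumes ell: "(2 - \<epsilon> * \<zeta> * p)\<^sup>2 < 4 * (1 + \<epsilon>\<^sup>2 * (p * r - q\<^sup>2))"
    and \<epsilon>: "\<epsilon> \<noteq> 0" "300 * K\<^sup>2 * Y * \<bar>\<epsilon>\<bar> < 1"
  shows "\<exists>t. \<bar>t\<bar> < \<bar>\<epsilon>\<bar> \<and> \<not> bounded_below_at W (E + \<epsilon> + t)"
proof (rule ccontr)
  assume "\<not> ?thesis"
  hence below: "\<And>t. \<bar>t\<bar> < \<bar>\<epsilon>\<bar> \<Longrightarrow> bounded_below_at W (E + \<epsilon> + t)" by blast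
  define D where "D = p * r - q\<^sup>2"
  have D: "0 < D" "D \<le> K\<^sup>2" using gram gram_le by (auto simp: D_def)
  have KKY: "K * Y \<le> K\<^sup>2 * Y" using K1 Y0 by (simp add: power2_eq_square)
  have Y2: "Y \<le> K * Y" using K1 Y0 by simp
  have eps_Y: "\<bar>\<epsilon>\<bar> * Y \<le> 1 / 300" "\<bar>\<epsilon>\<bar> * (K * Y) \<le> 1 / 300" "\<bar>\<epsilon>\<bar> \<le> 1 / 200"
  proof -
    have "\<bar>\<epsilon>\<bar> * (K * Y) \<le> \<bar>\<epsilon>\<bar> * (K\<^sup>2 * Y)" by (intro mult_left_mono KKY) simp
    also have "\<dots> \<le> 1 / 300" using \<epsilon>(2) by (simp add: algebra_simps)
    finally show 1: "\<bar>\<epsilon>\<bar> * (K * Y) \<le> 1 / 300" .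
    have "\<bar>\<epsilon>\<bar> * Y \<le> \<bar>\<epsilon>\<bar> * (K * Y)" by (intro mult_left_mono Y2) simp
    thus 2: "\<bar>\<epsilon>\<bar> * Y \<le> 1 / 300" using 1 by simp
    have "\<bar>\<epsilon>\<bar> * (2 / 3) \<le> \<bar>\<epsilon>\<bar> * Y" using Y_ge K1 by (intro mult_left_mono) auto
    thus "\<bar>\<epsilon>\<bar> \<le> 1 / 200" using 2 by simp
  qed
  let ?c = complex_of_real
  define m11 m12 m21 m22 where "m11 = 1 + \<epsilon> * (q - \<zeta> * p)" and "m12 = \<zeta> + \<epsilon> * (r - \<zeta> * q)"
    and "m21 = - \<epsilon> * p" and "m22 = 1 - \<epsilon> * q"
  have dM: "m11 * m22 - m12 * m21 = 1 + \<epsilon>\<^sup>2 * D"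
    by (simp add: m11_def m12_def m21_def m22_def D_def power2_eq_square algebra_simps)
  have "m11 + m22 = 2 - \<epsilon> * \<zeta> * p" by (simp add: m11_def m22_def algebra_simps)
  hence "(m11 + m22)\<^sup>2 < 4 * (m11 * m22 - m12 * m21)" using ell unfolding dM D_def by simp
  then obtain l z1 z2 where l: "(cmod l)\<^sup>2 = 1 + \<epsilon>\<^sup>2 * D"
    and eig: "?c m11 * z1 + ?c m12 * z2 = l * z1" "?c m21 * z1 + ?c m22 * z2 = l * z2"
    and Z: "cmod z1 + cmod z2 > 0"
    unfolding dM[symmetric] by (rule elliptic_eigenvector)
  define Z where "Z = cmod z1 + cmod z2"
  have Z0: "Z > 0" using Z by (simp add: Z_def)
  have l0: "cmod l \<ge> 1" using l D by (intro power2_le_imp_le[of 1]) auto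
  \<comment> \<open>The determinant is \<open>1 + \<epsilon>\<^sup>2 * D\<close> and not 1. Moving
    the eigenvalue to the unit circle keeps the sequence bounded in both directions and changes the
    equation only to second order.\<close>
  define \<rho> where "\<rho> = l / ?c (cmod l)"
  have \<rho>: "cmod \<rho> = 1" using l0 by (auto simp: \<rho>_def norm_divide)
  have \<rho>l: "cmod (\<rho> - l) \<le> \<epsilon>\<^sup>2 * K\<^sup>2"
  proof -
    have "l = \<rho> * ?c (cmod l)" using l0 by (auto simp: \<rho>_def)
    hence "\<rho> - l = \<rho> * ?c (1 - cmod l)" by (simp add: algebra_simps)
    hence "cmod (\<rho> - l) = \<bar>1 - cmod l\<bar>" by (simp only: norm_mult norm_of_real \<rho> mult_1_left)
    also have "\<dots> \<le> cmod l * cmod l - 1" using l0 mult_left_mono[OF l0, of "cmod l"] by simp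
    also have "\<dots> = \<epsilon>\<^sup>2 * D" using l by (simp add: power2_eq_square)
    also have "\<dots> \<le> \<epsilon>\<^sup>2 * K\<^sup>2" by (intro mult_left_mono D) simp
    finally show ?thesis .
  qed
  \<comment> \<open>The eigenvector is carried back by \<open>1 - \<epsilon> Y\<close>, the inverse
    of the averaging conjugation to first order.\<close>
  define x1 where "x1 n = z1 - ?c \<epsilon> * (?c (y1 n) * z1 + ?c (y2 n) * z2)" for n
  define x2 where "x2 n = z2 - ?c \<epsilon> * (?c (y3 n) * z1 - ?c (y1 n) * z2)" for n
  define v1 where "v1 n = \<rho> powi n * x1 n" for n
  define v2 where "v2 n = \<rho> powi n * x2 n" for n
  have pw: "cmod (\<rho> powi n) = 1" for n by (simp add: norm_power_int \<rho>)
  have pw1: "\<rho> powi (n + 1) = \<rho> powi n * \<rho>" for n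
  proof -
    have "\<rho> \<noteq> 0" using \<rho> by auto
    thus ?thesis by (simp add: power_int_add)
  qed
  have xe: "cmod (x1 n - z1) \<le> Z / 300" "cmod (x2 n - z2) \<le> Z / 300" for n
  proof -
    have e: "\<bar>\<epsilon>\<bar> * (Y * Z) \<le> Z / 300" using mult_right_mono[OF eps_Y(1), of Z] Z0 by simp
    have "cmod (x1 n - z1) = \<bar>\<epsilon>\<bar> * cmod (?c (y1 n) * z1 + ?c (y2 n) * z2)"
      by (simp add: x1_def norm_mult)
    also have "\<dots> \<le> \<bar>\<epsilon>\<bar> * (Y * Z)" unfolding Z_def by (intro mult_left_mono norm_of_real_combination_le Y_bound) simp
    finally show "cmod (x1 n - z1) \<le> Z / 300" using e by simp
    have "cmod (x2 n - z2) = \<bar>\<epsilon>\<bar> * cmod (?c (y3 n) * z1 + ?c (- y1 n) * z2)"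
      by (simp add: x2_def norm_mult)
    also have "\<dots> \<le> \<bar>\<epsilon>\<bar> * (Y * Z)" unfolding Z_def by (intro mult_left_mono norm_of_real_combination_le) (simp_all add: Y_bound)
    finally show "cmod (x2 n - z2) \<le> Z / 300" using e by simp
  qed
  have vx: "cmod (v1 n) = cmod (x1 n)" "cmod (v2 n) = cmod (x2 n)" for n
    by (simp_all add: v1_def v2_def norm_mult pw)
  have vlow: "cmod (v1 n) + cmod (v2 n) \<ge> 99 / 100 * Z" for n
    using xe[of n] norm_triangle_ineq2[of z1 "z1 - x1 n"] norm_triangle_ineq2[of z2 "z2 - x2 n"] Z0
    unfolding vx by (simp add: Z_def norm_minus_commute)
  have xup: "cmod (x1 n) + cmod (x2 n) \<le> 101 / 100 * Z" for n
    using xe[of n] norm_triangle_ineq[of z1 "x1 n - z1"] norm_triangle_ineq[of z2 "x2 n - z2"] Z0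
    by (simp add: Z_def)
  define g1 where "g1 n = v1 (n + 1) - ((1 + ?c \<epsilon> * (?c (a n) * ?c (b n) - ?c \<zeta> * (?c (a n) * ?c (a n)))) * v1 n
      + (?c \<zeta> + ?c \<epsilon> * (?c (b n) * ?c (b n) - ?c \<zeta> * (?c (a n) * ?c (b n)))) * v2 n)" for n
  define g2 where "g2 n = v2 (n + 1) - (- ?c \<epsilon> * (?c (a n) * ?c (a n)) * v1 n
      + (1 - ?c \<epsilon> * (?c (a n) * ?c (b n))) * v2 n)" for n
  \<comment> \<open>Two remainder rows of size \<open>6 * K * Y\<close> account for 12; the
    normalisation of the eigenvalue, of size \<open>K\<^sup>2\<close> with
    \<open>K \<le> 3 / 2 * Y\<close>, fits into the other 3.\<close>
  define G where "G = 15 * K * Y * \<epsilon>\<^sup>2 * Z"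
  have g: "cmod (g1 n) + cmod (g2 n) \<le> G" for n
  proof -
    note cs = conjugation_step[OF coh_complex[of n], of "?c \<epsilon>" z1 z2]
    define E11 where "E11 = y1 (n+1) * (q - \<zeta> * p) - y2 (n+1) * p - (a n * b n - \<zeta> * (a n * a n)) * y1 n - (b n * b n - \<zeta> * (a n * b n)) * y3 n"
    define E12 where "E12 = y1 (n+1) * (r - \<zeta> * q) - y2 (n+1) * q - (a n * b n - \<zeta> * (a n * a n)) * y2 n + (b n * b n - \<zeta> * (a n * b n)) * y1 n"
    define E21 where "E21 = y3 (n+1) * (q - \<zeta> * p) + y1 (n+1) * p + (a n * a n) * y1 n + (a n * b n) * y3 n"
    define E22 where "E22 = y3 (n+1) * (r - \<zeta> * q) + y1 (n+1) * q + (a n * a n) * y2 n - (a n * b n) * y1 n"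
    have E: "\<bar>E11\<bar> \<le> 6 * K * Y" "\<bar>E12\<bar> \<le> 6 * K * Y" "\<bar>E21\<bar> \<le> 6 * K * Y" "\<bar>E22\<bar> \<le> 6 * K * Y"
      unfolding E11_def E12_def E21_def E22_def by (rule quadratic_error_le)+
    have eig': "(1 + ?c \<epsilon> * (?c q - ?c \<zeta> * ?c p)) * z1 + (?c \<zeta> + ?c \<epsilon> * (?c r - ?c \<zeta> * ?c q)) * z2 = l * z1"
      "- ?c \<epsilon> * ?c p * z1 + (1 - ?c \<epsilon> * ?c q) * z2 = l * z2"
      using eig by (simp_all add: m11_def m12_def m21_def m22_def)
    have c3: "(1 + ?c \<epsilon> * (?c (a n) * ?c (b n) - ?c \<zeta> * (?c (a n) * ?c (a n)))) * x1 n
        + (?c \<zeta> + ?c \<epsilon> * (?c (b n) * ?c (b n) - ?c \<zeta> * (?c (a n) * ?c (b n)))) * x2 n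
      = (1 - ?c \<epsilon> * ?c (y1 (n + 1))) * (l * z1) - ?c \<epsilon> * ?c (y2 (n + 1)) * (l * z2)
        + ?c (\<epsilon>\<^sup>2) * (?c E11 * z1 + ?c E12 * z2)"
      using cs(3)[unfolded eig'] by (simp add: x1_def x2_def E11_def E12_def)
    have c4: "- ?c \<epsilon> * (?c (a n) * ?c (a n)) * x1 n + (1 - ?c \<epsilon> * (?c (a n) * ?c (b n))) * x2 n
      = - ?c \<epsilon> * ?c (y3 (n + 1)) * (l * z1) + (1 + ?c \<epsilon> * ?c (y1 (n + 1))) * (l * z2)
        + ?c (\<epsilon>\<^sup>2) * (?c E21 * z1 + ?c E22 * z2)"
      using cs(4)[unfolded eig'] by (simp add: x1_def x2_def E21_def E22_def)
    have 1: "g1 n = \<rho> powi n * ((\<rho> - l) * x1 (n + 1) - ?c (\<epsilon>\<^sup>2) * (?c E11 * z1 + ?c E12 * z2))"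
    proof -
      have "g1 n = \<rho> powi n * (\<rho> * x1 (n + 1) - ((1 - ?c \<epsilon> * ?c (y1 (n + 1))) * (l * z1)
           - ?c \<epsilon> * ?c (y2 (n + 1)) * (l * z2)
           + ?c (\<epsilon>\<^sup>2) * (?c E11 * z1 + ?c E12 * z2)))"
        unfolding c3[symmetric] g1_def v1_def v2_def pw1 by (simp add: algebra_simps)
      also have "\<dots> = \<rho> powi n * ((\<rho> - l) * x1 (n + 1) - ?c (\<epsilon>\<^sup>2) * (?c E11 * z1 + ?c E12 * z2))"
        by (simp add: x1_def algebra_simps)
      finally show ?thesis .
    qed
    have 2: "g2 n = \<rho> powi n * ((\<rho> - l) * x2 (n + 1) - ?c (\<epsilon>\<^sup>2) * (?c E21 * z1 + ?c E22 * z2))"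
    proof -
      have "g2 n = \<rho> powi n * (\<rho> * x2 (n + 1) - (- ?c \<epsilon> * ?c (y3 (n + 1)) * (l * z1)
           + (1 + ?c \<epsilon> * ?c (y1 (n + 1))) * (l * z2)
           + ?c (\<epsilon>\<^sup>2) * (?c E21 * z1 + ?c E22 * z2)))"
        unfolding c4[symmetric] g2_def v1_def v2_def pw1 by (simp add: algebra_simps)
      also have "\<dots> = \<rho> powi n * ((\<rho> - l) * x2 (n + 1) - ?c (\<epsilon>\<^sup>2) * (?c E21 * z1 + ?c E22 * z2))"
        by (simp add: x2_def algebra_simps)
      finally show ?thesis .
    qed
    have b1: "cmod ((\<rho> - l) * x - ?c (\<epsilon>\<^sup>2) * e) \<le> \<epsilon>\<^sup>2 * K\<^sup>2 * cmod x + \<epsilon>\<^sup>2 * cmod e" for x e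
    proof -
      have "cmod ((\<rho> - l) * x - ?c (\<epsilon>\<^sup>2) * e) \<le> cmod (\<rho> - l) * cmod x + \<epsilon>\<^sup>2 * cmod e"
        using norm_triangle_ineq4[of "(\<rho> - l) * x" "?c (\<epsilon>\<^sup>2) * e"] by (simp add: norm_mult norm_power)
      thus ?thesis using mult_right_mono[OF \<rho>l, of "cmod x"] by simp
    qed
    have "cmod (g1 n) + cmod (g2 n) \<le> (\<epsilon>\<^sup>2 * K\<^sup>2 * cmod (x1 (n + 1)) + \<epsilon>\<^sup>2 * (6 * K * Y * Z))
        + (\<epsilon>\<^sup>2 * K\<^sup>2 * cmod (x2 (n + 1)) + \<epsilon>\<^sup>2 * (6 * K * Y * Z))"
      unfolding 1 2 norm_mult[of "\<rho> powi n"] pw Z_def mult_1_left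
      by (intro add_mono order_trans[OF b1] mult_left_mono norm_of_real_combination_le E order_refl) auto
    also have "\<dots> = \<epsilon>\<^sup>2 * K * (K * (cmod (x1 (n + 1)) + cmod (x2 (n + 1))) + 12 * Y * Z)"
      by (simp add: power2_eq_square algebra_simps)
    also have "\<dots> \<le> \<epsilon>\<^sup>2 * K * (15 * Y * Z)"
    proof (intro mult_left_mono)
      have "K * (cmod (x1 (n + 1)) + cmod (x2 (n + 1))) \<le> (3 / 2 * Y) * (101 / 100 * Z)"
        using xup[of "n + 1"] Y_ge K1 Y0 by (intro mult_mono) auto
      thus "K * (cmod (x1 (n + 1)) + cmod (x2 (n + 1))) + 12 * Y * Z \<le> 15 * Y * Z"
        using mult_pos_pos[OF Y0 Z0] by simp
    qed (use K1 in auto)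
    finally show ?thesis by (simp add: G_def algebra_simps)
  qed
  define u where "u n = ?c (a n) * v1 n + ?c (b n) * v2 n" for n
  \<comment> \<open>The second component in the frame agrees with \<open>u (n - 1)\<close> up to
    \<open>d2 (n - 1)\<close>; eliminating it leaves a scalar second-order equation for
    \<open>u\<close>.\<close>
  define t where "t n = ?c (a (n - 1)) * v1 n + (?c (b (n - 1)) - ?c \<zeta> * ?c (a (n - 1))) * v2 n" for n
  define d1 where "d1 n = ?c (a (n + 1)) * g1 n + ?c (b (n + 1)) * g2 n" for n
  define d2 where "d2 n = ?c (a n) * g1 n + (?c (b n) - ?c \<zeta> * ?c (a n)) * g2 n" for n
  have NG: "N * (cmod (g1 n) + cmod (g2 n)) \<le> N * G" for n using g N1 by (intro mult_left_mono) auto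
  have d1: "cmod (d1 n) \<le> N * G" for n
    unfolding d1_def by (rule order_trans[OF norm_of_real_combination_le NG]) (simp_all add: bound)
  have d2: "cmod (d2 n) \<le> N * G" for n
  proof -
    have "cmod (?c (a n) * g1 n + ?c (b n - \<zeta> * a n) * g2 n) \<le> N * G"
      by (rule order_trans[OF norm_of_real_combination_le NG]) (simp_all add: bound)
    thus ?thesis by (simp add: d2_def)
  qed
  have vs1: "v1 (n + 1) = ((1 + ?c \<epsilon> * (?c (a n) * ?c (b n) - ?c \<zeta> * (?c (a n) * ?c (a n)))) * v1 n
      + (?c \<zeta> + ?c \<epsilon> * (?c (b n) * ?c (b n) - ?c \<zeta> * (?c (a n) * ?c (b n)))) * v2 n) + g1 n" for n
    by (simp add: g1_def)
  have vs2: "v2 (n + 1) = (- ?c \<epsilon> * (?c (a n) * ?c (a n)) * v1 n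
      + (1 - ?c \<epsilon> * (?c (a n) * ?c (b n))) * v2 n) + g2 n" for n
    by (simp add: g2_def)
  have det_c: "?c (a (n + 1)) * (?c (b n) - ?c \<zeta> * ?c (a n)) - ?c (b (n + 1)) * ?c (a n) = 1" for n
    using det_complex[of "n + 1"] by simp
  have us: "u (n + 1) = (?c E + ?c \<epsilon> - ?c (W n)) * u n - t n + d1 n" for n
  proof -
    have "u (n + 1) = ?c (a (n + 1)) * (v1 (n + 1) - g1 n) + ?c (b (n + 1)) * (v2 (n + 1) - g2 n) + d1 n"
      by (simp add: u_def d1_def algebra_simps)
    also have "v1 (n + 1) - g1 n = (1 + ?c \<epsilon> * (?c (a n) * ?c (b n) - ?c \<zeta> * (?c (a n) * ?c (a n)))) * v1 n
      + (?c \<zeta> + ?c \<epsilon> * (?c (b n) * ?c (b n) - ?c \<zeta> * (?c (a n) * ?c (b n)))) * v2 n"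
      unfolding vs1 by simp
    also have "v2 (n + 1) - g2 n = - ?c \<epsilon> * (?c (a n) * ?c (a n)) * v1 n
      + (1 - ?c \<epsilon> * (?c (a n) * ?c (b n))) * v2 n" unfolding vs2 by simp
    finally show ?thesis
      unfolding frame_step(1)[OF det_c sol_a_complex sol_b_complex] u_def t_def .
  qed
  have ts: "t (n + 1) = u n + d2 n" for n
  proof -
    have "t (n + 1) = ?c (a n) * (v1 (n + 1) - g1 n) + (?c (b n) - ?c \<zeta> * ?c (a n)) * (v2 (n + 1) - g2 n) + d2 n"
      by (simp add: t_def d2_def algebra_simps)
    also have "v1 (n + 1) - g1 n = (1 + ?c \<epsilon> * (?c (a n) * ?c (b n) - ?c \<zeta> * (?c (a n) * ?c (a n)))) * v1 n
      + (?c \<zeta> + ?c \<epsilon> * (?c (b n) * ?c (b n) - ?c \<zeta> * (?c (a n) * ?c (b n)))) * v2 n"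
      unfolding vs1 by simp
    also have "v2 (n + 1) - g2 n = - ?c \<epsilon> * (?c (a n) * ?c (a n)) * v1 n
      + (1 - ?c \<epsilon> * (?c (a n) * ?c (b n))) * v2 n" unfolding vs2 by simp
    finally show ?thesis
      unfolding frame_step(2)[OF det_c sol_a_complex sol_b_complex] u_def .
  qed
  have tn: "t n = u (n - 1) + d2 (n - 1)" for n using ts[of "n - 1"] by simp
  have eq: "jacobi W u n - ?c (E + \<epsilon>) * u n = d1 n - d2 (n - 1)" for n
    unfolding jacobi_def us tn by (simp add: algebra_simps)
  have approx: "cmod (jacobi W u n - ?c (E + \<epsilon>) * u n) \<le> 2 * (N * G)" for n
    unfolding eq using norm_triangle_ineq4[of "d1 n" "d2 (n - 1)"] d1[of n] d2[of "n - 1"] by linarith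
  have ub: "cmod (u n) \<le> N * (101 / 100 * Z)" for n
  proof -
    have "cmod (u n) \<le> N * (cmod (v1 n) + cmod (v2 n))"
      unfolding u_def by (rule norm_of_real_combination_le) (rule bound)+
    also have "\<dots> \<le> N * (101 / 100 * Z)" unfolding vx using xup N1 by (intro mult_left_mono) auto
    finally show ?thesis .
  qed
  have small: "20 * (K * (15 * K * Y * \<bar>\<epsilon>\<bar>)) < 1" using \<epsilon>(2) by (simp add: power2_eq_square)
  have NNG: "N * (N * G) \<le> Z / 20 * \<bar>\<epsilon>\<bar>"
  proof -
    have "N * (N * G) = K * (15 * K * Y * \<bar>\<epsilon>\<bar>) * (\<bar>\<epsilon>\<bar> * Z)"
      by (simp add: G_def K_def power2_eq_square mult.assoc[of _ "\<bar>\<epsilon>\<bar>" "\<bar>\<epsilon>\<bar>"] flip: abs_mult)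
    also have "\<dots> \<le> 1 / 20 * (\<bar>\<epsilon>\<bar> * Z)" using small Z0 by (intro mult_right_mono) auto
    finally show ?thesis by (simp add: mult.commute)
  qed
  \<comment> \<open>The sequence \<open>u\<close> may vanish at single sites. The frame is
    invertible with entries bounded by \<open>N\<close>, however, so two consecutive values control
    \<open>v1\<close> and \<open>v2\<close>.\<close>
  have low1: "Z / (5 * N) \<le> cmod (u n) + cmod (u (n - 1))" for n
  proof -
    have "v1 n = ?c (b (n - 1) - \<zeta> * a (n - 1)) * u n + ?c (- b n) * t n
        \<and> v2 n = ?c (- a (n - 1)) * u n + ?c (a n) * t n"
    proof -
      have "?c (b (n - 1) - \<zeta> * a (n - 1)) * u n + ?c (- b n) * t n
          = (?c (a n) * (?c (b (n - 1)) - ?c \<zeta> * ?c (a (n - 1))) - ?c (b n) * ?c (a (n - 1))) * v1 n"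
        "?c (- a (n - 1)) * u n + ?c (a n) * t n
          = (?c (a n) * (?c (b (n - 1)) - ?c \<zeta> * ?c (a (n - 1))) - ?c (b n) * ?c (a (n - 1))) * v2 n"
        unfolding u_def t_def by (simp_all add: algebra_simps)
      thus ?thesis unfolding det_complex by simp
    qed
    hence "cmod (v1 n) \<le> N * (cmod (u n) + cmod (t n))" "cmod (v2 n) \<le> N * (cmod (u n) + cmod (t n))"
      using norm_of_real_combination_le[of "b (n - 1) - \<zeta> * a (n - 1)" N "- b n" "u n" "t n"]
        norm_of_real_combination_le[of "- a (n - 1)" N "a n" "u n" "t n"] bound
      by auto
    moreover have "cmod (t n) \<le> cmod (u (n - 1)) + N * G"
      unfolding tn using norm_triangle_ineq[of "u (n - 1)" "d2 (n - 1)"] d2[of "n - 1"] by linarith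
    hence "N * (cmod (u n) + cmod (t n)) \<le> N * (cmod (u n) + cmod (u (n - 1))) + N * (N * G)"
      using N1 mult_left_mono[of "cmod (t n)" "cmod (u (n - 1)) + N * G" N] by (simp add: algebra_simps)
    moreover have "x \<le> 2 * (A' + B')" if "s \<le> A" "s' \<le> A" "A \<le> A' + B'" "x \<le> s + s'" for x s s' A A' B' :: real
      using that by simp
    ultimately have "99 / 100 * Z \<le> 2 * (N * (cmod (u n) + cmod (u (n - 1))) + N * (N * G))"
      using vlow[of n] by blast
    moreover have "Z / 20 * \<bar>\<epsilon>\<bar> \<le> Z / 20 * 1" using eps_Y(3) Z0 by (intro mult_left_mono) auto
    ultimately have "Z \<le> 5 * (N * (cmod (u n) + cmod (u (n - 1))))" using NNG Z0 by argo
    thus ?thesis using N1 by (simp add: field_simps)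
  qed
  have low: "(Z / (5 * N))\<^sup>2 / 2 \<le> (cmod (u n))\<^sup>2 + (cmod (u (n - 1)))\<^sup>2" for n
  proof -
    have "(Z / (5 * N))\<^sup>2 \<le> (cmod (u n) + cmod (u (n - 1)))\<^sup>2"
      using low1[of n] Z0 N1 by (intro power_mono) auto
    also have "\<dots> \<le> 2 * ((cmod (u n))\<^sup>2 + (cmod (u (n - 1)))\<^sup>2)"
      using sum_squares_bound[of "cmod (u n)" "cmod (u (n - 1))"] by (simp add: power2_sum)
    finally show ?thesis by simp
  qed
  have "\<bar>\<epsilon>\<bar>\<^sup>2 * ((Z / (5 * N))\<^sup>2 / 2) \<le> 2 * (2 * (N * G))\<^sup>2"
    by (rule approximate_eigenfunction[OF below _ ub approx low]) (use \<epsilon>(1) in auto)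
  hence "(\<bar>\<epsilon>\<bar> * Z)\<^sup>2 \<le> (20 * (N * (N * G)))\<^sup>2"
    using N1 by (simp add: power_mult_distrib power_divide field_simps)
  hence "\<bar>\<epsilon>\<bar> * Z \<le> 20 * (N * (N * G))"
    using N1 K1 Y0 Z0 by (subst (asm) abs_le_square_iff[symmetric]) (auto simp: G_def)
  moreover have "20 * (N * (N * G)) < \<bar>\<epsilon>\<bar> * Z"
  proof -
    have "20 * (N * (N * G)) = 20 * (K * (15 * K * Y * \<bar>\<epsilon>\<bar>)) * (\<bar>\<epsilon>\<bar> * Z)"
      by (simp add: G_def K_def power2_eq_square mult.assoc[of _ "\<bar>\<epsilon>\<bar>" "\<bar>\<epsilon>\<bar>"] flip: abs_mult)
    also have "\<dots> < 1 * (\<bar>\<epsilon>\<bar> * Z)" using small Z0 \<epsilon>(1) by (intro mult_strict_right_mono) auto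
    finally show ?thesis by simp
  qed
  ultimately show False by simp
qed

text \<open>To the left of \<open>E\<close> the lower left entry of the averaged matrix is
  \<open>\<delta> * p > 0\<close>, while the upper right one stays close to \<zeta>; this is the
  situation of \<open>lyapunov_increment\<close>. For square summable \<open>u\<close> the
  increments sum to zero, so their definite part is controlled by the forcing, which is the operator
  at \<open>E - \<delta>\<close> applied to \<open>u\<close>.\<close>

lemma hyperbolic_bounded_below:
  assumes \<delta>: "0 < \<delta>" "60000 * K\<^sup>2 * Y * \<delta> \<le> 1" "15 * K * \<delta> \<le> \<zeta>"
  shows "bounded_below_at W (E - \<delta>)"
proof -
  let ?c = complex_of_real
  define h where "h = \<delta> * p"
  have p0: "p > 0"
  proof -
    have "0 < 1 / (5 * N\<^sup>2)" using N1 by simp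
    thus ?thesis using p_ge by linarith
  qed
  have p: "1 \<le> 5 * K * p"
    using mult_left_mono[OF p_ge, of "5 * N\<^sup>2"] N1 by (simp add: K_def)
  have h0: "h > 0" using \<delta> p0 by (simp add: h_def)
  have pK: "p \<le> K" using means'(1) by simp
  have hK: "h \<le> \<delta> * K" unfolding h_def using pK \<delta> by (intro mult_left_mono) auto
  have \<delta>h: "\<delta> \<le> 5 * K * h"
    using mult_left_mono[OF p, of \<delta>] \<delta>(1) by (simp add: h_def algebra_simps)
  have K0: "K > 0" using K1 by simp
  have dKKY: "\<delta> * (K * (K * Y)) \<le> 1 / 60000" using \<delta>(2) by (simp add: power2_eq_square algebra_simps)
  have dKKK: "\<delta> * (K * (K * K)) \<le> 1 / 40000"
  proof -
    have "\<delta> * (K * (K * K)) \<le> \<delta> * (K * (K * (3 / 2 * Y)))"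
      using Y_ge \<delta>(1) K0 by (intro mult_left_mono) auto
    thus ?thesis using dKKY by simp
  qed
  have dK: "\<delta> * K \<le> 1 / 40000"
  proof -
    have "\<delta> * K * 1 \<le> \<delta> * K * (K * K)"
      using \<delta>(1) K1 mult_mono[of 1 K 1 K] by (intro mult_left_mono) auto
    thus ?thesis using dKKK by (simp add: algebra_simps)
  qed
  have dY: "\<delta> * Y \<le> 1 / 60000"
  proof -
    have "\<delta> * Y * 1 \<le> \<delta> * Y * (K * K)"
      using \<delta>(1) Y0 K1 mult_mono[of 1 K 1 K] by (intro mult_left_mono) auto
    thus ?thesis using dKKY by (simp add: algebra_simps)
  qed
  define m11 m12 m22 where "m11 = 1 - \<delta> * (q - \<zeta> * p)" and "m12 = \<zeta> - \<delta> * (r - \<zeta> * q)"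
    and "m22 = 1 + \<delta> * q"
  have d1: "\<bar>\<delta> * (q - \<zeta> * p)\<bar> \<le> 1 / 10" "\<bar>\<delta> * (r - \<zeta> * q)\<bar> \<le> \<zeta> / 10" "\<bar>\<delta> * q\<bar> \<le> 1 / 10"
  proof -
    have "\<bar>\<delta> * s\<bar> \<le> \<delta> * (3 / 2 * K)" if "\<bar>s\<bar> \<le> 3 / 2 * K" for s
      unfolding abs_mult using that \<delta> by (simp add: mult_left_mono)
    note * = this
    show "\<bar>\<delta> * (q - \<zeta> * p)\<bar> \<le> 1 / 10" using *[OF minus_zeta_le[OF means'(2,1)]] dK by simp
    show "\<bar>\<delta> * (r - \<zeta> * q)\<bar> \<le> \<zeta> / 10" using *[OF minus_zeta_le[OF means'(3,2)]] \<delta>(3) by (simp add: mult.commute)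
    show "\<bar>\<delta> * q\<bar> \<le> 1 / 10" using *[of q] means'(2) K1 dK by simp
  qed
  have k: "\<bar>m11 * m22 + m12 * h - 1\<bar> \<le> h / 10"
  proof -
    have eq: "m11 * m22 + m12 * h - 1 = h * (2 * \<zeta> + 2 * (\<delta> * (\<zeta> * q)) - \<delta> * r) - \<delta> * (\<delta> * (q * q))"
      by (simp add: m11_def m12_def m22_def h_def algebra_simps)
    \<comment> \<open>This term alone lacks a factor \<open>h\<close>. The lower bound on
      \<open>p\<close> supplies one, in the form \<open>\<delta> \<le> 5 * K * h\<close>.\<close>
    have "\<delta> * (\<delta> * (q * q)) \<le> (5 * K * h) * (\<delta> * (K * K))"
    proof (rule mult_mono[OF \<delta>h])
      have "q * q \<le> K * K"
        using mult_mono[OF means'(2) means'(2)] K0 abs_mult_self_eq[of q] by simp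
      thus "\<delta> * (q * q) \<le> \<delta> * (K * K)" using \<delta>(1) by (intro mult_left_mono) auto
    qed (use K0 h0 \<delta>(1) in auto)
    also have "\<dots> = 5 * h * (\<delta> * (K * (K * K)))" by (simp add: algebra_simps)
    also have "\<dots> \<le> 5 * h * (1 / 40000)" using h0 by (intro mult_left_mono dKKK) auto
    finally have 1: "\<delta> * (\<delta> * (q * q)) \<le> h / 8000" by simp
    have 2: "\<bar>\<delta> * (\<zeta> * q)\<bar> \<le> 1 / 40000"
    proof -
      have "\<bar>\<delta> * (\<zeta> * q)\<bar> = \<delta> * (\<zeta> * \<bar>q\<bar>)" using \<delta>(1) \<zeta>(1) by (simp add: abs_mult)
      also have "\<dots> \<le> \<delta> * (1 * K)" using \<delta>(1) \<zeta> means'(2) by (intro mult_left_mono mult_mono) auto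
      finally show ?thesis using dK by simp
    qed
    have 3: "\<bar>\<delta> * r\<bar> \<le> 1 / 40000"
    proof -
      have "\<bar>\<delta> * r\<bar> = \<delta> * \<bar>r\<bar>" using \<delta>(1) by (simp add: abs_mult)
      also have "\<dots> \<le> \<delta> * K" using \<delta>(1) means'(3) by (intro mult_left_mono) auto
      finally show ?thesis using dK by simp
    qed
    have 4: "\<bar>2 * \<zeta> + 2 * (\<delta> * (\<zeta> * q)) - \<delta> * r\<bar> \<le> 9 / 100" using 2 3 \<zeta> by linarith
    have "\<bar>h * (2 * \<zeta> + 2 * (\<delta> * (\<zeta> * q)) - \<delta> * r)\<bar> \<le> h * (9 / 100)"
      unfolding abs_mult[of h] by (rule mult_mono) (use h0 4 in auto)
    moreover have "0 \<le> \<delta> * (\<delta> * (q * q))" using \<delta>(1) by simp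
    moreover have "\<bar>x - y\<bar> \<le> h / 10" if "\<bar>x\<bar> \<le> h * (9 / 100)" "0 \<le> y" "y \<le> h / 8000" for x y
      using that h0 by linarith
    ultimately show ?thesis unfolding eq using 1 by blast
  qed
  have h\<zeta>: "h \<le> \<zeta>" 
  proof -
    have "15 * (\<delta> * K) \<le> \<zeta>" using \<delta>(3) by (simp add: algebra_simps)
    thus ?thesis using hK mult_pos_pos[OF \<delta>(1) K0] by linarith
  qed
  \<comment> \<open>Here \<kappa> is the relative size of the second-order remainder. The bound
    \<open>6 * K * Y\<close> is doubled because \<open>vw\<close> estimates \<open>v\<close> by
    twice \<open>w\<close>.\<close>
  define \<kappa> where "\<kappa> = 12 * K * Y * \<delta>\<^sup>2"
  have \<kappa>: "0 \<le> \<kappa>" "\<kappa> \<le> h / 1000"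
  proof -
    show "0 \<le> \<kappa>" using K0 Y0 by (simp add: \<kappa>_def)
    have "\<kappa> = 12 * K * Y * \<delta> * \<delta>" by (simp add: \<kappa>_def power2_eq_square)
    also have "\<dots> \<le> 12 * K * Y * \<delta> * (5 * K * h)" using K0 Y0 \<delta>(1) by (intro mult_left_mono \<delta>h) auto
    also have "\<dots> = 60 * h * (\<delta> * (K * (K * Y)))" by (simp add: algebra_simps)
    also have "\<dots> \<le> 60 * h * (1 / 60000)" using h0 by (intro mult_left_mono dKKY) auto
    finally show "\<kappa> \<le> h / 1000" by simp
  qed
  have main: "h / (120 * K) * ell2_norm u \<le> ell2_norm (\<lambda>n. jacobi W u n - ?c (E - \<delta>) * u n)"
    if u: "u \<in> ell2" for u
  proof -
    define f where "f n = jacobi W u n - ?c (E - \<delta>) * u n" for n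
    have f: "f \<in> ell2" unfolding f_def by (rule jacobi_minus_ell2[OF u])
    define e where "e = - ?c \<delta>"
    have uf: "u (n + 1) = (?c E + e - ?c (W n)) * u n - u (n - 1) + f n" for n
      by (simp add: f_def jacobi_def e_def algebra_simps)
    define v1 where "v1 n = (?c (b (n - 1)) - ?c \<zeta> * ?c (a (n - 1))) * u n - ?c (b n) * u (n - 1)" for n
    define v2 where "v2 n = - ?c (a (n - 1)) * u n + ?c (a n) * u (n - 1)" for n
    \<comment> \<open>While \<open>v1\<close>, \<open>v2\<close> are the coordinates of
      \<open>u\<close> in the frame, \<open>w1\<close>, \<open>w2\<close> result from applying
      \<open>1 + e Y\<close>, after which the coefficients are constant up to second order.\<close>
    define w1 where "w1 n = v1 n + e * (?c (y1 n) * v1 n + ?c (y2 n) * v2 n)" for n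
    define w2 where "w2 n = v2 n + e * (?c (y3 n) * v1 n - ?c (y1 n) * v2 n)" for n
    have det_c: "?c (a (n + 1)) * (?c (b n) - ?c \<zeta> * ?c (a n)) - ?c (b (n + 1)) * ?c (a n) = 1" for n
      using det_complex[of "n + 1"] by simp
    have fsi: "?c (a n) * v1 n + ?c (b n) * v2 n = u n"
      "v1 (n + 1) = (1 + e * (?c (a n) * ?c (b n) - ?c \<zeta> * (?c (a n) * ?c (a n)))) * v1 n
            + (?c \<zeta> + e * (?c (b n) * ?c (b n) - ?c \<zeta> * (?c (a n) * ?c (b n)))) * v2 n
            + (?c (b n) - ?c \<zeta> * ?c (a n)) * f n"
      "v2 (n + 1) = - e * (?c (a n) * ?c (a n)) * v1 n + (1 - e * (?c (a n) * ?c (b n))) * v2 n - ?c (a n) * f n" for n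
      using frame_step_inverse[OF det_c det_complex sol_a_complex sol_b_complex uf v1_def v2_def]
      unfolding v1_def[of "n + 1"] v2_def[of "n + 1"] by simp_all
    have bb: "\<bar>- \<delta> * s\<bar> \<le> 1 / 60000" if "\<bar>s\<bar> \<le> Y" for s
    proof -
      have "\<bar>- \<delta> * s\<bar> = \<delta> * \<bar>s\<bar>" using \<delta>(1) by (simp add: abs_mult)
      also have "\<dots> \<le> \<delta> * Y" using \<delta>(1) that by (intro mult_left_mono) auto
      finally show ?thesis using dY by linarith
    qed
    have wv: "cmod (w1 n - v1 n) \<le> 1 / 60000 * (cmod (v1 n) + cmod (v2 n))"
         "cmod (w2 n - v2 n) \<le> 1 / 60000 * (cmod (v1 n) + cmod (v2 n))" for n
    proof -
      have "w1 n - v1 n = ?c (- \<delta> * y1 n) * v1 n + ?c (- \<delta> * y2 n) * v2 n"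
        by (simp add: w1_def e_def algebra_simps)
      thus "cmod (w1 n - v1 n) \<le> 1 / 60000 * (cmod (v1 n) + cmod (v2 n))"
        using norm_of_real_combination_le[OF bb[OF Y_bound(1)] bb[OF Y_bound(2)]] by simp
      have "w2 n - v2 n = ?c (- \<delta> * y3 n) * v1 n + ?c (- \<delta> * (- y1 n)) * v2 n"
        by (simp add: w2_def e_def algebra_simps)
      thus "cmod (w2 n - v2 n) \<le> 1 / 60000 * (cmod (v1 n) + cmod (v2 n))"
        using norm_of_real_combination_le[OF bb[OF Y_bound(3)] bb[of "- y1 n"]] Y_bound(1) by simp
    qed
    have vw: "cmod (v1 n) + cmod (v2 n) \<le> 2 * (cmod (w1 n) + cmod (w2 n))" for n
      using wv[of n] norm_triangle_ineq2[of "v1 n" "w1 n"] norm_triangle_ineq2[of "v2 n" "w2 n"]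
        norm_ge_zero[of "v1 n"] norm_ge_zero[of "v2 n"]
      unfolding norm_minus_commute[of "w1 n" "v1 n"] norm_minus_commute[of "w2 n" "v2 n"] by argo
    define e1 where "e1 n = w1 (n + 1) - (m11 *\<^sub>R w1 n + m12 *\<^sub>R w2 n)" for n
    define e2 where "e2 n = w2 (n + 1) - (h *\<^sub>R w1 n + m22 *\<^sub>R w2 n)" for n
    have e12: "cmod (e1 n) \<le> \<kappa> * (cmod (w1 n) + cmod (w2 n)) + 2 * N * cmod (f n)"
      "cmod (e2 n) \<le> \<kappa> * (cmod (w1 n) + cmod (w2 n)) + 2 * N * cmod (f n)" for n
    proof -
      note cs = conjugation_step[OF coh_complex[of n], of e "v1 n" "v2 n"]
      define E11 where "E11 = y1 (n+1) * (a n * b n - \<zeta> * (a n * a n)) - y2 (n+1) * (a n * a n) - (q - \<zeta> * p) * y1 n - (r - \<zeta> * q) * y3 n"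
      define E12 where "E12 = y1 (n+1) * (b n * b n - \<zeta> * (a n * b n)) - y2 (n+1) * (a n * b n) - (q - \<zeta> * p) * y2 n + (r - \<zeta> * q) * y1 n"
      define E21 where "E21 = y3 (n+1) * (a n * b n - \<zeta> * (a n * a n)) + y1 (n+1) * (a n * a n) + p * y1 n + q * y3 n"
      define E22 where "E22 = y3 (n+1) * (b n * b n - \<zeta> * (a n * b n)) + y1 (n+1) * (a n * b n) + p * y2 n - q * y1 n"
      have E: "\<bar>E11\<bar> \<le> 6 * K * Y" "\<bar>E12\<bar> \<le> 6 * K * Y" "\<bar>E21\<bar> \<le> 6 * K * Y" "\<bar>E22\<bar> \<le> 6 * K * Y"
        unfolding E11_def E12_def E21_def E22_def by (rule quadratic_error_le)+
      have c1: "(1 + e * ?c (y1 (n + 1))) * ((1 + e * (?c (a n) * ?c (b n) - ?c \<zeta> * (?c (a n) * ?c (a n)))) * v1 n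
            + (?c \<zeta> + e * (?c (b n) * ?c (b n) - ?c \<zeta> * (?c (a n) * ?c (b n)))) * v2 n)
           + e * ?c (y2 (n + 1)) * (- e * (?c (a n) * ?c (a n)) * v1 n + (1 - e * (?c (a n) * ?c (b n))) * v2 n)
         = ?c m11 * w1 n + ?c m12 * w2 n + ?c (\<delta>\<^sup>2) * (?c E11 * v1 n + ?c E12 * v2 n)"
        using cs(1) by (simp add: w1_def w2_def m11_def m12_def E11_def E12_def e_def)
      have c2: "e * ?c (y3 (n + 1)) * ((1 + e * (?c (a n) * ?c (b n) - ?c \<zeta> * (?c (a n) * ?c (a n)))) * v1 n
            + (?c \<zeta> + e * (?c (b n) * ?c (b n) - ?c \<zeta> * (?c (a n) * ?c (b n)))) * v2 n)
           + (1 - e * ?c (y1 (n + 1))) * (- e * (?c (a n) * ?c (a n)) * v1 n + (1 - e * (?c (a n) * ?c (b n))) * v2 n)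
         = ?c h * w1 n + ?c m22 * w2 n + ?c (\<delta>\<^sup>2) * (?c E21 * v1 n + ?c E22 * v2 n)"
        using cs(2) by (simp add: w1_def w2_def h_def m22_def E21_def E22_def e_def)
      define F1 where "F1 = ?c (b n - \<zeta> * a n) * f n + (?c (- \<delta> * y1 (n + 1)) * (?c (b n - \<zeta> * a n) * f n) + ?c (- \<delta> * y2 (n + 1)) * (?c (- a n) * f n))"
      define F2 where "F2 = ?c (- a n) * f n + (?c (- \<delta> * y3 (n + 1)) * (?c (b n - \<zeta> * a n) * f n) + ?c (- \<delta> * (- y1 (n + 1))) * (?c (- a n) * f n))"
      have 1: "e1 n = ?c (\<delta>\<^sup>2) * (?c E11 * v1 n + ?c E12 * v2 n) + F1"
      proof -
        have "w1 (n + 1) = ?c m11 * w1 n + ?c m12 * w2 n + ?c (\<delta>\<^sup>2) * (?c E11 * v1 n + ?c E12 * v2 n) + F1"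
          unfolding c1[symmetric] F1_def w1_def[of "n + 1"] fsi(2,3) by (simp add: e_def algebra_simps)
        thus ?thesis by (simp add: e1_def scaleR_conv_of_real)
      qed
      have 2: "e2 n = ?c (\<delta>\<^sup>2) * (?c E21 * v1 n + ?c E22 * v2 n) + F2"
      proof -
        have "w2 (n + 1) = ?c h * w1 n + ?c m22 * w2 n + ?c (\<delta>\<^sup>2) * (?c E21 * v1 n + ?c E22 * v2 n) + F2"
          unfolding c2[symmetric] F2_def w2_def[of "n + 1"] fsi(2,3) by (simp add: e_def algebra_simps)
        thus ?thesis by (simp add: e2_def scaleR_conv_of_real)
      qed
      have g: "cmod (?c s * f n) \<le> N * cmod (f n)" if "\<bar>s\<bar> \<le> N" for s
        using that by (simp add: norm_mult mult_right_mono del: of_real_diff of_real_mult)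
      have F: "cmod (x + (?c s * x' + ?c s' * y')) \<le> 2 * N * cmod (f n)"
        if "\<bar>s\<bar> \<le> 1 / 60000" "\<bar>s'\<bar> \<le> 1 / 60000" "cmod x \<le> N * cmod (f n)" "cmod x' \<le> N * cmod (f n)" "cmod y' \<le> N * cmod (f n)"
        for x x' y' s s'
      proof -
        have "cmod (x + (?c s * x' + ?c s' * y')) \<le> cmod x + 1 / 60000 * (cmod x' + cmod y')"
          using norm_triangle_ineq[of x "?c s * x' + ?c s' * y'"] norm_of_real_combination_le[OF that(1,2), of x' y'] by linarith
        moreover have "0 \<le> N * cmod (f n)" using N1 by simp
        ultimately show ?thesis using that(3-5) unfolding mult.assoc[of 2] by argo
      qed
      have an: "\<bar>- a n\<bar> \<le> N" using bound(1) by simp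
      have F1: "cmod F1 \<le> 2 * N * cmod (f n)" unfolding F1_def
        by (rule F[OF bb[OF Y_bound(1)] bb[OF Y_bound(2)] g[OF bound(3)] g[OF bound(3)] g[OF an]])
      have F2: "cmod F2 \<le> 2 * N * cmod (f n)" unfolding F2_def
        by (rule F[OF bb[OF Y_bound(3)] bb g[OF an] g[OF bound(3)] g[OF an]]) (simp add: Y_bound(1))
      have V: "cmod (?c (\<delta>\<^sup>2) * (?c s * v1 n + ?c s' * v2 n)) \<le> \<kappa> * (cmod (w1 n) + cmod (w2 n))"
        if "\<bar>s\<bar> \<le> 6 * K * Y" "\<bar>s'\<bar> \<le> 6 * K * Y" for s s'
      proof -
        have "cmod (?c (\<delta>\<^sup>2) * (?c s * v1 n + ?c s' * v2 n)) = \<delta>\<^sup>2 * cmod (?c s * v1 n + ?c s' * v2 n)"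
          by (simp add: norm_mult norm_power)
        also have "\<dots> \<le> \<delta>\<^sup>2 * (6 * K * Y * (cmod (v1 n) + cmod (v2 n)))"
          by (intro mult_left_mono norm_of_real_combination_le that) simp
        also have "\<dots> \<le> \<delta>\<^sup>2 * (6 * K * Y * (2 * (cmod (w1 n) + cmod (w2 n))))"
          using K0 Y0 by (intro mult_left_mono vw) auto
        finally show ?thesis by (simp add: \<kappa>_def algebra_simps)
      qed
      show "cmod (e1 n) \<le> \<kappa> * (cmod (w1 n) + cmod (w2 n)) + 2 * N * cmod (f n)"
        unfolding 1 by (rule order_trans[OF norm_triangle_ineq add_mono[OF V F1]]) (rule E)+
      show "cmod (e2 n) \<le> \<kappa> * (cmod (w1 n) + cmod (w2 n)) + 2 * N * cmod (f n)"
        unfolding 2 by (rule order_trans[OF norm_triangle_ineq add_mono[OF V F2]]) (rule E)+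
    qed
    have incr: "h / 4 * ((cmod (w1 n))\<^sup>2 + (cmod (w2 n))\<^sup>2) - 100 / h * (2 * N * cmod (f n))\<^sup>2
        \<le> w1 (n + 1) \<bullet> w2 (n + 1) - w1 n \<bullet> w2 n" for n
    proof -
      have "w1 (n + 1) = m11 *\<^sub>R w1 n + m12 *\<^sub>R w2 n + e1 n" "w2 (n + 1) = h *\<^sub>R w1 n + m22 *\<^sub>R w2 n + e2 n"
        by (simp_all add: e1_def e2_def)
      thus ?thesis
        by (simp only:) (rule lyapunov_increment[OF _ _ _ _ _ _ h0 h\<zeta> \<zeta>(2) k e12 \<kappa>],
            use d1 N1 in \<open>auto simp: m11_def m12_def m22_def abs_le_iff\<close>)
    qed
    have um: "(\<lambda>n. u (n - 1)) \<in> ell2" using ell2_shift[OF u, of "-1"] by simp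
    have lin2: "(\<lambda>n. ?c (s n) * x n + ?c (s' n) * y n) \<in> ell2"
      if "x \<in> ell2" "y \<in> ell2" "\<And>n. \<bar>s n\<bar> \<le> C" "\<And>n. \<bar>s' n\<bar> \<le> C" for x y s s' C
      by (intro ell2_add ell2_bounded_mult[where B = C] that) (simp_all add: that)
    have v1e: "v1 \<in> ell2"
    proof -
      have "(\<lambda>n. ?c (b (n - 1) - \<zeta> * a (n - 1)) * u n + ?c (- b n) * u (n - 1)) \<in> ell2"
        by (rule lin2[OF u um, of _ N]) (simp_all add: bound)
      also have "(\<lambda>n. ?c (b (n - 1) - \<zeta> * a (n - 1)) * u n + ?c (- b n) * u (n - 1)) = v1"
        by (simp add: v1_def fun_eq_iff)
      finally show ?thesis .
    qed
    have v2e: "v2 \<in> ell2"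
    proof -
      have "(\<lambda>n. ?c (- a (n - 1)) * u n + ?c (a n) * u (n - 1)) \<in> ell2"
        by (rule lin2[OF u um, of _ N]) (simp_all add: bound)
      also have "(\<lambda>n. ?c (- a (n - 1)) * u n + ?c (a n) * u (n - 1)) = v2"
        by (simp add: v2_def fun_eq_iff)
      finally show ?thesis .
    qed
    have w1e: "w1 \<in> ell2"
      unfolding w1_def by (intro ell2_add v1e ell2_cmult lin2[OF v1e v2e, of _ Y] Y_bound)
    have w2e: "w2 \<in> ell2"
    proof -
      have "(\<lambda>n. v2 n + e * (?c (y3 n) * v1 n + ?c (- y1 n) * v2 n)) \<in> ell2"
        by (intro ell2_add v2e ell2_cmult lin2[OF v1e v2e, of _ Y]) (simp_all add: Y_bound)
      thus ?thesis by (simp add: w2_def[abs_def])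
    qed
    let ?L = "\<lambda>n. w1 n \<bullet> w2 n"
    have sL: "?L summable_on UNIV" by (rule l2_inner_summable[OF w1e w2e])
    have sL': "(\<lambda>n. ?L (n + 1)) summable_on UNIV"
      by (rule l2_inner_summable[OF ell2_shift[OF w1e] ell2_shift[OF w2e]])
    have sw: "(\<lambda>n. (cmod (w1 n))\<^sup>2 + (cmod (w2 n))\<^sup>2) summable_on UNIV"
      using w1e w2e by (intro summable_on_add) (simp_all add: ell2_def)
    have sD: "(\<lambda>n. ?L (n + 1) - ?L n) summable_on UNIV"
      using summable_on_add[OF sL' summable_on_cmult_right[OF sL, of "-1"]] by simp
    have sf: "(\<lambda>n. (cmod (f n))\<^sup>2) summable_on UNIV" using f by (simp add: ell2_def)
    define SW where "SW = (\<Sum>\<^sub>\<infinity>n. (cmod (w1 n))\<^sup>2 + (cmod (w2 n))\<^sup>2)"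
    define SF where "SF = (\<Sum>\<^sub>\<infinity>n. (cmod (f n))\<^sup>2)"
    have "(\<Sum>\<^sub>\<infinity>n. h / 4 * ((cmod (w1 n))\<^sup>2 + (cmod (w2 n))\<^sup>2)) \<le> (\<Sum>\<^sub>\<infinity>n. (?L (n + 1) - ?L n) + 400 * K / h * (cmod (f n))\<^sup>2)"
    proof (rule infsum_mono)
      show "(\<lambda>n. h / 4 * ((cmod (w1 n))\<^sup>2 + (cmod (w2 n))\<^sup>2)) summable_on UNIV"
        by (intro summable_on_cmult_right sw)
      show "(\<lambda>n. (?L (n + 1) - ?L n) + 400 * K / h * (cmod (f n))\<^sup>2) summable_on UNIV"
        by (intro summable_on_add sD summable_on_cmult_right sf)
      show "h / 4 * ((cmod (w1 n))\<^sup>2 + (cmod (w2 n))\<^sup>2) \<le> (?L (n + 1) - ?L n) + 400 * K / h * (cmod (f n))\<^sup>2" for n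
        using incr[of n] by (simp add: power_mult_distrib K_def)
    qed
    also have "\<dots> = (\<Sum>\<^sub>\<infinity>n. ?L (n + 1) - ?L n) + (\<Sum>\<^sub>\<infinity>n. 400 * K / h * (cmod (f n))\<^sup>2)"
      by (intro infsum_add sD summable_on_cmult_right sf)
    \<comment> \<open>The form is summable since \<open>w1\<close> and \<open>w2\<close> are square
      summable, and its sum over all integers is invariant under the shift.\<close>
    also have "(\<Sum>\<^sub>\<infinity>n. ?L (n + 1) - ?L n) = 0"
      using infsum_add[OF sL' summable_on_cmult_right[OF sL, of "-1"]] infsum_shift_int[of ?L 1]
        infsum_uminus[of ?L UNIV] by simp
    also have "(\<Sum>\<^sub>\<infinity>n. 400 * K / h * (cmod (f n))\<^sup>2) = 400 * K / h * SF"
      unfolding SF_def by (rule infsum_cmult_right) (use sf in simp)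
    finally have 1: "h / 4 * SW \<le> 400 * K / h * SF"
      unfolding SW_def by (subst (asm) infsum_cmult_right) (use sw in simp_all)
    have "(ell2_norm u)\<^sup>2 = (\<Sum>\<^sub>\<infinity>n. (cmod (u n))\<^sup>2)" by (rule ell2_norm_power2[OF u])
    also have "\<dots> \<le> (\<Sum>\<^sub>\<infinity>n. 8 * K * ((cmod (w1 n))\<^sup>2 + (cmod (w2 n))\<^sup>2))"
    proof (rule infsum_mono)
      show "(\<lambda>n. (cmod (u n))\<^sup>2) summable_on UNIV" using u by (simp add: ell2_def)
      show "(\<lambda>n. 8 * K * ((cmod (w1 n))\<^sup>2 + (cmod (w2 n))\<^sup>2)) summable_on UNIV"
        by (intro summable_on_cmult_right sw)
      show "(cmod (u n))\<^sup>2 \<le> 8 * K * ((cmod (w1 n))\<^sup>2 + (cmod (w2 n))\<^sup>2)" for n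
      proof -
        have "cmod (u n) \<le> N * (cmod (v1 n) + cmod (v2 n))"
          using norm_of_real_combination_le[OF bound(1) bound(2), of n "v1 n" n "v2 n"] unfolding fsi(1) .
        also have "\<dots> \<le> N * (2 * (cmod (w1 n) + cmod (w2 n)))" using N1 by (intro mult_left_mono vw) auto
        finally have "(cmod (u n))\<^sup>2 \<le> (N * (2 * (cmod (w1 n) + cmod (w2 n))))\<^sup>2" by (intro power_mono) auto
        also have "\<dots> = 4 * K * (cmod (w1 n) + cmod (w2 n))\<^sup>2" by (simp add: K_def power2_eq_square algebra_simps)
        also have "\<dots> \<le> 4 * K * (2 * ((cmod (w1 n))\<^sup>2 + (cmod (w2 n))\<^sup>2))"
          using sum_squares_bound[of "cmod (w1 n)" "cmod (w2 n)"] K0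
          by (intro mult_left_mono) (auto simp: power2_sum)
        finally show ?thesis by (simp add: algebra_simps)
      qed
    qed
    also have "\<dots> = 8 * K * SW" unfolding SW_def by (rule infsum_cmult_right) (use sw in simp)
    also have "\<dots> \<le> 8 * K * (1600 * K / h\<^sup>2 * SF)"
    proof (rule mult_left_mono)
      show "SW \<le> 1600 * K / h\<^sup>2 * SF" using 1 h0 by (simp add: field_simps power2_eq_square)
    qed (use K0 in simp)
    also have "\<dots> = 12800 * K\<^sup>2 / h\<^sup>2 * SF" by (simp add: power2_eq_square)
    also have "\<dots> \<le> 14400 * K\<^sup>2 / h\<^sup>2 * SF"
      by (intro mult_right_mono divide_right_mono) (auto simp: SF_def infsum_nonneg)
    also have "\<dots> = (120 * K / h * ell2_norm f)\<^sup>2"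
      by (simp add: power_mult_distrib power_divide ell2_norm_power2[OF f] SF_def)
    finally have "ell2_norm u \<le> 120 * K / h * ell2_norm f"
      by (rule power2_le_imp_le) (use K0 h0 in \<open>simp add: ell2_norm_def infsum_nonneg\<close>)
    thus ?thesis using h0 K0 by (simp add: field_simps f_def[abs_def])
  qed
  show ?thesis
    unfolding bounded_below_at_def using main h0 K0 by (intro exI[of _ "h / (120 * K)"]) auto
qed

end

section \<open>Fourier series on the torus\<close>

lemma int_vec_simps [simp]:
  "int_vec 0 = 0" "int_vec (m + n) = int_vec m + int_vec n" "int_vec (- n) = - int_vec n"
  by (simp_all add: int_vec_def vec_eq_iff)

lemma int_vec_inner_Ints: "int_vec m \<bullet> int_vec n = of_int (\<Sum>j\<in>UNIV. m $ j * n $ j)"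
  by (simp add: inner_vec_def int_vec_def)

lemma cis_2pi_int [simp]: "cis (2 * pi * of_int k) = 1"
  by (simp add: complex_eq_iff cos_one_2pi_int)

section \<open>Characters and trigonometric polynomials\<close>

definition torus_char :: "int^'d \<Rightarrow> real^'d \<Rightarrow> complex" where
  "torus_char n x = cis (2 * pi * (int_vec n \<bullet> x))"

lemma norm_torus_char [simp]: "cmod (torus_char n x) = 1"
  by (simp add: torus_char_def)

lemma torus_char_0 [simp]: "torus_char 0 x = 1"
  by (simp add: torus_char_def)

lemma torus_char_add: "torus_char (m + n) x = torus_char m x * torus_char n x"
  by (simp add: torus_char_def cis_mult inner_add_left algebra_simps)

lemma torus_char_minus_mult [simp]: "torus_char n x * torus_char (- n) x = 1"
  by (simp flip: torus_char_add)

lemma torus_char_shift: "torus_char n (x + y) = torus_char n x * torus_char n y"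
  by (simp add: torus_char_def cis_mult inner_add_right algebra_simps)

lemma torus_char_scale: "torus_char n (real k *\<^sub>R x) = torus_char n x ^ k"
  by (simp add: torus_char_def Complex.DeMoivre algebra_simps)

lemma torus_char_int_vec [simp]: "torus_char n (int_vec m) = 1"
  unfolding torus_char_def int_vec_inner_Ints by (rule cis_2pi_int)

lemma continuous_on_torus_char [continuous_intros]: "continuous_on S (torus_char n)"
  unfolding torus_char_def[abs_def] cis_conv_exp by (intro continuous_intros)

definition periodic :: "(real^'d \<Rightarrow> 'b) \<Rightarrow> bool" where
  "periodic f \<longleftrightarrow> (\<forall>x n. f (x + int_vec n) = f x)"

lemma periodic_torus_char: "periodic (torus_char n)"
  by (simp add: periodic_def torus_char_shift)

inductive trig_poly :: "(real^'d \<Rightarrow> complex) \<Rightarrow> bool" where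
  trig_zero: "trig_poly (\<lambda>x. 0)"
| trig_term: "trig_poly f \<Longrightarrow> trig_poly (\<lambda>x. f x + c * torus_char n x)"

lemma trig_poly_add:
  assumes "trig_poly g" "trig_poly f"
  shows "trig_poly (\<lambda>x. f x + g x)"
  using assms
proof (induction rule: trig_poly.induct)
  case (trig_term g c n)
  thus ?case using trig_poly.trig_term[of "\<lambda>x. f x + g x" c n] by (simp add: add.assoc)
qed simp

lemma trig_poly_mult_char:
  assumes "trig_poly f"
  shows "trig_poly (\<lambda>x. f x * (c * torus_char n x))"
  using assms
proof (induction rule: trig_poly.induct)
  case (trig_term g c' m)
  thus ?case
    using trig_poly.trig_term[of "\<lambda>x. g x * (c * torus_char n x)" "c' * c" "m + n"]
    by (simp add: torus_char_add algebra_simps)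
qed (simp add: trig_poly.intros)

lemma trig_poly_mult:
  assumes "trig_poly g" "trig_poly f"
  shows "trig_poly (\<lambda>x. f x * g x)"
  using assms
proof (induction rule: trig_poly.induct)
  case (trig_term g c n)
  thus ?case
    using trig_poly_add[OF trig_poly_mult_char, of f "\<lambda>x. f x * g x" c n] by (simp add: algebra_simps)
qed (simp add: trig_poly.intros)

lemma trig_poly_char: "trig_poly (\<lambda>x. c * torus_char n x)"
  using trig_term[OF trig_zero] by simp

lemma trig_poly_const: "trig_poly (\<lambda>x. c)"
  using trig_poly_char[of c 0] by simp

lemma periodic_fundamental_domain:
  fixes x :: "real^'d"
  obtains m where "x + int_vec m \<in> cbox 0 (\<chi> j. 1)"
proof
  show "x + int_vec (\<chi> j. - \<lfloor>x $ j\<rfloor>) \<in> cbox 0 (\<chi> j. 1)"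
    unfolding mem_box_cart
  proof (intro allI)
    fix j
    have "0 \<le> x $ j - of_int \<lfloor>x $ j\<rfloor> \<and> x $ j - of_int \<lfloor>x $ j\<rfloor> \<le> 1" by linarith
    thus "(0::real^'d) $ j \<le> (x + int_vec (\<chi> j. - \<lfloor>x $ j\<rfloor>)) $ j
        \<and> (x + int_vec (\<chi> j. - \<lfloor>x $ j\<rfloor>)) $ j \<le> (\<chi> j. 1) $ j"
      by (simp add: int_vec_def)
  qed
qed

text \<open>The coordinate characters embed the torus as a compact set \<open>S\<close>, through
  which every periodic function factors. On \<open>S\<close> the real and imaginary parts of the
  coordinates separate points and pull back to trigonometric polynomials, so the Stone-Weierstrass
  theorem applies.\<close>

lemma trig_poly_dense_real:
  fixes f :: "real^'d \<Rightarrow> real"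
  assumes f: "continuous_on UNIV f" "periodic f" and "\<epsilon> > 0"
  shows "\<exists>p. trig_poly p \<and> (\<forall>x. cmod (of_real (f x) - p x) < \<epsilon>)"
proof -
  define \<iota> :: "real^'d \<Rightarrow> complex^'d" where "\<iota> x = (\<chi> j. cis (2 * pi * x $ j))" for x
  have cont_\<iota>: "continuous_on S \<iota>" for S
    unfolding \<iota>_def cis_conv_exp by (intro continuous_intros)
  define C :: "(real^'d) set" where "C = cbox 0 (\<chi> j. 1)"
  have C: "compact C" by (simp add: C_def)
  define S where "S = \<iota> ` C"
  have compS: "compact S" unfolding S_def by (intro compact_continuous_image cont_\<iota> C)
  have \<iota>_per: "\<iota> (x + int_vec m) = \<iota> x" for x m
    by (simp add: \<iota>_def vec_eq_iff int_vec_def distrib_left flip: cis_mult)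
  have \<iota>_S: "\<iota> x \<in> S" for x
    using periodic_fundamental_domain[of x] \<iota>_per[of x] unfolding S_def C_def by (metis imageI)
  have \<iota>_inj: "f x = f y" if "\<iota> x = \<iota> y" for x y
  proof -
    have "\<exists>k::int. x $ j = y $ j + of_int k" for j
    proof -
      have "cis (2 * pi * x $ j) = cis (2 * pi * y $ j)" using that by (simp add: \<iota>_def vec_eq_iff)
      hence "cis (2 * pi * x $ j) * cis (- (2 * pi * y $ j)) = 1"
        by (simp add: cis_mult)
      hence "cos (2 * pi * x $ j - 2 * pi * y $ j) = 1" by (simp add: cis_mult complex_eq_iff)
      then obtain k :: int where "2 * pi * x $ j - 2 * pi * y $ j = of_int k * 2 * pi"
        unfolding cos_one_2pi_int by blast
      hence "2 * pi * (x $ j) = 2 * pi * (y $ j + of_int k)" by (simp add: algebra_simps)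
      hence "x $ j = y $ j + of_int k" by simp
      thus ?thesis ..
    qed
    then obtain k where "\<And>j. x $ j = y $ j + of_int (k j)" by metis
    hence "x = y + int_vec (\<chi> j. k j)" by (simp add: vec_eq_iff int_vec_def)
    thus ?thesis using f(2) by (simp add: periodic_def)
  qed
  define g where "g z = f (SOME x. x \<in> C \<and> \<iota> x = z)" for z
  have g: "g (\<iota> x) = f x" for x
  proof -
    have "\<exists>y. y \<in> C \<and> \<iota> y = \<iota> x" using \<iota>_S[of x] by (auto simp: S_def)
    from someI_ex[OF this] show ?thesis unfolding g_def by (intro \<iota>_inj) simp
  qed
  \<comment> \<open>The factored function is given only by a choice of preimages. Its graph, though,
    is a continuous image of the compact cube, and closed graphs with compact range give
    continuity.\<close>
  have contg: "continuous_on S g"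
  proof (rule continuous_from_closed_graph)
    show "compact (f ` C)" by (intro compact_continuous_image C continuous_on_subset[OF f(1)]) simp
    show "g \<in> S \<rightarrow> f ` C" by (auto simp: S_def g)
    have "(\<lambda>z. (z, g z)) ` S = (\<lambda>x. (\<iota> x, f x)) ` C" by (auto simp: S_def g image_image)
    also have "compact \<dots>"
      by (intro compact_continuous_image C continuous_on_Pair cont_\<iota> continuous_on_subset[OF f(1)]) simp
    finally show "closed ((\<lambda>z. (z, g z)) ` S)" by (rule compact_imp_closed)
  qed
  define P where "P h \<longleftrightarrow> continuous_on S h \<and> (\<exists>p. trig_poly p \<and> (\<forall>x. of_real (h (\<iota> x)) = p x))" for h :: "complex^'d \<Rightarrow> real"
  have ax: "int_vec (axis j 1) \<bullet> x = x $ j" for j and x :: "real^'d"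
  proof -
    have "int_vec (axis j 1) = axis j (1::real)" by (simp add: int_vec_def vec_eq_iff axis_def)
    thus ?thesis by (simp add: inner_axis')
  qed
  have PRe: "P (\<lambda>z. Re (z $ j))" for j
    unfolding P_def
  proof (intro conjI exI allI)
    show "trig_poly (\<lambda>x. 1/2 * torus_char (axis j 1) x + 1/2 * torus_char (- axis j 1) x)"
      by (intro trig_poly_add trig_poly_char)
    show "of_real (Re (\<iota> x $ j)) = 1/2 * torus_char (axis j 1) x + 1/2 * torus_char (- axis j 1) x" for x
      by (simp add: torus_char_def ax \<iota>_def complex_eq_iff)
  qed (intro continuous_intros)
  have PIm: "P (\<lambda>z. Im (z $ j))" for j
    unfolding P_def
  proof (intro conjI exI allI)
    show "trig_poly (\<lambda>x. - \<i>/2 * torus_char (axis j 1) x + \<i>/2 * torus_char (- axis j 1) x)"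
      by (intro trig_poly_add trig_poly_char)
    show "of_real (Im (\<iota> x $ j)) = - \<i>/2 * torus_char (axis j 1) x + \<i>/2 * torus_char (- axis j 1) x" for x
      by (simp add: torus_char_def ax \<iota>_def complex_eq_iff)
  qed (intro continuous_intros)
  have "\<exists>h. P h \<and> (\<forall>z\<in>S. \<bar>g z - h z\<bar> < \<epsilon>)"
  proof (rule Stone_Weierstrass_HOL[OF compS])
    show "P (\<lambda>_. c)" for c unfolding P_def by (auto intro: trig_poly_const)
    show "P (\<lambda>x. h1 x + h2 x)" if h: "P h1 \<and> P h2" for h1 h2
    proof -
      obtain p1 p2 where p: "trig_poly p1" "trig_poly p2" "\<And>x. of_real (h1 (\<iota> x)) = p1 x" "\<And>x. of_real (h2 (\<iota> x)) = p2 x"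
        using h unfolding P_def by blast
      thus ?thesis using h unfolding P_def
        by (intro conjI exI[of _ "\<lambda>x. p1 x + p2 x"]) (auto intro!: trig_poly_add continuous_intros)
    qed
    show "P (\<lambda>x. h1 x * h2 x)" if h: "P h1 \<and> P h2" for h1 h2
    proof -
      obtain p1 p2 where p: "trig_poly p1" "trig_poly p2" "\<And>x. of_real (h1 (\<iota> x)) = p1 x" "\<And>x. of_real (h2 (\<iota> x)) = p2 x"
        using h unfolding P_def by blast
      thus ?thesis using h unfolding P_def
        by (intro conjI exI[of _ "\<lambda>x. p1 x * p2 x"]) (auto intro!: trig_poly_mult continuous_intros)
    qed
    show "\<exists>h. P h \<and> h z \<noteq> h w" if zw: "z \<in> S \<and> w \<in> S \<and> z \<noteq> w" for z w
    proof -
      obtain j where "z $ j \<noteq> w $ j" using zw unfolding vec_eq_iff by blast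
      hence "Re (z $ j) \<noteq> Re (w $ j) \<or> Im (z $ j) \<noteq> Im (w $ j)" by (auto simp: complex_eq_iff)
      thus ?thesis using PRe[of j] PIm[of j] by blast
    qed
  qed (use contg \<open>\<epsilon> > 0\<close> in \<open>auto simp: P_def\<close>)
  then obtain h p where h: "\<And>z. z \<in> S \<Longrightarrow> \<bar>g z - h z\<bar> < \<epsilon>" and p: "trig_poly p" "\<And>x. of_real (h (\<iota> x)) = p x"
    unfolding P_def by blast
  have "cmod (of_real (f x) - p x) < \<epsilon>" for x
    using h[OF \<iota>_S[of x]] unfolding p(2)[symmetric] g by (simp flip: of_real_diff)
  thus ?thesis using p(1) by blast
qed

lemma trig_poly_dense:
  fixes f :: "real^'d \<Rightarrow> complex"
  assumes f: "continuous_on UNIV f" "periodic f" and "\<epsilon> > 0"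
  shows "\<exists>p. trig_poly p \<and> (\<forall>x. cmod (f x - p x) < \<epsilon>)"
proof -
  obtain p where p: "trig_poly p" "\<And>x. cmod (of_real (Re (f x)) - p x) < \<epsilon> / 2"
    using trig_poly_dense_real[of "\<lambda>x. Re (f x)" "\<epsilon> / 2"] assms
    by (auto simp: periodic_def intro!: continuous_intros)
  obtain q where q: "trig_poly q" "\<And>x. cmod (of_real (Im (f x)) - q x) < \<epsilon> / 2"
    using trig_poly_dense_real[of "\<lambda>x. Im (f x)" "\<epsilon> / 2"] assms
    by (auto simp: periodic_def intro!: continuous_intros)
  have "cmod (f x - (p x + q x * (\<i> * torus_char 0 x))) < \<epsilon>" for x
  proof -
    have "f x - (p x + q x * (\<i> * torus_char 0 x))
        = (of_real (Re (f x)) - p x) + \<i> * (of_real (Im (f x)) - q x)"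
      using complex_eq[of "f x"] by (simp add: algebra_simps)
    hence "cmod (f x - (p x + q x * (\<i> * torus_char 0 x)))
        \<le> cmod (of_real (Re (f x)) - p x) + cmod (\<i> * (of_real (Im (f x)) - q x))"
      by (simp only: norm_triangle_ineq)
    thus ?thesis using p(2)[of x] q(2)[of x] by (simp add: norm_mult)
  qed
  thus ?thesis
    using trig_poly_add[OF trig_poly_mult_char[OF q(1)] p(1)] by blast
qed

section \<open>Birkhoff means and Fourier coefficients\<close>

definition birkhoff :: "real^'d \<Rightarrow> (real^'d \<Rightarrow> complex) \<Rightarrow> nat \<Rightarrow> complex" where
  "birkhoff \<alpha> f N = (\<Sum>k<N. f (real k *\<^sub>R \<alpha>)) / of_nat N"

text \<open>Requiring the same limit along every translated orbit builds translation invariance into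
  the notion. It takes the place of the integral over the torus.\<close>

definition has_mean :: "real^'d \<Rightarrow> (real^'d \<Rightarrow> complex) \<Rightarrow> complex \<Rightarrow> bool" where
  "has_mean \<alpha> f c \<longleftrightarrow> (\<forall>s. birkhoff \<alpha> (\<lambda>x. f (x + s)) \<longlonglongrightarrow> c)"

lemma torus_char_neq_1:
  fixes \<alpha> :: "real^'d"
  assumes \<alpha>: "rationally_independent_with_one \<alpha>" and "n \<noteq> 0"
  shows "torus_char n \<alpha> \<noteq> 1"
proof
  assume "torus_char n \<alpha> = 1"
  hence "cos (2 * pi * (int_vec n \<bullet> \<alpha>)) = 1" by (simp add: torus_char_def complex_eq_iff)
  then obtain k :: int where "2 * pi * (int_vec n \<bullet> \<alpha>) = of_int k * 2 * pi"
    unfolding cos_one_2pi_int by blast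
  hence "int_vec n \<bullet> \<alpha> = of_int k" by simp
  hence "of_rat (of_int (- k)) + (\<Sum>j\<in>UNIV. of_rat ((\<chi> j. of_int (n $ j)) $ j) * \<alpha> $ j) = (0::real)"
    by (simp add: inner_vec_def int_vec_def of_rat_minus)
  hence "(\<chi> j. of_int (n $ j)) = (0 :: rat^'d)"
    using \<alpha> unfolding rationally_independent_with_one_def by blast
  hence "n = 0" by (simp add: vec_eq_iff)
  thus False using \<open>n \<noteq> 0\<close> by blast
qed

lemma birkhoff_add: "birkhoff \<alpha> (\<lambda>x. f x + g x) = (\<lambda>N. birkhoff \<alpha> f N + birkhoff \<alpha> g N)"
  by (simp add: birkhoff_def sum.distrib add_divide_distrib fun_eq_iff)

lemma birkhoff_cmult: "birkhoff \<alpha> (\<lambda>x. c * f x) = (\<lambda>N. c * birkhoff \<alpha> f N)"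
  by (simp add: birkhoff_def sum_distrib_left fun_eq_iff)

lemma birkhoff_diff_le:
  assumes "\<And>x. cmod (f x - g x) \<le> \<epsilon>" "N > 0"
  shows "cmod (birkhoff \<alpha> f N - birkhoff \<alpha> g N) \<le> \<epsilon>"
proof -
  have "birkhoff \<alpha> f N - birkhoff \<alpha> g N = (\<Sum>k<N. f (real k *\<^sub>R \<alpha>) - g (real k *\<^sub>R \<alpha>)) / of_nat N"
    by (simp add: birkhoff_def sum_subtractf diff_divide_distrib)
  hence "cmod (birkhoff \<alpha> f N - birkhoff \<alpha> g N) = cmod (\<Sum>k<N. f (real k *\<^sub>R \<alpha>) - g (real k *\<^sub>R \<alpha>)) / real N"
    by (simp add: norm_divide)
  also have "cmod (\<Sum>k<N. f (real k *\<^sub>R \<alpha>) - g (real k *\<^sub>R \<alpha>)) \<le> of_nat (card {..<N}) * \<epsilon>"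
    by (rule sum_norm_bound) (rule assms)
  hence "cmod (\<Sum>k<N. f (real k *\<^sub>R \<alpha>) - g (real k *\<^sub>R \<alpha>)) / real N \<le> \<epsilon>"
    using assms(2) by (simp add: field_simps)
  finally show ?thesis .
qed

lemma has_mean_add: "has_mean \<alpha> f c \<Longrightarrow> has_mean \<alpha> g d \<Longrightarrow> has_mean \<alpha> (\<lambda>x. f x + g x) (c + d)"
  by (simp add: has_mean_def birkhoff_add tendsto_add)

lemma has_mean_cmult: "has_mean \<alpha> f c \<Longrightarrow> has_mean \<alpha> (\<lambda>x. a * f x) (a * c)"
  by (simp add: has_mean_def birkhoff_cmult tendsto_mult_left)

lemma has_mean_const: "has_mean \<alpha> (\<lambda>x. c) c"
  unfolding has_mean_def birkhoff_def
  by (auto intro!: tendsto_eventually eventually_sequentiallyI[of 1])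

lemma has_mean_shift: "has_mean \<alpha> f c \<Longrightarrow> has_mean \<alpha> (\<lambda>x. f (x + s)) c"
  by (simp add: has_mean_def add.assoc)

lemma has_mean_sum:
  "finite F \<Longrightarrow> (\<And>i. i \<in> F \<Longrightarrow> has_mean \<alpha> (f i) (c i)) \<Longrightarrow> has_mean \<alpha> (\<lambda>x. \<Sum>i\<in>F. f i x) (\<Sum>i\<in>F. c i)"
proof (induction F rule: finite_induct)
  case (insert i F)
  thus ?case using has_mean_add[of \<alpha> "f i" "c i" "\<lambda>x. \<Sum>i\<in>F. f i x" "\<Sum>i\<in>F. c i"] by simp
qed (simp add: has_mean_const)

text \<open>Along an orbit a character runs through a geometric progression; rational independence
  keeps its ratio different from 1, so the sums stay bounded.\<close>

lemma has_mean_torus_char: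
  assumes "rationally_independent_with_one \<alpha>" and "n \<noteq> 0"
  shows "has_mean \<alpha> (torus_char n) 0"
  unfolding has_mean_def
proof
  fix s
  define l where "l = torus_char n \<alpha>"
  have l: "l \<noteq> 1" "cmod l = 1" using torus_char_neq_1[OF assms] by (simp_all add: l_def)
  have bound: "cmod (birkhoff \<alpha> (\<lambda>x. torus_char n (x + s)) N) \<le> 2 / cmod (l - 1) * inverse (real N)" for N
  proof -
    have "birkhoff \<alpha> (\<lambda>x. torus_char n (x + s)) N = torus_char n s * (\<Sum>k<N. l ^ k) / of_nat N"
      by (simp add: birkhoff_def torus_char_shift torus_char_scale l_def sum_distrib_left mult.commute)
    also have "(\<Sum>k<N. l ^ k) = (l ^ N - 1) / (l - 1)" using l(1) by (rule geometric_sum)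
    finally have "cmod (birkhoff \<alpha> (\<lambda>x. torus_char n (x + s)) N) = cmod (l ^ N - 1) / cmod (l - 1) / real N"
      by (simp add: norm_mult norm_divide)
    also have "\<dots> \<le> 2 / cmod (l - 1) / real N"
      using norm_triangle_ineq4[of "l ^ N" 1] l(2) by (intro divide_right_mono) (auto simp: norm_power)
    finally show ?thesis by (simp add: divide_inverse)
  qed
  have "(\<lambda>N. 2 / cmod (l - 1) * inverse (real N)) \<longlonglongrightarrow> 2 / cmod (l - 1) * 0"
    by (intro tendsto_intros lim_inverse_n)
  hence lim: "(\<lambda>N. 2 / cmod (l - 1) * inverse (real N)) \<longlonglongrightarrow> 0" by simp
  show "birkhoff \<alpha> (\<lambda>x. torus_char n (x + s)) \<longlonglongrightarrow> 0"
    by (rule Lim_null_comparison[OF always_eventually lim]) (rule allI, rule bound)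
qed

lemma has_mean_torus_char':
  assumes "rationally_independent_with_one \<alpha>"
  shows "has_mean \<alpha> (\<lambda>x. torus_char m x * torus_char (- n) x) (if m = n then 1 else 0)"
proof (cases "m = n")
  case False
  have "(\<lambda>x. torus_char m x * torus_char (- n) x) = torus_char (m - n)"
    by (rule ext) (simp only: torus_char_add[symmetric] diff_conv_add_uminus)
  thus ?thesis using False has_mean_torus_char[OF assms, of "m - n"] by simp
next
  case True
  thus ?thesis using has_mean_const[of \<alpha> 1] by (simp only: torus_char_minus_mult if_True simp_thms)
qed

lemma has_mean_uniform_limit:
  assumes "\<And>\<epsilon>. \<epsilon> > 0 \<Longrightarrow> \<exists>p d. has_mean \<alpha> p d \<and> (\<forall>x. cmod (f x - p x) \<le> \<epsilon>) \<and> cmod (d - c) \<le> \<epsilon>"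
  shows "has_mean \<alpha> f c"
  unfolding has_mean_def
proof (intro allI metric_LIMSEQ_I)
  fix s and e :: real assume "e > 0"
  then obtain p d where p: "has_mean \<alpha> p d" "\<And>x. cmod (f x - p x) \<le> e / 4" "cmod (d - c) \<le> e / 4"
    using assms[of "e / 4"] by auto
  have "birkhoff \<alpha> (\<lambda>x. p (x + s)) \<longlonglongrightarrow> d" using p(1) by (simp add: has_mean_def)
  then obtain M where M: "\<And>N. N \<ge> M \<Longrightarrow> dist (birkhoff \<alpha> (\<lambda>x. p (x + s)) N) d < e / 4"
    using \<open>e > 0\<close> by (meson metric_LIMSEQ_D divide_pos_pos zero_less_numeral)
  have "dist (birkhoff \<alpha> (\<lambda>x. f (x + s)) N) c < e" if "N \<ge> max M 1" for N
  proof -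
    have "cmod (birkhoff \<alpha> (\<lambda>x. f (x + s)) N - birkhoff \<alpha> (\<lambda>x. p (x + s)) N) \<le> e / 4"
      by (rule birkhoff_diff_le) (use p(2) that in auto)
    thus ?thesis
      using M[of N] that p(3) \<open>e > 0\<close>
        dist_triangle[of "birkhoff \<alpha> (\<lambda>x. f (x + s)) N" c "birkhoff \<alpha> (\<lambda>x. p (x + s)) N"]
        dist_triangle[of "birkhoff \<alpha> (\<lambda>x. p (x + s)) N" c d]
      by (simp add: dist_norm)
  qed
  thus "\<exists>M. \<forall>N\<ge>M. dist (birkhoff \<alpha> (\<lambda>x. f (x + s)) N) c < e" by blast
qed

lemma has_mean_trig_poly:
  assumes "rationally_independent_with_one \<alpha>" "trig_poly p"
  shows "\<exists>c. has_mean \<alpha> p c"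
  using assms(2)
proof (induction rule: trig_poly.induct)
  case (trig_term f c n)
  have "\<exists>d. has_mean \<alpha> (torus_char n) d"
  proof (cases "n = 0")
    case True
    hence "torus_char n = (\<lambda>x. 1)" by (simp add: fun_eq_iff)
    thus ?thesis using has_mean_const by metis
  qed (use has_mean_torus_char[OF assms(1)] in blast)
  then obtain d where d: "has_mean \<alpha> (torus_char n) d" ..
  obtain c' where "has_mean \<alpha> f c'" using trig_term.IH ..
  from has_mean_add[OF this has_mean_cmult[OF d, of c]] show ?case ..
qed (use has_mean_const in blast)

lemma has_mean_diff_le:
  assumes "has_mean \<alpha> f c" "has_mean \<alpha> g d" "\<And>x. cmod (f x - g x) \<le> \<epsilon>"
  shows "cmod (c - d) \<le> \<epsilon>"
proof (rule LIMSEQ_le_const2)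
  show "(\<lambda>N. cmod (birkhoff \<alpha> (\<lambda>x. f (x + 0)) N - birkhoff \<alpha> (\<lambda>x. g (x + 0)) N)) \<longlonglongrightarrow> cmod (c - d)"
    using assms(1,2) unfolding has_mean_def by (intro tendsto_intros) blast+
  show "\<exists>M. \<forall>N\<ge>M. cmod (birkhoff \<alpha> (\<lambda>x. f (x + 0)) N - birkhoff \<alpha> (\<lambda>x. g (x + 0)) N) \<le> \<epsilon>"
    by (intro exI[of _ 1] allI impI birkhoff_diff_le) (use assms(3) in auto)
qed

text \<open>Weyl equidistribution: trigonometric polynomials have means, and the means of a uniform
  approximation form a Cauchy sequence.\<close>

lemma has_mean_continuous:
  assumes \<alpha>: "rationally_independent_with_one \<alpha>"
    and f: "continuous_on UNIV f" "periodic f"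
  shows "\<exists>c. has_mean \<alpha> f c"
proof -
  have "\<exists>p d. has_mean \<alpha> p d \<and> (\<forall>x. cmod (f x - p x) \<le> inverse (real (Suc k)))" for k
  proof -
    obtain p where "trig_poly p" "\<And>x. cmod (f x - p x) < inverse (real (Suc k))"
      using trig_poly_dense[OF f, of "inverse (real (Suc k))"] by auto
    thus ?thesis using has_mean_trig_poly[OF \<alpha>] by (meson less_imp_le)
  qed
  then obtain p d where p: "\<And>k. has_mean \<alpha> (p k) (d k)" "\<And>k x. cmod (f x - p k x) \<le> inverse (real (Suc k))"
    by metis
  have dist: "cmod (d k - d l) \<le> inverse (real (Suc k)) + inverse (real (Suc l))" for k l
  proof (rule has_mean_diff_le[OF p(1) p(1)])
    show "cmod (p k x - p l x) \<le> inverse (real (Suc k)) + inverse (real (Suc l))" for x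
      using p(2)[of x k] p(2)[of x l] norm_triangle_ineq4[of "f x - p l x" "f x - p k x"] by simp
  qed
  have small: "\<exists>M. \<forall>k\<ge>M. inverse (real (Suc k)) < e" if "e > 0" for e
    using metric_LIMSEQ_D[OF LIMSEQ_inverse_real_of_nat that] by simp
  have "Cauchy d"
  proof (rule metric_CauchyI)
    fix e :: real assume "e > 0"
    then obtain M where M: "\<And>k. k \<ge> M \<Longrightarrow> inverse (real (Suc k)) < e / 2" using small[of "e / 2"] by auto
    have "dist (d k) (d l) < e" if "k \<ge> M" "l \<ge> M" for k l
      using dist[of k l] M[OF that(1)] M[OF that(2)] unfolding dist_norm by linarith
    thus "\<exists>M. \<forall>k\<ge>M. \<forall>l\<ge>M. dist (d k) (d l) < e" by blast
  qed
  then obtain c where c: "d \<longlonglongrightarrow> c" by (auto simp: Cauchy_convergent_iff convergent_def)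
  have "has_mean \<alpha> f c"
  proof (rule has_mean_uniform_limit)
    fix e :: real assume e: "e > 0"
    obtain M where M: "\<And>k. k \<ge> M \<Longrightarrow> inverse (real (Suc k)) < e" using small[OF e] by auto
    obtain M' where M': "\<And>k. k \<ge> M' \<Longrightarrow> dist (d k) c < e" using metric_LIMSEQ_D[OF c e] by auto
    have "cmod (f x - p (max M M') x) \<le> e" for x
      using p(2)[of x "max M M'"] M[of "max M M'"] by simp
    moreover have "cmod (d (max M M') - c) \<le> e"
      using M'[of "max M M'"] by (simp add: dist_norm)
    ultimately show "\<exists>p d. has_mean \<alpha> p d \<and> (\<forall>x. cmod (f x - p x) \<le> e) \<and> cmod (d - c) \<le> e"
      using p(1) by blast
  qed
  thus ?thesis ..
qed

text \<open>Finitely many translates of a set where \<open>\<bar>h\<bar>\<close> is large cover the torus, so that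
  \<open>\<bar>h\<bar>\<^sup>2\<close> has a positive mean unless \<open>h\<close> vanishes.\<close>

lemma has_mean_norm_zero:
  fixes h :: "real^'d \<Rightarrow> complex"
  assumes h: "continuous_on UNIV h" "periodic h"
    and mean: "has_mean \<alpha> (\<lambda>x. of_real ((cmod (h x))\<^sup>2)) 0"
  shows "h x = 0"
proof (rule ccontr)
  assume "h x \<noteq> 0"
  define c where "c = (cmod (h x))\<^sup>2 / 4"
  have c: "c > 0" using \<open>h x \<noteq> 0\<close> by (simp add: c_def)
  obtain r where r: "r > 0" "\<And>y. dist y x < r \<Longrightarrow> dist (h y) (h x) < cmod (h x) / 2"
    using h(1) \<open>h x \<noteq> 0\<close> unfolding continuous_on_iff by (metis UNIV_I half_gt_zero zero_less_norm_iff)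
  have low: "c \<le> (cmod (h y))\<^sup>2" if "dist y x < r" for y
  proof -
    have "cmod (h x) / 2 \<le> cmod (h y)"
      using r(2)[OF that] norm_triangle_ineq2[of "h x" "h y"] by (simp add: dist_norm norm_minus_commute)
    hence "(cmod (h x) / 2)\<^sup>2 \<le> (cmod (h y))\<^sup>2" by (intro power_mono) auto
    thus ?thesis by (simp add: c_def power_divide)
  qed
  have "cbox (0::real^'d) (\<chi> j. 1) \<subseteq> (\<Union>y. ball y r)"
  proof
    show "z \<in> (\<Union>y. ball y r)" for z by (rule UN_I[of z]) (use r(1) in auto)
  qed
  then obtain D where D: "finite D" "cbox (0::real^'d) (\<chi> j. 1) \<subseteq> (\<Union>y\<in>D. ball y r)"
    by (rule compactE_image[OF compact_cbox, of UNIV "\<lambda>y. ball y r", rotated]) auto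
  define H where "H z = (\<Sum>y\<in>D. complex_of_real ((cmod (h (z + (x - y))))\<^sup>2))" for z
  have "has_mean \<alpha> H (\<Sum>y\<in>D. 0)"
    unfolding H_def by (intro has_mean_sum D has_mean_shift[OF mean])
  hence "birkhoff \<alpha> (\<lambda>z. H (z + 0)) \<longlonglongrightarrow> (\<Sum>y\<in>D. 0)"
    unfolding has_mean_def by blast
  hence "(\<lambda>N. Re (birkhoff \<alpha> (\<lambda>z. H (z + 0)) N)) \<longlonglongrightarrow> Re (\<Sum>y\<in>D. 0)"
    by (rule tendsto_Re)
  hence "(\<lambda>N. Re (birkhoff \<alpha> H N)) \<longlonglongrightarrow> 0" by simp
  moreover have "c \<le> Re (H z)" for z
  proof -
    obtain m where "z + int_vec m \<in> cbox 0 (\<chi> j. 1)" by (rule periodic_fundamental_domain)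
    then obtain y where y: "y \<in> D" "dist y (z + int_vec m) < r" using D(2) by auto
    have "dist (z + int_vec m + (x - y)) x < r"
      using y(2) by (simp add: dist_norm norm_minus_commute algebra_simps)
    from low[OF this] have "c \<le> (cmod (h (z + (x - y) + int_vec m)))\<^sup>2" by (simp add: algebra_simps)
    hence "c \<le> (cmod (h (z + (x - y))))\<^sup>2" using h(2) by (simp add: periodic_def)
    also have "\<dots> \<le> (\<Sum>y\<in>D. (cmod (h (z + (x - y))))\<^sup>2)"
      by (intro member_le_sum[OF y(1)] D) auto
    finally show ?thesis by (simp add: H_def)
  qed
  hence "c \<le> Re (birkhoff \<alpha> H N)" if "N \<ge> 1" for N
  proof -
    have "real N * c \<le> (\<Sum>k<N. Re (H (real k *\<^sub>R \<alpha>)))"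
      using sum_mono[of "{..<N}" "\<lambda>_. c" "\<lambda>k. Re (H (real k *\<^sub>R \<alpha>))"] \<open>\<And>z. c \<le> Re (H z)\<close> by simp
    moreover have "Re (birkhoff \<alpha> H N) = (\<Sum>k<N. Re (H (real k *\<^sub>R \<alpha>))) / real N"
      using that by (simp add: birkhoff_def Re_divide_of_nat)
    ultimately show ?thesis using that by (simp add: pos_le_divide_eq mult.commute)
  qed
  ultimately have "c \<le> 0" by (intro LIMSEQ_le_const[of _ 0]) auto
  thus False using c by simp
qed

lemma trig_poly_orthogonal:
  assumes "trig_poly p" "\<And>n. has_mean \<alpha> (\<lambda>x. h x * torus_char n x) 0"
  shows "has_mean \<alpha> (\<lambda>x. h x * p x) 0"
  using assms(1)
proof (induction rule: trig_poly.induct)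
  case (trig_term f c n)
  thus ?case
    using has_mean_add[OF trig_term.IH has_mean_cmult[OF assms(2)[of n], of c]]
    by (simp add: algebra_simps)
qed (simp add: has_mean_const)

lemma continuous_periodic_bounded:
  fixes h :: "real^'d \<Rightarrow> complex"
  assumes h: "continuous_on UNIV h" "periodic h"
  shows "\<exists>B>0. \<forall>x. cmod (h x) \<le> B"
proof -
  have "compact (h ` cbox 0 (\<chi> j. 1))"
    by (intro compact_continuous_image compact_cbox continuous_on_subset[OF h(1)]) simp
  then obtain B where B: "B > 0" "\<And>x. x \<in> cbox 0 (\<chi> j. 1) \<Longrightarrow> cmod (h x) \<le> B"
    using compact_imp_bounded bounded_pos by (metis imageI)
  have "cmod (h x) \<le> B" for x
  proof -
    obtain m where "x + int_vec m \<in> cbox 0 (\<chi> j. 1)" by (rule periodic_fundamental_domain)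
    from B(2)[OF this] show ?thesis using h(2) by (simp add: periodic_def)
  qed
  thus ?thesis using B(1) by blast
qed

text \<open>Let \<open>p\<close> be a trigonometric polynomial uniformly close to the conjugate of
  \<open>h\<close>. Then \<open>h * p\<close> has mean zero and is close to the squared modulus of
  \<open>h\<close>, whose mean therefore vanishes.\<close>

lemma fourier_uniqueness:
  fixes h :: "real^'d \<Rightarrow> complex"
  assumes h: "continuous_on UNIV h" "periodic h"
    and zero: "\<And>n. has_mean \<alpha> (\<lambda>x. h x * torus_char n x) 0"
  shows "h x = 0"
proof (rule has_mean_norm_zero[OF h])
  obtain B where B: "B > 0" "\<And>x. cmod (h x) \<le> B" using continuous_periodic_bounded[OF h] by blast
  show "has_mean \<alpha> (\<lambda>x. of_real ((cmod (h x))\<^sup>2)) 0"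
  proof (rule has_mean_uniform_limit)
    fix \<epsilon> :: real assume "\<epsilon> > 0"
    have "continuous_on UNIV (\<lambda>x. cnj (h x))" "periodic (\<lambda>x. cnj (h x))"
      using h by (auto simp: periodic_def intro!: continuous_intros)
    then obtain p where p: "trig_poly p" "\<And>x. cmod (cnj (h x) - p x) < \<epsilon> / B"
      using trig_poly_dense[of "\<lambda>x. cnj (h x)" "\<epsilon> / B"] B(1) \<open>\<epsilon> > 0\<close> by auto
    have "cmod (of_real ((cmod (h x))\<^sup>2) - h x * p x) \<le> \<epsilon>" for x
    proof -
      have "of_real ((cmod (h x))\<^sup>2) - h x * p x = h x * (cnj (h x) - p x)"
        by (simp add: complex_norm_square right_diff_distrib del: of_real_power)
      hence "cmod (of_real ((cmod (h x))\<^sup>2) - h x * p x) = cmod (h x) * cmod (cnj (h x) - p x)"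
        by (simp only: norm_mult)
      also have "\<dots> \<le> B * (\<epsilon> / B)" using B p(2)[of x] by (intro mult_mono) (auto intro: less_imp_le)
      finally show ?thesis using B(1) by simp
    qed
    thus "\<exists>p d. has_mean \<alpha> p d \<and> (\<forall>x. cmod (of_real ((cmod (h x))\<^sup>2) - p x) \<le> \<epsilon>) \<and> cmod (d - 0) \<le> \<epsilon>"
      using trig_poly_orthogonal[OF p(1) zero] \<open>\<epsilon> > 0\<close> by (intro exI[of _ "\<lambda>x. h x * p x"] exI[of _ 0]) simp
  qed
qed

definition cvec :: "real^'d \<Rightarrow> complex^'d" where
  "cvec x = (\<chi> j. of_real (x $ j))"

lemma cvec_nth [simp]: "cvec x $ j = of_real (x $ j)"
  by (simp add: cvec_def)

lemma l1_norm_nonneg: "0 \<le> l1_norm n"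
  by (simp add: l1_norm_def sum_nonneg)

definition char_sign :: "int^'d \<Rightarrow> real^'d" where
  "char_sign n = (\<chi> j. - sgn (of_int (n $ j)))"

lemma inner_char_sign: "int_vec n \<bullet> char_sign n = - of_int (l1_norm n)"
proof -
  have "of_int (n $ j) * sgn (of_int (n $ j)) = (of_int \<bar>n $ j\<bar> :: real)" for j
    by (simp add: abs_sgn mult.commute sgn_if)
  thus ?thesis by (simp add: inner_vec_def int_vec_def char_sign_def l1_norm_def sum_negf)
qed

text \<open>The means of \<open>x \<mapsto> f (x + w v)\<close> are constant for real \<open>w\<close>, hence for all \<open>w\<close> with
  \<open>\<bar>Im w\<bar> < R\<close>; taking \<open>v\<^sub>j = - sgn n\<^sub>j\<close> and \<open>w\<close> close to \<open>\<i> R\<close> gains the exponential factor.\<close>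

lemma fourier_coefficient_decay:
  fixes F :: "complex^'d \<Rightarrow> complex"
  assumes R: "R > 0" and bound: "\<And>z. z \<in> strip R \<Longrightarrow> cmod (F z) \<le> K"
    and hol: "\<And>a v. (\<And>j. \<bar>v $ j\<bar> \<le> 1) \<Longrightarrow> (\<lambda>w. F (cvec a + w *s cvec v)) holomorphic_on {w. \<bar>Im w\<bar> < R}"
    and mean: "has_mean \<alpha> (\<lambda>x. F (cvec x) * torus_char (- n) x) c"
  shows "cmod c \<le> K * exp (- 2 * pi * R * of_int (l1_norm n))"
proof -
  define l where "l = real_of_int (l1_norm n)"
  have l0: "l \<ge> 0" by (simp add: l_def l1_norm_nonneg)
  define v where "v = char_sign n"
  have v1: "\<bar>v $ j\<bar> \<le> 1" for j by (simp add: v_def char_sign_def sgn_if)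
  define S where "S = {w. \<bar>Im w\<bar> < R}"
  have S: "open S" "convex S"
  proof -
    have "S = {w. Im w < R} \<inter> {w. Im w > - R}" by (auto simp: S_def)
    thus "open S" "convex S"
      by (auto intro!: open_Int convex_Int open_halfspace_Im_lt open_halfspace_Im_gt convex_halfspace_Im_lt convex_halfspace_Im_gt)
  qed
  have in_strip: "cvec a + w *s cvec v \<in> strip R" if "w \<in> S" for a w
  proof -
    have "\<bar>Im w * v $ j\<bar> < R" for j
    proof -
      have "\<bar>Im w * v $ j\<bar> \<le> \<bar>Im w\<bar> * 1" unfolding abs_mult by (intro mult_left_mono v1) auto
      thus ?thesis using that by (simp add: S_def)
    qed
    thus ?thesis by (simp add: strip_def)
  qed
  have K0: "K \<ge> 0"
  proof -
    have "0 \<in> S" using R by (simp add: S_def)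
    from bound[OF in_strip[OF this]] show ?thesis using norm_ge_zero order_trans by blast
  qed
  \<comment> \<open>The Birkhoff sums along \<open>cvec v\<close> continued to complex
    \<open>w\<close>; the exponential factor is the continuation of the character on that
    line.\<close>
  define H where "H N w = (\<Sum>k<N. F (cvec (real k *\<^sub>R \<alpha>) + w *s cvec v)
      * (torus_char (- n) (real k *\<^sub>R \<alpha>) * exp (2 * pi * l * \<i> * w))) / of_nat N" for N :: nat and w
  have norm_H: "cmod (H N w) \<le> K * exp (- 2 * pi * l * Im w)" if "w \<in> S" for N w
  proof (cases "N = 0")
    case False
    have "cmod (\<Sum>k<N. F (cvec (real k *\<^sub>R \<alpha>) + w *s cvec v)
      * (torus_char (- n) (real k *\<^sub>R \<alpha>) * exp (2 * pi * l * \<i> * w)))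
      \<le> of_nat (card {..<N}) * (K * exp (- 2 * pi * l * Im w))"
    proof (rule sum_norm_bound)
      fix k
      show "cmod (F (cvec (real k *\<^sub>R \<alpha>) + w *s cvec v)
          * (torus_char (- n) (real k *\<^sub>R \<alpha>) * exp (2 * pi * l * \<i> * w))) \<le> K * exp (- 2 * pi * l * Im w)"
        unfolding norm_mult using bound[OF in_strip[OF that]] by (simp add: norm_mult)
    qed
    thus ?thesis using False by (simp add: H_def norm_divide field_simps)
  qed (use K0 in \<open>simp add: H_def\<close>)
  have H_real: "(\<lambda>N. H N (of_real s)) \<longlonglongrightarrow> c" for s
  proof -
    have "H N (of_real s) = birkhoff \<alpha> (\<lambda>x. F (cvec (x + s *\<^sub>R v)) * torus_char (- n) (x + s *\<^sub>R v)) N" for N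
    proof -
      have "exp (2 * pi * l * \<i> * of_real s) = torus_char (- n) (s *\<^sub>R v)"
        by (simp add: torus_char_def v_def inner_char_sign l_def cis_conv_exp algebra_simps)
      moreover have "cvec x + of_real s *s cvec v = cvec (x + s *\<^sub>R v)" for x
        by (simp add: vec_eq_iff)
      ultimately show ?thesis by (simp add: H_def birkhoff_def torus_char_shift)
    qed
    thus ?thesis using mean unfolding has_mean_def by simp
  qed
  \<comment> \<open>Montel's theorem yields a holomorphic limit from the uniform bound alone. A
    subsequence suffices, since the limit is already known on the real axis.\<close>
  obtain g r where g: "g holomorphic_on S" "strict_mono r" "\<And>w. w \<in> S \<Longrightarrow> (\<lambda>N. H (r N) w) \<longlonglongrightarrow> g w"
  proof (rule Montel[OF S(1), of "range H" H])
    fix h assume "h \<in> range H"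
    then obtain N where h: "h = H N" by blast
    have "(\<lambda>w. F (cvec a + w *s cvec v)) holomorphic_on S" for a
      using hol[OF v1] by (simp add: S_def)
    thus "h holomorphic_on S" unfolding h H_def[abs_def] divide_inverse by (intro holomorphic_intros)
  next
    fix C assume C: "compact C" "C \<subseteq> S"
    have "cmod (H N w) \<le> K * exp (2 * pi * l * R)" if "w \<in> S" for N w
    proof -
      have "- 2 * pi * l * Im w = 2 * pi * l * (- Im w)" by simp
      also have "\<dots> \<le> 2 * pi * l * R" using that l0 by (intro mult_left_mono) (auto simp: S_def)
      finally show ?thesis using norm_H[OF that, of N] K0 by (meson exp_le_cancel_iff mult_left_mono order_trans)
    qed
    thus "\<exists>B. \<forall>h\<in>range H. \<forall>z\<in>C. cmod (h z) \<le> B" using C(2) by blast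
  qed auto
  have g_real: "g (of_real s) = c" for s
  proof (rule LIMSEQ_unique)
    show "(\<lambda>N. H (r N) (of_real s)) \<longlonglongrightarrow> g (of_real s)" using R by (intro g) (simp add: S_def)
    show "(\<lambda>N. H (r N) (of_real s)) \<longlonglongrightarrow> c"
      using LIMSEQ_subseq_LIMSEQ[OF H_real g(2)] by (simp add: o_def)
  qed
  have g_c: "g w = c" if "w \<in> S" for w
  proof -
    have "(\<lambda>w. g w - c) w = 0"
    proof (rule analytic_continuation[of "\<lambda>w. g w - c" S "range of_real" 0])
      show "(0::complex) islimpt range of_real"
        unfolding islimpt_approachable
      proof (intro allI impI)
        fix e :: real assume "e > 0"
        show "\<exists>x'\<in>range of_real. x' \<noteq> (0::complex) \<and> dist x' 0 < e"
        proof (rule bexI)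
          show "of_real (e / 2) \<in> range of_real" by (rule rangeI)
          show "of_real (e / 2) \<noteq> (0::complex) \<and> dist (of_real (e / 2)) (0::complex) < e"
            using \<open>e > 0\<close> by simp
        qed
      qed
    qed (use S g(1) g_real R that in \<open>auto simp: S_def intro!: holomorphic_intros convex_connected\<close>)
    thus ?thesis by simp
  qed
  have le: "cmod c \<le> K * exp (- 2 * pi * l * t)" if t: "0 \<le> t" "t < R" for t
  proof (rule LIMSEQ_le_const2)
    have "\<i> * of_real t \<in> S" using t by (simp add: S_def)
    from tendsto_norm[OF g(3)[OF this]] show "(\<lambda>N. cmod (H (r N) (\<i> * of_real t))) \<longlonglongrightarrow> cmod c"
      using g_c[OF \<open>\<i> * of_real t \<in> S\<close>] by simp
    show "\<exists>M. \<forall>N\<ge>M. cmod (H (r N) (\<i> * of_real t)) \<le> K * exp (- 2 * pi * l * t)"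
      using norm_H[OF \<open>\<i> * of_real t \<in> S\<close>] by auto
  qed
  have "((\<lambda>t. K * exp (- 2 * pi * l * t)) \<longlongrightarrow> K * exp (- 2 * pi * l * R)) (at_left R)"
    by (intro tendsto_intros)
  moreover have "eventually (\<lambda>t. cmod c \<le> K * exp (- 2 * pi * l * t)) (at_left R)"
    using eventually_at_left_real[OF R] by (rule eventually_mono) (rule le, auto)
  ultimately have "cmod c \<le> K * exp (- 2 * pi * l * R)"
    by (rule tendsto_lowerbound) simp
  thus ?thesis by (simp add: l_def algebra_simps)
qed

text \<open>Absolute summability makes the series converge uniformly, so its sum is continuous with
  the same Fourier coefficients as \<open>f\<close>; uniqueness then identifies the two.\<close>

lemma fourier_series:
  fixes f :: "real^'d \<Rightarrow> complex"
  assumes \<alpha>: "rationally_independent_with_one \<alpha>"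
    and f: "continuous_on UNIV f" "periodic f"
    and mean: "\<And>n. has_mean \<alpha> (\<lambda>x. f x * torus_char (- n) x) (c n)"
    and sum: "(\<lambda>n. cmod (c n)) summable_on UNIV"
  shows "f x = (\<Sum>\<^sub>\<infinity>n. c n * torus_char n x)"
proof -
  define g where "g x = (\<Sum>\<^sub>\<infinity>n. c n * torus_char n x)" for x
  have summ: "(\<lambda>n. c n * torus_char n x) summable_on A" for x A
    by (rule summable_on_subset_banach[OF _ subset_UNIV], rule abs_summable_summable) (use sum in \<open>simp add: norm_mult\<close>)
  have approx: "\<exists>F. finite F \<and> (\<forall>G x. finite G \<longrightarrow> F \<subseteq> G \<longrightarrow> cmod (g x - (\<Sum>n\<in>G. c n * torus_char n x)) \<le> \<epsilon>)" if "\<epsilon> > 0" for \<epsilon>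
  proof -
    define T where "T = (\<Sum>\<^sub>\<infinity>n. cmod (c n))"
    have "(sum (\<lambda>n. cmod (c n)) \<longlongrightarrow> T) (finite_subsets_at_top UNIV)"
      unfolding T_def by (rule infsum_tendsto[OF sum])
    hence "eventually (\<lambda>F. dist (sum (\<lambda>n. cmod (c n)) F) T < \<epsilon>) (finite_subsets_at_top UNIV)"
      using that by (rule tendstoD)
    then obtain F where F: "finite F" "\<And>G. finite G \<Longrightarrow> F \<subseteq> G \<Longrightarrow> dist (sum (\<lambda>n. cmod (c n)) G) T < \<epsilon>"
      unfolding eventually_finite_subsets_at_top by auto
    have "cmod (g x - (\<Sum>n\<in>G. c n * torus_char n x)) \<le> \<epsilon>" if G: "finite G" "F \<subseteq> G" for G x
    proof -
      have "g x = (\<Sum>\<^sub>\<infinity>n\<in>G \<union> (UNIV - G). c n * torus_char n x)" by (simp add: g_def)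
      also have "\<dots> = (\<Sum>\<^sub>\<infinity>n\<in>G. c n * torus_char n x) + (\<Sum>\<^sub>\<infinity>n\<in>UNIV - G. c n * torus_char n x)"
        by (rule infsum_Un_disjoint) (auto intro: summ)
      finally have "g x - (\<Sum>n\<in>G. c n * torus_char n x) = (\<Sum>\<^sub>\<infinity>n\<in>UNIV - G. c n * torus_char n x)"
        using G by simp
      also have "cmod \<dots> \<le> (\<Sum>\<^sub>\<infinity>n\<in>UNIV - G. cmod (c n))"
        using norm_infsum_bound[of "\<lambda>n. c n * torus_char n x" "UNIV - G"]
          summable_on_subset_banach[OF sum, of "UNIV - G"] by (simp add: norm_mult)
      also have "\<dots> = T - sum (\<lambda>n. cmod (c n)) G"
      proof -
        have "T = (\<Sum>\<^sub>\<infinity>n\<in>G \<union> (UNIV - G). cmod (c n))" by (simp add: T_def)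
        also have "\<dots> = (\<Sum>\<^sub>\<infinity>n\<in>G. cmod (c n)) + (\<Sum>\<^sub>\<infinity>n\<in>UNIV - G. cmod (c n))"
          by (rule infsum_Un_disjoint) (auto intro: summable_on_subset_banach[OF sum])
        finally show ?thesis using G by simp
      qed
      also have "\<dots> \<le> \<epsilon>" using F(2)[OF G] by (simp add: dist_real_def)
      finally show ?thesis .
    qed
    thus ?thesis using F(1) by blast
  qed
  have g_cont: "continuous_on UNIV g"
  proof (rule uniform_limit_theorem)
    show "uniform_limit UNIV (\<lambda>F x. \<Sum>n\<in>F. c n * torus_char n x) g (finite_subsets_at_top UNIV)"
    proof (rule uniform_limitI)
      fix e :: real assume "e > 0"
      then obtain F where F: "finite F" "\<And>G x. finite G \<Longrightarrow> F \<subseteq> G \<Longrightarrow> cmod (g x - (\<Sum>n\<in>G. c n * torus_char n x)) \<le> e / 2"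
        using approx[of "e / 2"] by auto
      show "\<forall>\<^sub>F G in finite_subsets_at_top UNIV. \<forall>x\<in>UNIV. dist (\<Sum>n\<in>G. c n * torus_char n x) (g x) < e"
        unfolding eventually_finite_subsets_at_top
        using F \<open>e > 0\<close>
        by (intro exI[of _ F]) (auto simp: dist_norm norm_minus_commute intro!: le_less_trans[OF F(2)])
    qed
    show "\<forall>\<^sub>F F in finite_subsets_at_top UNIV. continuous_on UNIV (\<lambda>x. \<Sum>n\<in>F. c n * torus_char n x)"
      by (intro always_eventually allI continuous_intros)
  qed simp
  have g_per: "periodic g" by (simp add: periodic_def g_def torus_char_shift)
  have g_mean: "has_mean \<alpha> (\<lambda>x. g x * torus_char (- n) x) (c n)" for n
  proof (rule has_mean_uniform_limit)
    fix \<epsilon> :: real assume "\<epsilon> > 0"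
    then obtain F where F: "finite F" "\<And>G x. finite G \<Longrightarrow> F \<subseteq> G \<Longrightarrow> cmod (g x - (\<Sum>n\<in>G. c n * torus_char n x)) \<le> \<epsilon>"
      using approx[of \<epsilon>] by auto
    define G where "G = insert n F"
    have G: "finite G" "F \<subseteq> G" "n \<in> G" using F by (auto simp: G_def)
    have "has_mean \<alpha> (\<lambda>x. \<Sum>m\<in>G. c m * (torus_char m x * torus_char (- n) x)) (\<Sum>m\<in>G. c m * (if m = n then 1 else 0))"
      by (intro has_mean_sum G has_mean_cmult has_mean_torus_char' \<alpha>)
    also have "(\<Sum>m\<in>G. c m * (if m = n then 1 else 0)) = c n" using G by (simp add: if_distrib cong: if_cong)
    finally have 1: "has_mean \<alpha> (\<lambda>x. \<Sum>m\<in>G. c m * (torus_char m x * torus_char (- n) x)) (c n)" .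
    have 2: "cmod (g x * torus_char (- n) x - (\<Sum>m\<in>G. c m * (torus_char m x * torus_char (- n) x))) \<le> \<epsilon>" for x
    proof -
      have "g x * torus_char (- n) x - (\<Sum>m\<in>G. c m * (torus_char m x * torus_char (- n) x))
          = (g x - (\<Sum>m\<in>G. c m * torus_char m x)) * torus_char (- n) x"
        by (simp add: left_diff_distrib sum_distrib_right mult.assoc)
      thus ?thesis using F(2)[OF G(1,2), of x] by (simp add: norm_mult)
    qed
    show "\<exists>p d. has_mean \<alpha> p d \<and> (\<forall>x. cmod (g x * torus_char (- n) x - p x) \<le> \<epsilon>) \<and> cmod (d - c n) \<le> \<epsilon>"
      using 1 2 \<open>\<epsilon> > 0\<close> by (intro exI conjI) auto
  qed
  have "f x - g x = 0"
  proof (rule fourier_uniqueness[of "\<lambda>x. f x - g x"])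
    show "continuous_on UNIV (\<lambda>x. f x - g x)" by (intro continuous_intros f g_cont)
    show "periodic (\<lambda>x. f x - g x)" using f(2) g_per by (simp add: periodic_def)
    show "has_mean \<alpha> (\<lambda>x. (f x - g x) * torus_char n x) 0" for n
      using has_mean_add[OF mean[of "- n"] has_mean_cmult[OF g_mean[of "- n"], of "-1"]]
      by (simp add: algebra_simps)
  qed
  thus ?thesis by (simp add: g_def)
qed

section \<open>Small divisors\<close>

text \<open>As long as the cosine is at least 1/2, compare derivatives; beyond \<open>pi / 3\<close>
  the sine is at least 4/5, which exceeds half of \<open>pi / 2\<close>.\<close>

lemma sin_ge_half:
  fixes y :: real
  assumes "0 \<le> y" "y \<le> pi / 2"
  shows "y / 2 \<le> sin y"
proof (cases "y \<le> pi / 3")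
  case True
  have "sin 0 - 0 / 2 \<le> sin y - y / 2"
  proof (rule DERIV_nonneg_imp_nondecreasing[OF assms(1)])
    fix x assume "0 \<le> x" "x \<le> y"
    hence "cos (pi / 3) \<le> cos x" using True by (intro cos_monotone_0_pi_le) auto
    hence "0 \<le> cos x - 1 / 2" by (simp add: cos_60)
    moreover have "((\<lambda>x. sin x - x / 2) has_real_derivative (cos x - 1 / 2)) (at x)"
      by (auto intro!: derivative_eq_intros)
    ultimately show "\<exists>D. ((\<lambda>x. sin x - x / 2) has_real_derivative D) (at x) \<and> 0 \<le> D" by blast
  qed
  thus ?thesis by simp
next
  case False
  hence "sin (pi / 3) \<le> sin y" using assms by (intro sin_monotone_2pi_le) auto
  moreover have "8 / 5 \<le> sqrt 3" by (rule real_le_rsqrt) (simp add: power2_eq_square)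
  moreover have "pi < 32 / 10" using pi_less_4 pi_approx by simp
  ultimately show ?thesis using assms(2) by (simp add: sin_60)
qed

lemma torus_dist_eq: "torus_dist x = \<bar>x - of_int (round x)\<bar>"
  unfolding torus_dist_def
proof (rule antisym)
  show "(INF j. \<bar>x - real_of_int j\<bar>) \<le> \<bar>x - of_int (round x)\<bar>"
    by (rule cINF_lower) (auto intro: bdd_belowI2[of _ 0])
  show "\<bar>x - of_int (round x)\<bar> \<le> (INF j. \<bar>x - real_of_int j\<bar>)"
    by (rule cINF_greatest) (auto intro: round_diff_minimal)
qed

lemma torus_dist_nonneg: "0 \<le> torus_dist x"
  by (simp add: torus_dist_eq)

lemma torus_dist_le_half: "torus_dist x \<le> 1 / 2"
  using of_int_round_abs_le[of x] by (simp add: torus_dist_eq abs_minus_commute)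

text \<open>The right-hand side is the chord \<open>2 * sin (pi * s)\<close>, with \<open>s\<close>
  the distance to the nearest integer. The bound \<open>y / 2\<close> for the sine is enough because
  \<open>pi > 1\<close>.\<close>

lemma torus_dist_le_cis: "torus_dist t \<le> cmod (cis (2 * pi * t) - 1)"
proof -
  define s where "s = t - of_int (round t)"
  have s: "torus_dist t = \<bar>s\<bar>" "\<bar>s\<bar> \<le> 1 / 2"
    using torus_dist_le_half[of t] by (simp_all add: torus_dist_eq s_def)
  have "cis (2 * pi * t) = cis (2 * pi * s) * cis (2 * pi * of_int (round t))"
    by (simp only: cis_mult s_def) (simp add: algebra_simps)
  hence c: "cis (2 * pi * t) = cis (2 * pi * s)" by simp
  have "(cmod (cis (2 * pi * s) - 1))\<^sup>2 = (cos (2 * pi * s) - 1)\<^sup>2 + (sin (2 * pi * s))\<^sup>2"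
    by (simp add: cmod_power2)
  also have "\<dots> = 2 - 2 * cos (2 * (pi * s))"
    using sin_cos_squared_add[of "2 * pi * s"] by (simp add: power2_diff mult.assoc)
  also have "\<dots> = (2 * sin (pi * s))\<^sup>2"
    by (simp add: cos_double_sin)
  finally have "cmod (cis (2 * pi * s) - 1) = \<bar>2 * sin (pi * s)\<bar>"
    by (metis abs_norm_cancel real_sqrt_abs)
  also have "\<dots> = 2 * \<bar>sin (pi * \<bar>s\<bar>)\<bar>" by (simp add: abs_if abs_mult)
  also have "\<dots> \<ge> 2 * (pi * \<bar>s\<bar> / 2)"
  proof -
    have "pi * \<bar>s\<bar> \<le> pi / 2" using s(2) mult_left_mono[OF s(2), of pi] by simp
    thus ?thesis using sin_ge_half[of "pi * \<bar>s\<bar>"] by simp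
  qed
  finally have "pi * \<bar>s\<bar> \<le> cmod (cis (2 * pi * s) - 1)" by simp
  moreover have "1 * \<bar>s\<bar> \<le> pi * \<bar>s\<bar>" using pi_ge_two by (intro mult_right_mono) auto
  ultimately show ?thesis unfolding c s by simp
qed

lemma torus_dist_le_char: "torus_dist (int_vec n \<bullet> \<alpha>) \<le> cmod (torus_char n \<alpha> - 1)"
  unfolding torus_char_def by (rule torus_dist_le_cis)

lemma sum_exp_abs_le:
  fixes a :: real
  assumes "a > 0"
  shows "(\<Sum>k\<in>{- int M..int M}. exp (- a * of_int \<bar>k\<bar>)) \<le> 1 + 2 / a"
proof -
  define q where "q = exp (- a)"
  have q: "0 < q" "q < 1" using assms by (simp_all add: q_def)
  have geo: "(\<Sum>k<M. q ^ Suc k) \<le> 1 / a"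
  proof -
    have "(\<Sum>k<M. q ^ Suc k) = q * ((1 - q ^ M) / (1 - q))"
      using q by (simp add: sum_distrib_left[symmetric] sum_gp_strict)
    also have "\<dots> \<le> q * (1 / (1 - q))"
      using q by (intro mult_left_mono divide_right_mono) auto
    also have "\<dots> \<le> 1 / a"
    proof -
      have "q * (1 + a) \<le> q * exp a" using q exp_ge_add_one_self[of a] by (intro mult_left_mono) auto
      also have "\<dots> = 1" by (simp add: q_def flip: exp_add)
      finally show ?thesis using q assms by (simp add: field_simps)
    qed
    finally show ?thesis .
  qed
  have "(\<Sum>k\<in>{- int M..int M}. exp (- a * of_int \<bar>k\<bar>)) = 1 + 2 * (\<Sum>k<M. q ^ Suc k)"
  proof (induction M)
    case (Suc M)
    have "{- int (Suc M)..int (Suc M)} = insert (- int (Suc M)) (insert (int (Suc M)) {- int M..int M})"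
      by auto
    moreover have "exp (- a * of_int \<bar>int (Suc M)\<bar>) = q ^ Suc M"
      by (simp only: q_def exp_of_nat_mult[symmetric]) (simp add: algebra_simps)
    ultimately show ?case using Suc.IH by (simp add: add.commute[of _ "1::real"])
  qed simp
  thus ?thesis using geo by simp
qed

text \<open>The exponential of the norm is a product over the coordinates, so a sum over a box
  factorises into one-dimensional geometric sums.\<close>

lemma sum_exp_l1_norm_le:
  fixes a :: real
  assumes "a > 0" and "finite (F :: (int^'d) set)"
  shows "(\<Sum>n\<in>F. exp (- a * of_int (l1_norm n))) \<le> (1 + 2 / a) ^ CARD('d)"
proof -
  define M where "M = Max (insert 0 ((\<lambda>n. nat (l1_norm n)) ` F))"
  have M: "l1_norm n \<le> int M" if "n \<in> F" for n
  proof -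
    have "nat (l1_norm n) \<le> M" unfolding M_def using that assms(2) by (intro Max_ge) auto
    thus ?thesis by simp
  qed
  define I where "I = {- int M..int M}"
  have sub: "($) ` F \<subseteq> PiE UNIV (\<lambda>_. I)"
  proof safe
    fix n :: "int^'d" and j assume "n \<in> F"
    have "\<bar>n $ j\<bar> \<le> l1_norm n"
      unfolding l1_norm_def by (rule member_le_sum) auto
    thus "n $ j \<in> I" using M[OF \<open>n \<in> F\<close>] by (auto simp: I_def)
  qed auto
  have inj: "inj_on ($) F" by (auto simp: inj_on_def vec_nth_inject)
  have "(\<Sum>n\<in>F. exp (- a * of_int (l1_norm n))) = (\<Sum>n\<in>F. \<Prod>j\<in>UNIV. exp (- a * of_int \<bar>n $ j\<bar>))"
    by (simp add: l1_norm_def exp_sum sum_distrib_left flip: sum_negf)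
  also have "\<dots> = (\<Sum>g\<in>($) ` F. \<Prod>j\<in>UNIV. exp (- a * of_int \<bar>g j\<bar>))"
    by (simp add: sum.reindex[OF inj])
  also have "\<dots> \<le> (\<Sum>g\<in>PiE UNIV (\<lambda>_. I). \<Prod>j\<in>(UNIV :: 'd set). exp (- a * of_int \<bar>g j\<bar>))"
    by (intro sum_mono2 sub finite_PiE) (auto simp: I_def prod_nonneg)
  also have "\<dots> = (\<Prod>j\<in>(UNIV :: 'd set). \<Sum>k\<in>I. exp (- a * of_int \<bar>k\<bar>))"
    by (rule prod_sum_PiE[symmetric]) (auto simp: I_def)
  also have "\<dots> = (\<Sum>k\<in>I. exp (- a * of_int \<bar>k\<bar>)) ^ CARD('d)" by simp
  also have "\<dots> \<le> (1 + 2 / a) ^ CARD('d)"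
    unfolding I_def by (intro power_mono sum_exp_abs_le assms sum_nonneg) auto
  finally show ?thesis .
qed

lemma summable_exp_l1_norm:
  fixes a :: real
  assumes "a > 0"
  shows "(\<lambda>n::int^'d. exp (- a * of_int (l1_norm n))) summable_on A"
    and "(\<Sum>\<^sub>\<infinity>n::int^'d\<in>A. exp (- a * of_int (l1_norm n))) \<le> (1 + 2 / a) ^ CARD('d)"
proof -
  show *: "(\<lambda>n::int^'d. exp (- a * of_int (l1_norm n))) summable_on A"
    by (rule nonneg_bdd_above_summable_on)
       (use sum_exp_l1_norm_le[OF assms] in \<open>auto intro!: bdd_aboveI2\<close>)
  show "(\<Sum>\<^sub>\<infinity>n::int^'d\<in>A. exp (- a * of_int (l1_norm n))) \<le> (1 + 2 / a) ^ CARD('d)"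
    by (rule infsum_le_finite_sums[OF *]) (rule sum_exp_l1_norm_le[OF assms])
qed

section \<open>The small divisor series and its two upper bounds\<close>

lemma finite_l1_ball: "finite {n::int^'d. l1_norm n \<le> k}"
proof -
  have "{n::int^'d. l1_norm n \<le> k} \<subseteq> (\<lambda>g. \<chi> j. g j) ` PiE UNIV (\<lambda>_. {- k..k})"
  proof
    fix n :: "int^'d" assume "n \<in> {n. l1_norm n \<le> k}"
    moreover have "\<bar>n $ j\<bar> \<le> l1_norm n" for j
      unfolding l1_norm_def by (rule member_le_sum) auto
    ultimately have "\<bar>n $ j\<bar> \<le> k" for j by (meson mem_Collect_eq order_trans)
    hence "($) n \<in> PiE UNIV (\<lambda>_. {- k..k})" by (auto simp: abs_le_iff) (metis minus_le_iff)
    moreover have "n = (\<chi> j. n $ j)" by simp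
    ultimately show "n \<in> (\<lambda>g. \<chi> j. g j) ` PiE UNIV (\<lambda>_. {- k..k})" by blast
  qed
  thus ?thesis by (rule finite_subset) (intro finite_imageI finite_PiE, auto)
qed

text \<open>Two rates \<rho> occur: \<open>2 * pi * R\<close>, at which the Fourier coefficients
  decay, and half of \<open>R\<close> plus three times \<open>beta \<alpha>\<close>, as in
  \<open>D_alpha\<close>.\<close>

definition small_divisor_term :: "real \<Rightarrow> real^'d \<Rightarrow> int^'d \<Rightarrow> real" where
  "small_divisor_term \<rho> \<alpha> n = exp (- \<rho> * of_int (l1_norm n)) / cmod (torus_char n \<alpha> - 1) ^ 3"

lemma small_divisor_term_nonneg: "0 \<le> small_divisor_term \<rho> \<alpha> n"
  by (simp add: small_divisor_term_def)

lemma small_divisor_term_mono: "\<rho> \<le> \<sigma> \<Longrightarrow> small_divisor_term \<sigma> \<alpha> n \<le> small_divisor_term \<rho> \<alpha> n"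
  unfolding small_divisor_term_def
  by (intro divide_right_mono) (auto intro!: mult_right_mono simp: l1_norm_nonneg)

lemma l1_norm_pos: "n \<noteq> 0 \<Longrightarrow> 1 \<le> l1_norm n"
proof (rule ccontr)
  assume "n \<noteq> 0" "\<not> 1 \<le> l1_norm n"
  hence "l1_norm n = 0" using l1_norm_nonneg[of n] by linarith
  hence "\<And>j. \<bar>n $ j\<bar> = 0"
    unfolding l1_norm_def by (subst (asm) sum_nonneg_eq_0_iff) auto
  thus False using \<open>n \<noteq> 0\<close> by (simp add: vec_eq_iff)
qed

text \<open>Outside a finite ball the divisors are bounded below by
  \<open>exp (- b * l1_norm n)\<close>, so their cubes use up \<open>3 * b\<close> of the decay
  rate.\<close>

lemma small_divisor_summable:
  fixes \<alpha> :: "real^'d"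
  assumes \<alpha>: "rationally_independent_with_one \<alpha>"
    and b: "beta \<alpha> < ereal b" "3 * b < \<rho>"
  shows "small_divisor_term \<rho> \<alpha> summable_on UNIV - {0}"
proof -
  have "eventually (\<lambda>n. ereal (1 / real_of_int (l1_norm n) * ln (1 / torus_dist (int_vec n \<bullet> \<alpha>))) < ereal b)
      (filtercomap l1_norm at_top)"
    by (rule Limsup_lessD) (use b(1) in \<open>simp add: beta_def\<close>)
  then obtain k where k: "\<And>n. l1_norm n \<ge> k \<Longrightarrow> 1 / real_of_int (l1_norm n) * ln (1 / torus_dist (int_vec n \<bullet> \<alpha>)) < b"
    unfolding eventually_filtercomap_at_top_linorder by auto
  define G where "G = {n::int^'d. l1_norm n \<le> k}"
  have bound: "small_divisor_term \<rho> \<alpha> n \<le> exp (- (\<rho> - 3 * b) * of_int (l1_norm n))"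
    if n: "n \<in> (UNIV - {0}) - G" for n
  proof -
    have l: "real_of_int (l1_norm n) > 0" using l1_norm_pos[of n] n by simp
    define d where "d = torus_dist (int_vec n \<bullet> \<alpha>)"
    \<comment> \<open>As \<open>1 / 0 = 0\<close>, the bound on the logarithm would not exclude a
      vanishing divisor; rational independence does.\<close>
    have d0: "d > 0"
    proof (rule ccontr)
      assume "\<not> d > 0"
      hence "d = 0" using torus_dist_nonneg[of "int_vec n \<bullet> \<alpha>"] by (simp add: d_def)
      hence "int_vec n \<bullet> \<alpha> = of_int (round (int_vec n \<bullet> \<alpha>))" by (simp add: d_def torus_dist_eq)
      hence "torus_char n \<alpha> = 1" unfolding torus_char_def by (metis cis_2pi_int)
      thus False using torus_char_neq_1[OF \<alpha>, of n] n by simp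
    qed
    have "1 / real_of_int (l1_norm n) * ln (1 / d) < b" using k[of n] n by (auto simp: G_def d_def)
    hence "ln (1 / d) < b * of_int (l1_norm n)" using l by (simp add: field_simps)
    hence "1 / d < exp (b * of_int (l1_norm n))"
      using d0 by (metis exp_less_mono exp_ln zero_less_divide_1_iff)
    hence "exp (- b * of_int (l1_norm n)) \<le> d"
      using d0 by (simp add: exp_minus field_simps)
    also have "d \<le> cmod (torus_char n \<alpha> - 1)" unfolding d_def by (rule torus_dist_le_char)
    finally have "exp (- b * of_int (l1_norm n)) ^ 3 \<le> cmod (torus_char n \<alpha> - 1) ^ 3"
      by (intro power_mono) auto
    hence "small_divisor_term \<rho> \<alpha> n \<le> exp (- \<rho> * of_int (l1_norm n)) / exp (- b * of_int (l1_norm n)) ^ 3"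
      unfolding small_divisor_term_def by (intro divide_left_mono mult_pos_pos) (auto intro: less_le_trans[of _ "exp (- b * of_int (l1_norm n)) ^ 3"])
    also have "\<dots> = exp (- (\<rho> - 3 * b) * of_int (l1_norm n))"
      by (simp add: exp_of_nat_mult[symmetric] exp_diff[symmetric] algebra_simps)
    finally show ?thesis .
  qed
  have "small_divisor_term \<rho> \<alpha> summable_on (UNIV - {0}) - G"
    by (rule summable_on_comparison_test[OF summable_exp_l1_norm(1)[of "\<rho> - 3 * b"]])
       (use b(2) bound small_divisor_term_nonneg in auto)
  hence "small_divisor_term \<rho> \<alpha> summable_on ((UNIV - {0}) - G) \<union> ((UNIV - {0}) \<inter> G)"
    by (intro summable_on_Un_disjoint) (auto simp: G_def finite_l1_ball)
  moreover have "((UNIV - {0}) - G) \<union> ((UNIV - {0}) \<inter> G) = UNIV - {0}" by auto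
  ultimately show ?thesis by simp
qed

text \<open>The rate in \<open>D_alpha\<close> lies above three times \<open>beta \<alpha>\<close>,
  so its series converges, and it lies below \<open>2 * pi * R\<close>, so that series dominates the
  one produced by the Fourier coefficients.\<close>

lemma D_alpha_ge:
  fixes \<alpha> :: "real^'d"
  assumes \<alpha>: "rationally_independent_with_one \<alpha>"
    and R: "0 < R" "3 * beta \<alpha> < ereal R" "0 \<le> 3 * beta \<alpha>"
  shows "small_divisor_term (2 * pi * R) \<alpha> summable_on UNIV - {0}"
    and "2 + 40 * (\<Sum>\<^sub>\<infinity>n\<in>UNIV - {0}. small_divisor_term (2 * pi * R) \<alpha> n) \<le> D_alpha \<alpha> R"
proof -
  obtain b where b: "beta \<alpha> = ereal b" "0 \<le> b" "3 * b < R"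
    using R(2,3) by (cases "beta \<alpha>") (auto simp: zero_ereal_def one_ereal_def numeral_eq_ereal)
  define \<rho> where "\<rho> = (R + 3 * b) / 2"
  \<comment> \<open>The bound has to exceed \<open>beta \<alpha>\<close> strictly while its triple
    stays below \<rho>; the midpoint of \<open>b\<close> and \<open>\<rho> / 3\<close> does
    both.\<close>
  have \<rho>: "3 * ((b + \<rho> / 3) / 2) < \<rho>" "b < (b + \<rho> / 3) / 2" using b by (simp_all add: \<rho>_def field_simps)
  have s: "small_divisor_term \<rho> \<alpha> summable_on UNIV - {0}"
    by (rule small_divisor_summable[OF \<alpha> _ \<rho>(1)]) (use b(1) \<rho>(2) in simp)
  have le: "\<rho> \<le> 2 * pi * R"
  proof -
    have "\<rho> \<le> 1 * R" using b by (simp add: \<rho>_def)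
    also have "\<dots> \<le> 2 * pi * R" using R(1) pi_ge_two by (intro mult_right_mono) auto
    finally show ?thesis .
  qed
  show s2: "small_divisor_term (2 * pi * R) \<alpha> summable_on UNIV - {0}"
    by (rule summable_on_comparison_test[OF s]) (auto simp: small_divisor_term_mono[OF le] small_divisor_term_nonneg)
  have "(\<Sum>\<^sub>\<infinity>n\<in>UNIV - {0}. small_divisor_term (2 * pi * R) \<alpha> n) \<le> (\<Sum>\<^sub>\<infinity>n\<in>UNIV - {0}. small_divisor_term \<rho> \<alpha> n)"
    by (rule infsum_mono[OF s2 s]) (rule small_divisor_term_mono[OF le])
  moreover have "small_divisor_term \<rho> \<alpha> n = exp (- (R + 3 * real_of_ereal (beta \<alpha>)) * real_of_int (l1_norm n) / 2)
       / cmod (exp (2 * of_real pi * \<i> * of_real (int_vec n \<bullet> \<alpha>)) - 1) ^ 3" for n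
    by (simp add: small_divisor_term_def \<rho>_def b(1) torus_char_def cis_conv_exp algebra_simps)
  ultimately show "2 + 40 * (\<Sum>\<^sub>\<infinity>n\<in>UNIV - {0}. small_divisor_term (2 * pi * R) \<alpha> n) \<le> D_alpha \<alpha> R"
    by (simp add: D_alpha_def)
qed

text \<open>Drop the part of the Gamma integral before \<open>x\<close> and replace
  \<open>t powr s\<close> by its value at \<open>x\<close> on the rest.\<close>

lemma powr_exp_le_Gamma:
  fixes s x :: real
  assumes "0 \<le> s" "0 \<le> x"
  shows "x powr s * exp (- x) \<le> Gamma (s + 1)"
proof (rule has_integral_le)
  have "((\<lambda>t. exp (- 1 * t)) has_integral exp (- 1 * x) / 1) {x..}"
    by (rule has_integral_exp_minus_to_infinity) simp
  hence "((\<lambda>t. x powr s * exp (- t)) has_integral x powr s * exp (- x)) {x..}"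
    by (intro has_integral_mult_right) simp
  thus "((\<lambda>t. if t \<in> {x..} then x powr s * exp (- t) else 0) has_integral x powr s * exp (- x)) {0..}"
    by (subst has_integral_restrict) (use assms in auto)
  show "((\<lambda>t. t powr s / exp t) has_integral Gamma (s + 1)) {0..}"
    using Gamma_integral_real[of "s + 1"] assms by simp
  show "(if t \<in> {x..} then x powr s * exp (- t) else 0) \<le> t powr s / exp t" if "t \<in> {0..}" for t
    using assms powr_mono2[of s x t] by (simp add: exp_minus field_simps)
qed

text \<open>This fits the power \<open>3 * \<tau>\<close> of the cubed divisors to the Gamma value
  in \<open>D_tau\<close>. For \<open>y \<ge> 1\<close> the exponent may be raised to
  \<open>4 * \<tau> + 1\<close>. For smaller \<open>y\<close> the product is at most 1, and the
  factor 3 compensates for \<open>exp (- 1)\<close>.\<close>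

lemma powr_exp_le_Gamma':
  fixes \<tau> y :: real
  assumes "0 \<le> \<tau>" "0 < y"
  shows "y powr (3 * \<tau>) * exp (- y) \<le> 3 * Gamma (4 * \<tau> + 2)" "1 \<le> 3 * Gamma (4 * \<tau> + 2)"
proof -
  have G: "z powr (4 * \<tau> + 1) * exp (- z) \<le> Gamma (4 * \<tau> + 2)" if "z \<ge> 0" for z
    using powr_exp_le_Gamma[of "4 * \<tau> + 1" z] assms that by (simp add: add.commute)
  have "exp (- 1) \<le> Gamma (4 * \<tau> + 2)" using G[of 1] by simp
  moreover have "1 / 3 \<le> exp (- 1 :: real)" using exp_le by (simp add: exp_minus field_simps)
  ultimately show 1: "1 \<le> 3 * Gamma (4 * \<tau> + 2)" by simp
  show "y powr (3 * \<tau>) * exp (- y) \<le> 3 * Gamma (4 * \<tau> + 2)"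
  proof (cases "y \<ge> 1")
    case True
    have "y powr (3 * \<tau>) * exp (- y) \<le> y powr (4 * \<tau> + 1) * exp (- y)"
      using True assms by (intro mult_right_mono powr_mono) auto
    also have "\<dots> \<le> Gamma (4 * \<tau> + 2)" using assms by (intro G) simp
    finally show ?thesis using 1 by simp
  next
    case False
    have "y powr (3 * \<tau>) * exp (- y) \<le> 1 * 1"
      using False assms by (intro mult_mono powr_le1) auto
    thus ?thesis using 1 by simp
  qed
qed

text \<open>The exponential decay is split into halves. One absorbs the cubed divisors, at the price
  of a Gamma value and \<open>3 * \<tau>\<close> powers of \<open>1 / R\<close>; the other is summed
  and contributes \<open>CARD('d) < \<tau> + 1\<close> powers. Together this is the exponent
  \<open>4 * \<tau> + 1\<close>.\<close>

lemma D_tau_ge: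
  fixes \<alpha> :: "real^'d"
  assumes R: "0 < R" "R < 1" and \<gamma>: "0 < \<gamma>" and \<tau>: "real CARD('d) - 1 < \<tau>" and DC: "\<alpha> \<in> DC \<gamma> \<tau>"
    and s: "small_divisor_term (2 * pi * R) \<alpha> summable_on UNIV - {0}"
  shows "(2 + 40 * (\<Sum>\<^sub>\<infinity>n\<in>UNIV - {0}. small_divisor_term (2 * pi * R) \<alpha> n)) * (\<gamma> ^ 3 * R powr (4 * \<tau> + 1))
    \<le> D_tau \<tau>"
proof -
  have d1: "real CARD('d) \<ge> 1" by (simp add: Suc_leI)
  have \<tau>0: "\<tau> > 0" using \<tau> d1 by linarith
  define \<Gamma> where "\<Gamma> = Gamma (4 * \<tau> + 2)"
  have \<Gamma>: "1 \<le> 3 * \<Gamma>" using powr_exp_le_Gamma'(2)[of \<tau> 1] \<tau>0 by (simp add: \<Gamma>_def)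
  have dc: "\<gamma> * real_of_int (l1_norm n) powr (- \<tau>) < torus_dist (int_vec n \<bullet> \<alpha>)" if "n \<noteq> 0" for n
    using DC that by (simp add: DC_def)
  \<comment> \<open>The Diophantine condition is tested on a unit vector, whose norm is 1. This
    makes the factor \<open>x\<close> below at most 1.\<close>
  have \<gamma>1: "\<gamma> \<le> 1"
  proof -
    define j :: 'd where "j = undefined"
    have "l1_norm (axis j 1 :: int^'d) = (\<Sum>i\<in>UNIV. if i = j then 1 else 0)"
      unfolding l1_norm_def by (intro sum.cong) (auto simp: axis_def)
    hence "l1_norm (axis j 1 :: int^'d) = 1" by simp
    moreover have "axis j 1 \<noteq> (0 :: int^'d)" by (simp add: axis_eq_0_iff)
    ultimately show ?thesis
      using dc[of "axis j 1"] torus_dist_le_half[of "int_vec (axis j 1) \<bullet> \<alpha>"] by simp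
  qed
  define C where "C = 3 * \<Gamma> * inverse \<gamma> ^ 3 * (1 / R) powr (3 * \<tau>)"
  have C0: "C \<ge> 0" using \<Gamma> \<gamma> by (simp add: C_def)
  have bound: "small_divisor_term (2 * pi * R) \<alpha> n \<le> C * exp (- (pi * R) * of_int (l1_norm n))" if n: "n \<noteq> 0" for n
  proof -
    define L where "L = real_of_int (l1_norm n)"
    have L: "L \<ge> 1" using l1_norm_pos[OF n] by (simp add: L_def)
    have pos: "0 < \<gamma> * L powr (- \<tau>)" using \<gamma> L by simp
    have le: "\<gamma> * L powr (- \<tau>) \<le> cmod (torus_char n \<alpha> - 1)"
      using dc[OF n] torus_dist_le_char[of n \<alpha>] by (simp add: L_def)
    have "small_divisor_term (2 * pi * R) \<alpha> n \<le> exp (- (2 * pi * R) * L) / (\<gamma> * L powr (- \<tau>)) ^ 3"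
      unfolding small_divisor_term_def L_def[symmetric]
      using \<gamma> pos le less_le_trans[OF pos le]
      by (intro divide_left_mono mult_pos_pos zero_less_power power_mono) auto
    also have "\<dots> = inverse \<gamma> ^ 3 * L powr (3 * \<tau>) * exp (- (2 * pi * R) * L)"
    proof -
      have "(L powr (- \<tau>)) ^ 3 = inverse (L powr (3 * \<tau>))"
        using L by (simp add: powr_power mult.commute flip: powr_minus)
      thus ?thesis using \<gamma> L by (simp add: power_mult_distrib field_simps)
    qed
    also have "L powr (3 * \<tau>) * exp (- (2 * pi * R) * L)
        = (1 / (pi * R)) powr (3 * \<tau>) * ((pi * R * L) powr (3 * \<tau>) * exp (- (pi * R * L))) * exp (- (pi * R) * L)"
    proof -
      have "(1 / (pi * R)) powr (3 * \<tau>) * (pi * R * L) powr (3 * \<tau>) = L powr (3 * \<tau>)"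
        using R L by (subst powr_mult[symmetric]) auto
      moreover have "exp (- (2 * pi * R) * L) = exp (- (pi * R * L)) * exp (- (pi * R) * L)"
        by (simp flip: exp_add)
      ultimately show ?thesis by (simp add: algebra_simps)
    qed
    hence "inverse \<gamma> ^ 3 * L powr (3 * \<tau>) * exp (- (2 * pi * R) * L)
      = inverse \<gamma> ^ 3 * ((1 / (pi * R)) powr (3 * \<tau>) * ((pi * R * L) powr (3 * \<tau>) * exp (- (pi * R * L)))) * exp (- (pi * R) * L)"
      by simp
    also have "\<dots> \<le> inverse \<gamma> ^ 3 * ((1 / R) powr (3 * \<tau>) * (3 * \<Gamma>)) * exp (- (pi * R) * L)"
    proof (rule mult_right_mono[OF mult_left_mono[OF mult_mono]])
      show "(1 / (pi * R)) powr (3 * \<tau>) \<le> (1 / R) powr (3 * \<tau>)"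
        using R \<tau>0 pi_ge_two by (intro powr_mono2) (auto simp: field_simps)
      show "(pi * R * L) powr (3 * \<tau>) * exp (- (pi * R * L)) \<le> 3 * \<Gamma>"
        unfolding \<Gamma>_def using \<tau>0 R L by (intro powr_exp_le_Gamma'(1)) auto
    qed (use \<gamma> in auto)
    finally show ?thesis by (simp add: C_def L_def algebra_simps)
  qed
  define S where "S = (\<Sum>\<^sub>\<infinity>n\<in>UNIV - {0}. small_divisor_term (2 * pi * R) \<alpha> n)"
  have piR: "pi * R > 0" using R by simp
  note ex = summable_exp_l1_norm[OF piR, of "UNIV - {0 :: int^'d}"]
  have "S \<le> (\<Sum>\<^sub>\<infinity>n\<in>UNIV - {0 :: int^'d}. C * exp (- (pi * R) * of_int (l1_norm n)))"
    unfolding S_def by (intro infsum_mono[OF s] summable_on_cmult_right ex) (use bound in auto)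
  also have "\<dots> = C * (\<Sum>\<^sub>\<infinity>n\<in>UNIV - {0 :: int^'d}. exp (- (pi * R) * of_int (l1_norm n)))"
    by (rule infsum_cmult_right) (use ex(1) in simp)
  also have "\<dots> \<le> C * (1 + 2 / (pi * R)) ^ CARD('d)"
    by (intro mult_left_mono ex C0)
  also have "\<dots> \<le> C * (2 / R) ^ CARD('d)"
  proof (intro mult_left_mono power_mono C0)
    have "2 / (pi * R) \<le> 1 / R" using R pi_ge_two by (simp add: field_simps)
    moreover have "1 \<le> 1 / R" using R by simp
    ultimately show "1 + 2 / (pi * R) \<le> 2 / R" by (simp add: field_simps)
  qed (use R in auto)
  also have "(2 / R) ^ CARD('d) = (2 / R) powr real CARD('d)" using R by (simp add: powr_realpow)
  also have "C * (2 / R) powr real CARD('d) \<le> C * (2 / R) powr (\<tau> + 1)"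
    using R \<tau> C0 by (intro mult_left_mono powr_mono) (auto simp: field_simps)
  also have "(2 / R) powr (\<tau> + 1) = 2 powr (\<tau> + 1) * (1 / R) powr (\<tau> + 1)"
    using R by (subst powr_mult[symmetric]) auto
  also have "C * (2 powr (\<tau> + 1) * (1 / R) powr (\<tau> + 1))
      = 6 * \<Gamma> * 2 powr \<tau> * (inverse \<gamma> ^ 3 * (1 / R) powr (4 * \<tau> + 1))"
    using R by (simp add: C_def powr_add) (simp add: mult.commute flip: powr_add)
  finally have S: "S \<le> 6 * \<Gamma> * 2 powr \<tau> * (inverse \<gamma> ^ 3 * (1 / R) powr (4 * \<tau> + 1))" .
  define x where "x = \<gamma> ^ 3 * R powr (4 * \<tau> + 1)"
  have x: "0 < x" "x \<le> 1"
    using \<gamma> R \<gamma>1 \<tau>0 by (auto simp: x_def intro!: mult_le_one power_le_one powr_le1)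
  have "inverse \<gamma> ^ 3 * (1 / R) powr (4 * \<tau> + 1) = 1 / x"
    using R \<gamma> by (simp add: x_def power_inverse powr_divide field_simps)
  hence "S \<le> 6 * \<Gamma> * 2 powr \<tau> / x" using S by simp
  hence Sx: "S * x \<le> 6 * \<Gamma> * 2 powr \<tau>" using x by (simp add: pos_le_divide_eq)
  have "1 \<le> (2::real) powr \<tau>" using \<tau>0 by (simp add: ge_one_powr_ge_zero)
  hence "2 \<le> 6 * \<Gamma> * 2 powr \<tau>" using \<Gamma> mult_mono[of 1 "3 * \<Gamma>" 1 "2 powr \<tau>"] by simp
  hence "(2 + 40 * S) * x \<le> 246 * \<Gamma> * 2 powr \<tau>"
    using Sx x by (simp add: algebra_simps)
  also have "\<dots> \<le> 512 * 2 powr (4 * \<tau>) * \<Gamma>"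
  proof -
    have "2 powr \<tau> \<le> (2::real) powr (4 * \<tau>)" using \<tau>0 by (intro powr_mono) auto
    moreover have "\<Gamma> \<ge> 0" using \<Gamma> by simp
    ultimately have "\<Gamma> * 2 powr \<tau> \<le> \<Gamma> * 2 powr (4 * \<tau>)" "0 \<le> \<Gamma> * 2 powr (4 * \<tau>)"
      by (auto intro: mult_left_mono)
    thus ?thesis by (simp add: mult.commute)
  qed
  also have "\<dots> = D_tau \<tau>" by (simp add: D_tau_def \<Gamma>_def powr_add)
  finally show ?thesis by (simp add: x_def S_def)
qed

section \<open>Solution of the cohomological equation for an analytic product\<close>

lemma holomorphic_on_line:
  fixes F :: "complex^'d \<Rightarrow> complex"
  assumes F: "holomorphic_several F (strip R)" and v: "\<And>j. \<bar>v $ j\<bar> \<le> 1"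
  shows "(\<lambda>w. F (cvec a + w *s cvec v)) holomorphic_on {w. \<bar>Im w\<bar> < R}"
proof (rule holomorphic_onI)
  fix w assume "w \<in> {w. \<bar>Im w\<bar> < R}"
  hence "\<bar>Im w * v $ j\<bar> < R" for j
    unfolding abs_mult using mult_left_mono[OF v[of j], of "\<bar>Im w\<bar>"] by simp
  hence "cvec a + w *s cvec v \<in> strip R" by (simp add: strip_def)
  then obtain D where D: "(F has_derivative D) (at (cvec a + w *s cvec v))" "\<And>c z. D (c *s z) = c * D z"
    using F unfolding holomorphic_several_def by blast
  have "linear (\<lambda>h::complex. h *s cvec v)"
    by (rule linearI) (simp_all add: vec_eq_iff algebra_simps)
  hence "bounded_linear (\<lambda>h::complex. h *s cvec v)"
    by (simp add: linear_conv_bounded_linear)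
  hence "((\<lambda>w. cvec a + w *s cvec v) has_derivative (\<lambda>h. h *s cvec v)) (at w)"
    by (intro derivative_eq_intros bounded_linear_imp_has_derivative) (auto intro: bounded_linear_imp_has_derivative)
  from has_derivative_compose[OF this D(1)]
  have "((\<lambda>w. F (cvec a + w *s cvec v)) has_derivative (\<lambda>h. D (cvec v) * h)) (at w)"
    by (simp add: D(2) mult.commute)
  hence "((\<lambda>w. F (cvec a + w *s cvec v)) has_field_derivative D (cvec v)) (at w)"
    by (simp add: has_field_derivative_def)
  thus "(\<lambda>w. F (cvec a + w *s cvec v)) field_differentiable at w within {w. \<bar>Im w\<bar> < R}"
    using field_differentiable_def field_differentiable_at_within by blast
qed

lemma continuous_on_cvec_holomorphic:
  fixes F :: "complex^'d \<Rightarrow> complex"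
  assumes F: "holomorphic_several F (strip R)" and "R > 0"
  shows "continuous_on UNIV (\<lambda>x. F (cvec x))"
proof (rule continuous_on_compose2[of "range cvec" F])
  have "isCont F z" if "z \<in> range cvec" for z
  proof -
    have "z \<in> strip R" using that \<open>R > 0\<close> by (auto simp: strip_def)
    thus ?thesis using F has_derivative_continuous unfolding holomorphic_several_def by blast
  qed
  thus "continuous_on (range cvec) F" by (rule continuous_at_imp_continuous_on[OF ballI])
  show "continuous_on UNIV cvec" unfolding cvec_def by (intro continuous_intros)
qed auto

text \<open>\<open>\<phi>\<^sub>k\<close> arises by dividing the \<open>n\<close>-th Fourier coefficient by \<open>(torus_char n \<alpha> - 1)\<^sup>k\<close>; the factors 4 and 2 are the
  powers of \<open>\<bar>torus_char n \<alpha> - 1\<bar> \<le> 2\<close> that are missing from the cube.\<close>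

lemma cohomological_solution:
  fixes F G :: "complex^'d \<Rightarrow> complex" and f g :: "real^'d \<Rightarrow> real"
  assumes \<alpha>: "rationally_independent_with_one \<alpha>" and R: "R > 0"
    and F: "analytic_extension R f F" and G: "analytic_extension R g G"
    and FN: "\<And>z. z \<in> strip R \<Longrightarrow> cmod (F z) \<le> N" and GN: "\<And>z. z \<in> strip R \<Longrightarrow> cmod (G z) \<le> N"
    and per: "periodic (\<lambda>x. f x * g x)"
    and s: "small_divisor_term (2 * pi * R) \<alpha> summable_on UNIV - {0}"
  defines "S \<equiv> (\<Sum>\<^sub>\<infinity>n\<in>UNIV - {0}. small_divisor_term (2 * pi * R) \<alpha> n)"
  shows "\<exists>m \<phi>1 \<phi>2 \<phi>3. \<bar>m\<bar> \<le> N\<^sup>2 \<and>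
     (\<forall>n::int. \<phi>1 (n + 1) = \<phi>1 n + f (\<theta> + real_of_int n *\<^sub>R \<alpha>) * g (\<theta> + real_of_int n *\<^sub>R \<alpha>) - m \<and>
          \<phi>2 (n + 1) = \<phi>2 n + \<phi>1 n \<and> \<phi>3 (n + 1) = \<phi>3 n + \<phi>2 n \<and>
          \<bar>\<phi>1 n\<bar> \<le> 4 * (N\<^sup>2 * S) \<and> \<bar>\<phi>2 n\<bar> \<le> 2 * (N\<^sup>2 * S) \<and> \<bar>\<phi>3 n\<bar> \<le> N\<^sup>2 * S)"
proof -
  have FG: "F (cvec x) = of_real (f x)" "G (cvec x) = of_real (g x)" for x
    using F G unfolding analytic_extension_def cvec_def by auto
  have hF: "holomorphic_several F (strip R)" and hG: "holomorphic_several G (strip R)"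
    using F G unfolding analytic_extension_def by auto
  define h where "h x = F (cvec x) * G (cvec x)" for x
  have h_cont: "continuous_on UNIV h"
    unfolding h_def by (intro continuous_on_mult continuous_on_cvec_holomorphic[OF _ R] hF hG)
  have h_per: "periodic h"
    using per by (simp add: h_def FG periodic_def flip: of_real_mult)
  have "\<exists>c. has_mean \<alpha> (\<lambda>x. h x * torus_char (- n) x) c" for n
    using periodic_torus_char[of "- n"] h_per
    by (intro has_mean_continuous \<alpha> continuous_intros h_cont) (simp add: periodic_def)
  then obtain c where c: "\<And>n. has_mean \<alpha> (\<lambda>x. h x * torus_char (- n) x) (c n)" by metis
  have N0: "N \<ge> 0"
  proof -
    have "0 \<in> strip R" using R by (simp add: strip_def)
    from order_trans[OF norm_ge_zero FN[OF this]] show ?thesis .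
  qed
  have decay: "cmod (c n) \<le> N\<^sup>2 * exp (- 2 * pi * R * of_int (l1_norm n))" for n
  proof (rule fourier_coefficient_decay[OF R, of "\<lambda>z. F z * G z"])
    show "cmod (F z * G z) \<le> N\<^sup>2" if "z \<in> strip R" for z
      unfolding norm_mult power2_eq_square using FN[OF that] GN[OF that] N0 by (intro mult_mono) auto
    show "(\<lambda>w. F (cvec a + w *s cvec v) * G (cvec a + w *s cvec v)) holomorphic_on {w. \<bar>Im w\<bar> < R}"
      if "\<And>j. \<bar>v $ j\<bar> \<le> 1" for a v
      by (intro holomorphic_intros holomorphic_on_line hF hG that)
    show "has_mean \<alpha> (\<lambda>x. F (cvec x) * G (cvec x) * torus_char (- n) x) (c n)"
      using c[of n] by (simp add: h_def)
  qed
  have c_summable: "(\<lambda>n. cmod (c n)) summable_on UNIV"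
  proof (rule summable_on_comparison_test)
    show "(\<lambda>n::int^'d. N\<^sup>2 * exp (- (2 * pi * R) * of_int (l1_norm n))) summable_on UNIV"
      using R by (intro summable_on_cmult_right summable_exp_l1_norm) simp
  qed (use decay in auto)
  define l where "l n = torus_char n \<alpha> - 1" for n
  have l: "l n \<noteq> 0" "cmod (l n) \<le> 2" if "n \<noteq> 0" for n
    using torus_char_neq_1[OF \<alpha> that] norm_triangle_ineq4[of "torus_char n \<alpha>" 1] by (simp_all add: l_def)
  define X where "X n = \<theta> + real_of_int n *\<^sub>R \<alpha>" for n
  have X: "torus_char m (X (n + 1)) = torus_char m (X n) * (1 + l m)" for m n
  proof -
    have "X (n + 1) = X n + \<alpha>" by (simp add: X_def algebra_simps)
    thus ?thesis by (simp add: torus_char_shift l_def)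
  qed
  define A where "A = UNIV - {0 :: int^'d}"
  define \<psi> where "\<psi> k n = (\<Sum>\<^sub>\<infinity>m\<in>A. c m / l m ^ k * torus_char m (X n))" for k :: nat and n
  have term_le: "cmod (c m / l m ^ k) \<le> 2 ^ (3 - k) * (N\<^sup>2 * small_divisor_term (2 * pi * R) \<alpha> m)"
    if m: "m \<in> A" and k: "k \<le> 3" for m k
  proof -
    have l0: "cmod (l m) > 0" using l(1)[of m] m by (simp add: A_def)
    have "cmod (c m / l m ^ k) = cmod (c m) * cmod (l m) ^ (3 - k) / cmod (l m) ^ 3"
    proof -
      have "cmod (l m) ^ 3 = cmod (l m) ^ (3 - k) * cmod (l m) ^ k" using k by (simp flip: power_add)
      thus ?thesis using l0 by (simp add: norm_divide norm_power)
    qed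
    also have "\<dots> \<le> (N\<^sup>2 * exp (- 2 * pi * R * of_int (l1_norm m))) * 2 ^ (3 - k) / cmod (l m) ^ 3"
      using l(2)[of m] m by (intro divide_right_mono mult_mono decay power_mono) (auto simp: A_def)
    finally show ?thesis by (simp add: small_divisor_term_def l_def mult_ac)
  qed
  have sA: "small_divisor_term (2 * pi * R) \<alpha> summable_on A" using s by (simp add: A_def)
  have norm_summable: "(\<lambda>m. cmod (c m / l m ^ k * torus_char m (X n))) summable_on A" if "k \<le> 3" for k n
    unfolding norm_mult norm_torus_char mult_1_right
    by (rule summable_on_comparison_test[OF summable_on_cmult_right[OF summable_on_cmult_right[OF sA], of "2 ^ (3 - k)" "N\<^sup>2"]])
       (use term_le[OF _ that] in auto)
  have \<psi>_summable: "(\<lambda>m. c m / l m ^ k * torus_char m (X n)) summable_on A" if "k \<le> 3" for k n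
    by (rule abs_summable_summable) (rule norm_summable[OF that])
  have \<psi>_le: "cmod (\<psi> k n) \<le> 2 ^ (3 - k) * (N\<^sup>2 * S)" if k: "k \<le> 3" for k n
  proof -
    have "cmod (\<psi> k n) \<le> (\<Sum>\<^sub>\<infinity>m\<in>A. cmod (c m / l m ^ k * torus_char m (X n)))"
      unfolding \<psi>_def by (rule norm_infsum_bound[OF norm_summable[OF k]])
    also have "\<dots> \<le> (\<Sum>\<^sub>\<infinity>m\<in>A. 2 ^ (3 - k) * (N\<^sup>2 * small_divisor_term (2 * pi * R) \<alpha> m))"
    proof (intro infsum_mono norm_summable[OF k] summable_on_cmult_right sA)
      show "cmod (c m / l m ^ k * torus_char m (X n)) \<le> 2 ^ (3 - k) * (N\<^sup>2 * small_divisor_term (2 * pi * R) \<alpha> m)"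
        if "m \<in> A" for m
        unfolding norm_mult norm_torus_char mult_1_right by (rule term_le[OF that k])
    qed
    also have "\<dots> = 2 ^ (3 - k) * (\<Sum>\<^sub>\<infinity>m\<in>A. N\<^sup>2 * small_divisor_term (2 * pi * R) \<alpha> m)"
      by (rule infsum_cmult_right) (intro summable_on_cmult_right sA)
    also have "(\<Sum>\<^sub>\<infinity>m\<in>A. N\<^sup>2 * small_divisor_term (2 * pi * R) \<alpha> m) = N\<^sup>2 * S"
      unfolding S_def A_def[symmetric] by (rule infsum_cmult_right) (rule sA)
    finally show ?thesis .
  qed
  \<comment> \<open>One step along the orbit multiplies the \<open>m\<close>-th character by
    \<open>1 + l m\<close>, so taking the difference cancels one division.\<close>
  have \<psi>_step: "\<psi> (Suc k) (n + 1) = \<psi> (Suc k) n + \<psi> k n" if k: "Suc k \<le> 3" for k n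
  proof -
    have "\<psi> (Suc k) (n + 1) = (\<Sum>\<^sub>\<infinity>m\<in>A. c m / l m ^ Suc k * torus_char m (X n) + c m / l m ^ k * torus_char m (X n))"
      unfolding \<psi>_def X using l(1) by (intro infsum_cong) (auto simp: A_def field_simps)
    also have "\<dots> = \<psi> (Suc k) n + \<psi> k n"
      unfolding \<psi>_def by (rule infsum_add; rule \<psi>_summable) (use k in simp_all)
    finally show ?thesis .
  qed
  have \<psi>0: "\<psi> 0 n = h (X n) - c 0" for n
  proof -
    have "h (X n) = (\<Sum>\<^sub>\<infinity>m. c m * torus_char m (X n))"
      by (rule fourier_series[OF \<alpha> h_cont h_per c c_summable])
    also have "\<dots> = (\<Sum>\<^sub>\<infinity>m\<in>A \<union> {0}. c m * torus_char m (X n))" by (simp add: A_def)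
    also have "\<dots> = (\<Sum>\<^sub>\<infinity>m\<in>A. c m * torus_char m (X n)) + (\<Sum>\<^sub>\<infinity>m\<in>{0}. c m * torus_char m (X n))"
      by (rule infsum_Un_disjoint) (use \<psi>_summable[of 0 n] in \<open>auto simp: A_def\<close>)
    finally show ?thesis by (simp add: \<psi>_def)
  qed
  have hX: "Re (h (X n)) = f (X n) * g (X n)" for n by (simp add: h_def FG)
  have Re_le: "\<bar>Re (\<psi> k n)\<bar> \<le> 2 ^ (3 - k) * (N\<^sup>2 * S)" if "k \<le> 3" for k n
    using abs_Re_le_cmod[of "\<psi> k n"] \<psi>_le[OF that, of n] by linarith
  show ?thesis
  \<comment> \<open>The data are real, so the real parts satisfy the same equations with the same
    bounds.\<close>
  proof (rule exI[of _ "Re (c 0)"], rule exI[of _ "\<lambda>n. Re (\<psi> 1 n)"], rule exI[of _ "\<lambda>n. Re (\<psi> 2 n)"],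
      rule exI[of _ "\<lambda>n. Re (\<psi> 3 n)"], intro conjI allI)
    show "\<bar>Re (c 0)\<bar> \<le> N\<^sup>2"
      using abs_Re_le_cmod[of "c 0"] decay[of 0] by (simp add: l1_norm_def)
    fix n
    show "Re (\<psi> 1 (n + 1)) = Re (\<psi> 1 n) + f (\<theta> + real_of_int n *\<^sub>R \<alpha>) * g (\<theta> + real_of_int n *\<^sub>R \<alpha>) - Re (c 0)"
      using \<psi>_step[of 0 n] \<psi>0[of n] hX[of n] by (simp add: X_def)
    show "Re (\<psi> 2 (n + 1)) = Re (\<psi> 2 n) + Re (\<psi> 1 n)"
      using \<psi>_step[of 1 n] by (simp add: numeral_2_eq_2)
    show "Re (\<psi> 3 (n + 1)) = Re (\<psi> 3 n) + Re (\<psi> 2 n)"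
      using \<psi>_step[of 2 n] by (simp add: numeral_3_eq_3 numeral_2_eq_2)
    show "\<bar>Re (\<psi> 1 n)\<bar> \<le> 4 * (N\<^sup>2 * S)" "\<bar>Re (\<psi> 2 n)\<bar> \<le> 2 * (N\<^sup>2 * S)" "\<bar>Re (\<psi> 3 n)\<bar> \<le> N\<^sup>2 * S"
      using Re_le[of 1 n] Re_le[of 2 n] Re_le[of 3 n] by simp_all
  qed
qed

section \<open>Length of the gap\<close>

lemma matrix_vector_mult_axis: "((A::complex^'n^'m) *v axis j 1) $ i = A $ i $ j"
  by (simp add: matrix_vector_mult_def axis_def if_distrib[of "(*) _"] cong: if_cong)

lemma norm_matrix_entry_le:
  fixes A :: "complex^2^2"
  shows "cmod (A $ i $ j) \<le> onorm ((*v) A)" "norm (A *v axis j 1) \<le> onorm ((*v) A)"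
proof -
  have "norm (A *v axis j 1) \<le> onorm ((*v) A) * norm (axis j (1::complex))"
    by (rule onorm) simp
  thus 1: "norm (A *v axis j 1) \<le> onorm ((*v) A)" by simp
  have "A $ i $ j = (A *v axis j 1) $ i"
    by (simp add: matrix_vector_mult_axis)
  hence "cmod (A $ i $ j) \<le> norm (A *v axis j 1)" by (simp add: Finite_Cartesian_Product.norm_nth_le)
  thus "cmod (A $ i $ j) \<le> onorm ((*v) A)" using 1 by simp
qed

text \<open>The constant does not matter: the bound ensures that the supremum in
  \<open>strip_norm\<close> is taken over a bounded set.\<close>

lemma onorm_matrix_le:
  fixes A :: "complex^2^2"
  assumes "\<And>i j. cmod (A $ i $ j) \<le> B"
  shows "onorm ((*v) A) \<le> 4 * B"
proof (rule onorm_bound)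
  show "0 \<le> 4 * B" using assms[of 1 1] norm_ge_zero[of "A $ 1 $ 1"] by linarith
  fix x :: "complex^2"
  have "norm (A *v x) \<le> (\<Sum>i\<in>UNIV. cmod ((A *v x) $ i))"
    unfolding norm_vec_def by (rule L2_set_le_sum) simp
  also have "\<dots> \<le> (\<Sum>i\<in>(UNIV::2 set). 2 * B * norm x)"
  proof (rule sum_mono)
    fix i :: 2
    have "cmod ((A *v x) $ i) \<le> (\<Sum>j\<in>UNIV. cmod (A $ i $ j * x $ j))"
      unfolding matrix_vector_mult_def by (simp add: norm_sum)
    also have "\<dots> \<le> (\<Sum>j\<in>(UNIV::2 set). B * norm x)"
      unfolding norm_mult
      by (intro sum_mono mult_mono assms Finite_Cartesian_Product.norm_nth_le order_trans[OF norm_ge_zero assms]) auto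
    finally show "cmod ((A *v x) $ i) \<le> 2 * B * norm x" by simp
  qed
  finally show "norm (A *v x) \<le> 4 * B * norm x" by simp
qed

text \<open>For the lower bound 1, note that the columns of \<open>X 0\<close> are images of unit
  vectors; the sum of their squared lengths is at least twice the determinant.\<close>

lemma strip_norm_bounds:
  fixes X :: "real^'d \<Rightarrow> real^2^2"
  assumes X: "X \<in> C_omega_PSL R" and R: "R > 0"
  obtains F where "matrix_analytic_extension R X F"
    and "\<And>z i j. z \<in> strip R \<Longrightarrow> cmod (F z $ i $ j) \<le> strip_norm R X"
    and "1 \<le> strip_norm R X"
proof -
  define F where "F = (SOME F. matrix_analytic_extension R X F)"
  have F: "matrix_analytic_extension R X F"
    unfolding F_def using X by (intro someI_ex[of "matrix_analytic_extension R X"]) (simp add: C_omega_PSL_def)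
  have N: "strip_norm R X = (SUP z\<in>strip R. onorm ((*v) (F z)))"
    by (simp add: strip_norm_def F_def Let_def)
  have "\<exists>B. \<forall>z\<in>strip R. cmod (F z $ i $ j) \<le> B" for i j
    using F unfolding matrix_analytic_extension_def analytic_extension_def bounded_iff by auto
  then obtain B where B: "\<And>i j z. z \<in> strip R \<Longrightarrow> cmod (F z $ i $ j) \<le> B i j" by metis
  have "onorm ((*v) (F z)) \<le> 4 * (\<Sum>i\<in>UNIV. \<Sum>j\<in>UNIV. \<bar>B i j\<bar>)" if z: "z \<in> strip R" for z
  proof (rule onorm_matrix_le)
    fix i j
    have "cmod (F z $ i $ j) \<le> \<bar>B i j\<bar>" using B[OF z, of i j] by simp
    also have "\<dots> \<le> (\<Sum>j\<in>UNIV. \<bar>B i j\<bar>)" by (rule member_le_sum) auto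
    also have "\<dots> \<le> (\<Sum>i\<in>UNIV. \<Sum>j\<in>UNIV. \<bar>B i j\<bar>)"
      by (rule member_le_sum[of i UNIV "\<lambda>i. \<Sum>j\<in>UNIV. \<bar>B i j\<bar>"]) (auto intro: sum_nonneg)
    finally show "cmod (F z $ i $ j) \<le> (\<Sum>i\<in>UNIV. \<Sum>j\<in>UNIV. \<bar>B i j\<bar>)" .
  qed
  hence "bdd_above ((\<lambda>z. onorm ((*v) (F z))) ` strip R)" by (auto intro!: bdd_aboveI2)
  hence le: "onorm ((*v) (F z)) \<le> strip_norm R X" if "z \<in> strip R" for z
    unfolding N using that by (intro cSUP_upper)
  have "0 \<in> strip R" using R by (simp add: strip_def)
  have F0: "F 0 $ i $ j = of_real (X 0 $ i $ j)" for i j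
  proof -
    have "F (\<chi> j. of_real ((0::real^'d) $ j)) $ i $ j = of_real (X 0 $ i $ j)"
      using F unfolding matrix_analytic_extension_def analytic_extension_def by blast
    moreover have "(\<chi> j. of_real ((0::real^'d) $ j)) = (0 :: complex^'d)" by (simp add: vec_eq_iff)
    ultimately show ?thesis by simp
  qed
  have col: "(X 0 $ 1 $ j)\<^sup>2 + (X 0 $ 2 $ j)\<^sup>2 \<le> (strip_norm R X)\<^sup>2" for j
  proof -
    have "norm (F 0 *v axis j 1) \<le> strip_norm R X"
      using norm_matrix_entry_le(2)[of "F 0" j] le[OF \<open>0 \<in> strip R\<close>] by simp
    hence "(norm (F 0 *v axis j 1))\<^sup>2 \<le> (strip_norm R X)\<^sup>2" by (intro power_mono) auto
    moreover have "(norm (F 0 *v axis j 1))\<^sup>2 = (X 0 $ 1 $ j)\<^sup>2 + (X 0 $ 2 $ j)\<^sup>2"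
      by (simp add: norm_vec_def L2_set_def sum_2 matrix_vector_mult_axis F0)
    ultimately show ?thesis by simp
  qed
  have N0: "0 \<le> strip_norm R X"
    by (rule order_trans[OF norm_ge_zero order_trans[OF norm_matrix_entry_le(1)[of "F 0" 1 1] le[OF \<open>0 \<in> strip R\<close>]]])
  have "det (X 0) = 1" using X by (simp add: C_omega_PSL_def)
  hence d: "X 0 $ 1 $ 1 * X 0 $ 2 $ 2 - X 0 $ 1 $ 2 * X 0 $ 2 $ 1 = 1" by (simp add: det_2)
  have "1 \<le> (strip_norm R X)\<^sup>2"
  proof -
    have "2 * (x * w - y * z) \<le> (x\<^sup>2 + z\<^sup>2) + (y\<^sup>2 + w\<^sup>2)" for x y z w :: real
      using sum_squares_bound[of x w] sum_squares_bound[of "- y" z] by simp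
    from this[of "X 0 $ 1 $ 1" "X 0 $ 2 $ 2" "X 0 $ 1 $ 2" "X 0 $ 2 $ 1"] show ?thesis
      unfolding d using col[of 1] col[of 2] by linarith
  qed
  hence "1 \<le> strip_norm R X" using N0 power2_le_imp_le[of 1 "strip_norm R X"] by simp
  moreover have "cmod (F z $ i $ j) \<le> strip_norm R X" if "z \<in> strip R" for z i j
    using norm_matrix_entry_le(1)[of "F z" i j] le[OF that] by simp
  ultimately show thesis using that F by blast
qed

text \<open>Equality of classes is equality up to a sign. The sign may depend on the point of the
  orbit, so it is kept as \<open>s\<close> here and removed by \<open>sign_cocycle\<close>.\<close>

lemma PSL_conjugacy_entries:
  fixes A A' :: "real^2^2"
  assumes det: "det A' = 1"
    and eq: "PSL_class (matrix_inv A' ** vector [vector [e, - 1], vector [1, 0]] ** A)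
             = PSL_class (vector [vector [1, \<zeta>], vector [0, 1]])"
  shows "\<exists>s::real. s * s = 1 \<and> e * A $ 1 $ 1 - A $ 2 $ 1 = s * A' $ 1 $ 1 \<and>
     e * A $ 1 $ 2 - A $ 2 $ 2 = s * (\<zeta> * A' $ 1 $ 1 + A' $ 1 $ 2) \<and>
     A $ 1 $ 1 = s * A' $ 2 $ 1 \<and> A $ 1 $ 2 = s * (\<zeta> * A' $ 2 $ 1 + A' $ 2 $ 2)"
proof -
  define C :: "real^2^2" where "C = vector [vector [e, - 1], vector [1, 0]]"
  define B :: "real^2^2" where "B = vector [vector [1, \<zeta>], vector [0, 1]]"
  have inv: "A' ** matrix_inv A' = mat 1"
  proof -
    have "invertible A'" using det by (simp add: invertible_det_nz)
    thus ?thesis unfolding invertible_def matrix_inv_def by (rule someI_ex[THEN conjunct1])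
  qed
  have "matrix_inv A' ** C ** A \<in> PSL_class B"
    using eq by (auto simp: PSL_class_def C_def B_def)
  then obtain s :: real where s: "s * s = 1" "matrix_inv A' ** C ** A = s *\<^sub>R B"
  proof -
    have "matrix_inv A' ** C ** A = 1 *\<^sub>R B \<or> matrix_inv A' ** C ** A = (- 1) *\<^sub>R B"
      using \<open>matrix_inv A' ** C ** A \<in> PSL_class B\<close> by (simp add: PSL_class_def)
    thus thesis using that[of 1] that[of "- 1"] by auto
  qed
  have "C ** A = A' ** matrix_inv A' ** C ** A" by (simp add: inv)
  also have "\<dots> = A' ** (s *\<^sub>R B)" by (simp only: s(2)[symmetric] matrix_mul_assoc)
  finally have CA: "C ** A = A' ** (s *\<^sub>R B)" .
  have "(C ** A) $ i $ j = (A' ** (s *\<^sub>R B)) $ i $ j" for i j by (simp add: CA)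
  from this[of 1 1] this[of 1 2] this[of 2 1] this[of 2 2] show ?thesis
    using s(1) by (intro exI[of _ s]) (simp add: matrix_matrix_mult_def sum_2 C_def B_def algebra_simps)
qed

text \<open>The signs are accumulated from 0 in both directions; a sign is its own inverse, so the
  backward product needs no division.\<close>

lemma sign_cocycle:
  fixes s :: "int \<Rightarrow> real"
  assumes "\<And>n. s n * s n = 1"
  obtains \<sigma> where "\<And>n. \<sigma> n * \<sigma> n = 1" "\<And>n. \<sigma> (n + 1) = s n * \<sigma> n"
proof
  define \<sigma> where "\<sigma> n = (\<Prod>k\<in>{0..<n}. s k) * (\<Prod>k\<in>{n..<0}. s k)" for n
  have one: "(\<Prod>k\<in>K. s k) * (\<Prod>k\<in>K. s k) = 1" for K
    by (simp add: assms flip: prod.distrib)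
  show "\<sigma> n * \<sigma> n = 1" for n
    using one[of "{0..<n}"] one[of "{n..<0}"] by (cases "n \<ge> 0") (simp_all add: \<sigma>_def)
  show "\<sigma> (n + 1) = s n * \<sigma> n" for n
  proof (cases "n \<ge> 0")
    case True
    hence "{0..<n + 1} = insert n {0..<n}" by auto
    thus ?thesis using True by (simp add: \<sigma>_def)
  next
    case False
    hence "{n..<0} = insert n {n + 1..<0}" by auto
    hence "(\<Prod>k\<in>{n..<0}. s k) = s n * (\<Prod>k\<in>{n + 1..<0}. s k)" by simp
    hence "s n * (\<Prod>k\<in>{n..<0}. s k) = (s n * s n) * (\<Prod>k\<in>{n + 1..<0}. s k)" by simp
    thus ?thesis using False assms[of n] by (simp add: \<sigma>_def)
  qed
qed

section \<open>The gap as an interval\<close>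

lemma open_connected_bounded_real:
  fixes G :: "real set"
  assumes "open G" "connected G" "bounded G" "G \<noteq> {}"
  obtains l r where "l < r" "G = {l<..<r}"
proof
  have bdd: "bdd_below G" "bdd_above G"
    using assms(3) by (simp_all add: bounded_imp_bdd_below bounded_imp_bdd_above)
  have lo: "Inf G < x" if x: "x \<in> G" for x
  proof -
    obtain e where "e > 0" "ball x e \<subseteq> G" using assms(1) x open_contains_ball by blast
    hence "x - e / 2 \<in> G" by (auto simp: dist_real_def subset_iff)
    from cInf_lower[OF this bdd(1)] show ?thesis using \<open>e > 0\<close> by simp
  qed
  have hi: "x < Sup G" if x: "x \<in> G" for x
  proof -
    obtain e where "e > 0" "ball x e \<subseteq> G" using assms(1) x open_contains_ball by blast
    hence "x + e / 2 \<in> G" by (auto simp: dist_real_def subset_iff)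
    from cSup_upper[OF this bdd(2)] show ?thesis using \<open>e > 0\<close> by simp
  qed
  show "Inf G < Sup G" using assms(4) lo hi by (meson ex_in_conv less_trans)
  have "x \<in> G" if x: "Inf G < x" "x < Sup G" for x
  proof -
    obtain y where "y \<in> G" "y \<le> x" using cInf_lessD[OF assms(4) x(1)] by (auto intro: less_imp_le)
    moreover obtain z where "z \<in> G" "x \<le> z" using less_cSupD[OF assms(4) x(2)] by (auto intro: less_imp_le)
    ultimately show ?thesis
      using assms(2)[unfolded connected_iff_interval] by blast
  qed
  thus "G = {Inf G<..<Sup G}" using lo hi by auto
qed

lemma spectral_gap_interval:
  assumes W: "\<And>n. \<bar>W n\<bar> \<le> B"
    and G: "G \<in> components {e. bounded_below_at W e}" "bounded G"
  obtains l r where "l < r" "G = {l<..<r}" "\<And>e. l < e \<Longrightarrow> e < r \<Longrightarrow> bounded_below_at W e"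
proof -
  interpret bounded_potential W B by standard (rule W)
  have "open G" by (rule open_components[OF bounded_below_at_open G(1)])
  moreover have "connected G" "G \<noteq> {}" "G \<subseteq> {e. bounded_below_at W e}"
    using in_components_connected[OF G(1)] in_components_nonempty[OF G(1)] in_components_subset[OF G(1)] by auto
  ultimately obtain l r where "l < r" "G = {l<..<r}"
    using open_connected_bounded_real[OF _ _ G(2)] by blast
  thus thesis using that \<open>G \<subseteq> _\<close> by (auto simp: subset_iff)
qed

lemma (in averaged_cocycle) gap_length:
  assumes G: "G \<in> components {e. bounded_below_at W e}" "bounded G" "E \<in> frontier G"
    and \<kappa>: "0 < \<kappa>" "\<kappa> < 1 / 4"
    and small: "60000 * K\<^sup>2 * Y * \<zeta> powr \<kappa> \<le> 3 / 10"
  shows "\<zeta> powr (1 + \<kappa>) \<le> measure lborel G \<and> measure lborel G \<le> \<zeta> powr (1 - \<kappa>)"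
proof -
  obtain l r' where lr: "l < r'" "G = {l<..<r'}" and below: "\<And>e. l < e \<Longrightarrow> e < r' \<Longrightarrow> bounded_below_at W e"
    using spectral_gap_interval[OF W_le G(1,2)] by blast
  define z where "z = \<zeta> powr \<kappa>"
  have z: "z > 0" using \<zeta> by (simp add: z_def)
  have KY: "2 / 3 \<le> Y" "K \<le> 3 / 2 * Y" using Y_ge K1 by auto
  have Kz: "K * z \<le> 1 / 100000" "K * K * z \<le> 1 / 100000" "K\<^sup>2 * Y * z \<le> 1 / 200000"
  proof -
    show 1: "K\<^sup>2 * Y * z \<le> 1 / 200000" using small by (simp add: z_def algebra_simps)
    have "K * K * z * (2 / 3) \<le> K * K * z * Y"
      using KY K1 z by (intro mult_left_mono) auto
    also have "\<dots> = K\<^sup>2 * Y * z" by (simp add: power2_eq_square)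
    finally show 2: "K * K * z \<le> 1 / 100000" using 1 by simp
    have "1 * (K * z) \<le> K * (K * z)" using K1 z by (intro mult_right_mono) auto
    thus "K * z \<le> 1 / 100000" using 2 by simp
  qed
  have z1: "z \<le> 1 / 100000" using mult_right_mono[OF K1 less_imp_le[OF z]] Kz(1) by simp
  have up: "\<zeta> powr (1 + \<kappa>) = \<zeta> * z" using \<zeta> by (simp add: z_def powr_add)
  have dn: "\<zeta> powr (1 - \<kappa>) = \<zeta> / z" using \<zeta> by (simp add: z_def powr_diff)
  \<comment> \<open>This rests on \<open>2 * \<kappa> \<le> 1\<close>. It makes
    \<open>\<zeta> / z\<close> at most \<open>z\<close>, so that energies at distance
    \<open>\<zeta> powr (1 - \<kappa>)\<close> are still in the perturbative range.\<close>
  have \<zeta>z: "\<zeta> \<le> z * z"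
  proof -
    have "\<zeta> powr 1 \<le> \<zeta> powr (\<kappa> + \<kappa>)" using \<zeta> \<kappa> by (intro powr_mono') auto
    thus ?thesis using \<zeta>(1) unfolding z_def powr_add by simp
  qed
  have "z * z \<le> z * 1" using z z1 by (intro mult_left_mono) auto
  hence \<zeta>z': "\<zeta> \<le> z" using \<zeta>z by simp
  have pK: "\<bar>p\<bar> \<le> K" by (rule means')
  have \<zeta>p: "\<bar>\<zeta> * p\<bar> \<le> 1 / 100000"
  proof -
    have "\<bar>\<zeta> * p\<bar> \<le> z * K" unfolding abs_mult
      using \<zeta>z' z \<zeta> pK by (intro mult_mono) auto
    thus ?thesis using Kz(1) by (simp add: mult.commute)
  qed
  define D where "D = p * r - q\<^sup>2"
  have D: "1 / 8 \<le> D" using gram by (simp add: D_def)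
  have p0: "p > 0"
  proof -
    have "0 < 1 / (5 * N\<^sup>2)" using N1 by simp
    thus ?thesis using p_ge by linarith
  qed
  have KKY: "0 < K\<^sup>2 * Y" "0 \<le> Y" "0 \<le> K" using K1 Y0 by simp_all
  \<comment> \<open>Four times the determinant exceeds 4 by at least \<open>e\<^sup>2 / 2\<close>,
    whereas the linear and the quadratic part of the squared trace take at most
    \<open>e\<^sup>2 / 8\<close> each.\<close>
  have elliptic: "(2 - e * \<zeta> * p)\<^sup>2 < 4 * (1 + e\<^sup>2 * D)"
    if e: "e \<noteq> 0" "- (4 * (e * (\<zeta> * p))) \<le> e\<^sup>2 / 8" for e
  proof -
    have "(\<zeta> * p)\<^sup>2 \<le> (1 / 100000)\<^sup>2"
      using \<zeta>p by (simp add: abs_le_square_iff[symmetric])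
    hence "(\<zeta> * p)\<^sup>2 \<le> 1 / 8" by (simp add: power_divide)
    hence "e\<^sup>2 * (\<zeta> * p)\<^sup>2 \<le> e\<^sup>2 * (1 / 8)" by (intro mult_left_mono) auto
    moreover have "e\<^sup>2 * (1 / 8) \<le> e\<^sup>2 * D" by (intro mult_left_mono D) auto
    moreover have "0 < e\<^sup>2" using e(1) by simp
    moreover have "(2 - e * \<zeta> * p)\<^sup>2 = 4 - 4 * (e * (\<zeta> * p)) + e\<^sup>2 * (\<zeta> * p)\<^sup>2"
      by (simp add: power2_eq_square algebra_simps)
    moreover have "4 * (1 + e\<^sup>2 * D) = 4 + 4 * (e\<^sup>2 * D)" by simp
    ultimately show ?thesis using e(2) by linarith
  qed
  have "frontier G = {l, r'}" using lr by (simp add: frontier_def)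
  hence "E = l \<or> E = r'" using G(3) by blast
  moreover have "E \<noteq> l"
  proof
    assume El: "E = l"
    \<comment> \<open>The ball of radius \<open>e\<close> about \<open>E + e\<close> has to lie in
      the gap, and \<open>e\<close> must be small enough for
      \<open>spectrum_near_elliptic\<close>.\<close>
    define e where "e = min ((r' - l) / 2) (1 / (600 * K\<^sup>2 * Y))"
    have "0 < 1 / (600 * K\<^sup>2 * Y)" using K1 Y0 by simp
    moreover have "e \<le> (r' - l) / 2" unfolding e_def by (rule min.cobounded1)
    ultimately have e: "e > 0" "2 * e \<le> r' - l" "e \<le> 1 / (600 * K\<^sup>2 * Y)"
      using lr(1) by (simp_all add: e_def)
    have "300 * K\<^sup>2 * Y * \<bar>e\<bar> \<le> 300 * K\<^sup>2 * Y * (1 / (600 * K\<^sup>2 * Y))"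
      using e KKY by (intro mult_left_mono) auto
    also have "\<dots> < 1" using K1 Y0 by simp
    finally have small: "300 * K\<^sup>2 * Y * \<bar>e\<bar> < 1" .
    have "0 \<le> e * (\<zeta> * p)" using e(1) \<zeta> p0 by simp
    hence "- (4 * (e * (\<zeta> * p))) \<le> e\<^sup>2 / 8" using zero_le_power2[of e] by linarith
    from spectrum_near_elliptic[OF elliptic[OF _ this, unfolded D_def] _ small]
    obtain t where t: "\<bar>t\<bar> < e" "\<not> bounded_below_at W (E + e + t)" using e(1) by auto
    moreover have "bounded_below_at W (E + e + t)" using t(1) e El by (intro below) auto
    ultimately show False by blast
  qed
  ultimately have Er: "E = r'" by blast
  have "\<zeta> * z \<le> r' - l"
  proof -
    define I where "I = {E - \<zeta> * z<..<E}"
    have \<zeta>z0: "\<zeta> * z > 0" using \<zeta> z by simp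
    have "I \<subseteq> {e. bounded_below_at W e}"
    proof
      fix e assume "e \<in> I"
      define \<delta> where "\<delta> = E - e"
      have \<delta>: "0 < \<delta>" "\<delta> \<le> \<zeta> * z" using \<open>e \<in> I\<close> by (auto simp: I_def \<delta>_def)
      have "bounded_below_at W (E - \<delta>)"
      proof (rule hyperbolic_bounded_below[OF \<delta>(1)])
        have "60000 * K\<^sup>2 * Y * \<delta> \<le> 60000 * K\<^sup>2 * Y * (\<zeta> * z)"
          using \<delta>(2) KKY by (intro mult_left_mono) auto
        also have "\<dots> = 60000 * (K\<^sup>2 * Y * z) * \<zeta>" by simp
        also have "\<dots> \<le> 60000 * (1 / 200000) * 1"
          using Kz(3) \<zeta> KKY z by (intro mult_mono) auto
        also have "\<dots> \<le> 1" by simp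
        finally show "60000 * K\<^sup>2 * Y * \<delta> \<le> 1" .
        have "15 * K * \<delta> \<le> 15 * K * (\<zeta> * z)" using \<delta>(2) K1 by (intro mult_left_mono) auto
        also have "\<dots> = 15 * (K * z) * \<zeta>" by simp
        also have "\<dots> \<le> 1 * \<zeta>" using Kz(1) \<zeta> by (intro mult_right_mono) auto
        finally show "15 * K * \<delta> \<le> \<zeta>" unfolding mult_1_left .
      qed
      thus "e \<in> {e. bounded_below_at W e}" by (simp add: \<delta>_def)
    qed
    moreover have "connected I" by (simp add: I_def)
    moreover have "G \<inter> I \<noteq> {}"
    proof -
      have "(max l (E - \<zeta> * z) + E) / 2 \<in> G \<inter> I"
        using lr \<zeta>z0 Er by (auto simp: I_def max_def)
      thus ?thesis by blast
    qed
    ultimately have "I \<subseteq> G" using components_maximal[OF G(1)] by blast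
    hence "{E - \<zeta> * z<..<E} \<subseteq> {l<..<r'}" by (simp add: I_def lr)
    thus ?thesis using \<zeta>z0 Er greaterThanLessThan_subseteq_greaterThanLessThan[of "E - \<zeta> * z" E l r'] by auto
  qed
  moreover have "r' - l \<le> \<zeta> / z"
  proof (rule ccontr)
    assume long: "\<not> r' - l \<le> \<zeta> / z"
    \<comment> \<open>With half of the claimed bound as radius, the ball about \<open>E - h\<close>
      fits into any longer gap, while \<open>- h\<close> is already on the elliptic side of the
      threshold.\<close>
    define h where "h = \<zeta> / z / 2"
    have h: "h > 0" "\<zeta> = 2 * h * z" "h \<le> z / 2"
      using \<zeta> z \<zeta>z by (auto simp: h_def field_simps)
    have small: "300 * K\<^sup>2 * Y * \<bar>- h\<bar> < 1"
    proof -
      have "300 * K\<^sup>2 * Y * \<bar>- h\<bar> \<le> 300 * K\<^sup>2 * Y * (z / 2)"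
        using h KKY by (intro mult_left_mono) auto
      also have "\<dots> = 150 * (K\<^sup>2 * Y * z)" by simp
      also have "\<dots> < 1" using Kz(3) by linarith
      finally show ?thesis .
    qed
    have "- (4 * (- h * (\<zeta> * p))) \<le> (- h)\<^sup>2 / 8"
    proof -
      have "p * z \<le> K * z" using pK z by (intro mult_right_mono) auto
      hence "p * z \<le> 1 / 64" using Kz(1) by linarith
      hence "8 * h\<^sup>2 * (p * z) \<le> 8 * h\<^sup>2 * (1 / 64)" by (intro mult_left_mono) auto
      moreover have "- (4 * (- h * (\<zeta> * p))) = 8 * h\<^sup>2 * (p * z)"
        unfolding h(2) by (simp add: power2_eq_square)
      ultimately have "- (4 * (- h * (\<zeta> * p))) \<le> 8 * h\<^sup>2 * (1 / 64)" by (simp only:)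
      thus ?thesis by simp
    qed
    from spectrum_near_elliptic[OF elliptic[OF _ this, unfolded D_def] _ small]
    obtain t where t: "\<bar>t\<bar> < h" "\<not> bounded_below_at W (E + - h + t)" using h(1) by auto
    moreover have "bounded_below_at W (E + - h + t)"
      using t(1) long Er by (intro below) (auto simp: h_def abs_less_iff)
    ultimately show False by blast
  qed
  moreover have "measure lborel G = r' - l" using lr by simp
  ultimately show ?thesis unfolding up dn by simp
qed

section \<open>From the analytic conjugacy to the data along one orbit\<close>

lemma Sigma_spec_eq:
  assumes "\<And>x. \<bar>V x\<bar> \<le> B"
  shows "- Sigma_spec V \<alpha> \<theta> = {e. bounded_below_at (\<lambda>n. V (\<theta> + real_of_int n *\<^sub>R \<alpha>)) e}"
proof -
  interpret bounded_potential "\<lambda>n. V (\<theta> + real_of_int n *\<^sub>R \<alpha>)" B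
    by standard (rule assms)
  have "schroedinger V \<alpha> \<theta> = jacobi (\<lambda>n. V (\<theta> + real_of_int n *\<^sub>R \<alpha>))"
    by (simp add: schroedinger_def jacobi_def fun_eq_iff)
  thus ?thesis using spectrum_iff by (auto simp: Sigma_spec_def)
qed

lemma C_omega_real_bounded:
  assumes "V \<in> C_omega_real"
  obtains B where "\<And>x. \<bar>V x\<bar> \<le> B"
proof -
  obtain h F where h: "h > 0" "analytic_extension h V F"
    using assms by (auto simp: C_omega_real_def)
  then obtain B where B: "\<And>z. z \<in> strip h \<Longrightarrow> cmod (F z) \<le> B"
    unfolding analytic_extension_def bounded_iff by auto
  have "\<bar>V x\<bar> \<le> B" for x
  proof -
    have "(\<chi> j. of_real (x $ j)) \<in> strip h" using h(1) by (simp add: strip_def)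
    from B[OF this] show ?thesis using h(2) unfolding analytic_extension_def by simp
  qed
  thus thesis using that by blast
qed

text \<open>The sign ambiguity of the lift cancels in a product of two entries, and only such
  products are expanded into Fourier series.\<close>

lemma PSL_periodic_product:
  fixes X :: "real^'d \<Rightarrow> real^2^2"
  assumes "\<And>x n. PSL_class (X (x + int_vec n)) = PSL_class (X x)"
  shows "periodic (\<lambda>x. X x $ i $ j * X x $ k $ l)"
  unfolding periodic_def
proof (intro allI)
  fix x n
  have "X (x + int_vec n) \<in> PSL_class (X x)"
    unfolding assms[of x n, symmetric] by (simp add: PSL_class_def)
  hence "X (x + int_vec n) = X x \<or> X (x + int_vec n) = - X x" by (simp add: PSL_class_def)
  thus "X (x + int_vec n) $ i $ j * X (x + int_vec n) $ k $ l = X x $ i $ j * X x $ k $ l" by auto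
qed

lemma gap_estimate:
  fixes \<alpha> \<theta> :: "real^'d" and R \<kappa> E \<zeta> Dc :: real
    and V :: "real^'d \<Rightarrow> real" and X :: "real^'d \<Rightarrow> real^2^2" and G :: "real set"
  assumes \<alpha>: "rationally_independent_with_one \<alpha>"
    and R: "0 < R" and \<kappa>: "0 < \<kappa>" "\<kappa> < 1 / 4" and V: "V \<in> C_omega_real"
    and gap: "spectral_gap V \<alpha> \<theta> G" "E \<in> frontier G" and \<zeta>: "0 < \<zeta>" "\<zeta> < 1 / 2"
    and X: "X \<in> C_omega_PSL R"
    and conj: "\<And>x. PSL_class (matrix_inv (X (x + \<alpha>)) ** cocycle_matrix V E x ** X x)
               = PSL_class (vector [vector [1, \<zeta>], vector [0, 1]])"
    and s: "small_divisor_term (2 * pi * R) \<alpha> summable_on UNIV - {0}"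
    and Dc: "2 + 40 * (\<Sum>\<^sub>\<infinity>n\<in>UNIV - {0}. small_divisor_term (2 * pi * R) \<alpha> n) \<le> Dc"
    and small: "strip_norm R X ^ 14 * \<zeta> powr \<kappa> \<le> 10 powi (- 5) * Dc powi (- 4)"
  shows "\<zeta> powr (1 + \<kappa>) \<le> measure lborel G \<and> measure lborel G \<le> \<zeta> powr (1 - \<kappa>)"
proof -
  define S where "S = (\<Sum>\<^sub>\<infinity>n\<in>UNIV - {0}. small_divisor_term (2 * pi * R) \<alpha> n)"
  have S0: "S \<ge> 0" unfolding S_def by (intro infsum_nonneg small_divisor_term_nonneg)
  have Dc2: "Dc \<ge> 2" "S \<le> Dc / 40" using Dc S0 by (simp_all add: S_def)
  define N where "N = strip_norm R X"
  obtain F where F: "matrix_analytic_extension R X F"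
    and FN: "\<And>z i j. z \<in> strip R \<Longrightarrow> cmod (F z $ i $ j) \<le> N" and N1: "1 \<le> N"
    using strip_norm_bounds[OF X R] unfolding N_def by metis
  have XN: "\<bar>X x $ i $ j\<bar> \<le> N" for x i j
  proof -
    have "F (\<chi> j. of_real (x $ j)) $ i $ j = of_real (X x $ i $ j)"
      using F unfolding matrix_analytic_extension_def analytic_extension_def by blast
    moreover have "(\<chi> j. of_real (x $ j)) \<in> strip R" using R by (simp add: strip_def)
    ultimately show ?thesis using FN[of "\<chi> j. of_real (x $ j)" i j] by simp
  qed
  define z where "z = \<zeta> powr \<kappa>"
  have z: "z > 0" using \<zeta> by (simp add: z_def)
  \<comment> \<open>This is the form in which smallness is used: \<open>K\<^sup>2\<close>
    contributes \<open>N ^ 4\<close>, and \<open>Y\<close> contributes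
    \<open>N\<^sup>2 * Dc\<close>.\<close>
  have big: "N ^ 6 * Dc * z \<le> 1 / 100000"
  proof -
    have "N ^ 6 * Dc * z \<le> N ^ 14 * Dc ^ 4 * z"
      using N1 Dc2(1) z power_increasing[of 6 14 N] power_increasing[of 1 4 Dc]
      by (intro mult_right_mono mult_mono) auto
    also have "\<dots> = (N ^ 14 * z) * Dc ^ 4" by simp
    also have "\<dots> \<le> (10 powi (- 5) * Dc powi (- 4)) * Dc ^ 4"
      using small Dc2(1) by (intro mult_right_mono) (auto simp: N_def z_def)
    also have "\<dots> = 1 / 100000" using Dc2(1) by (simp add: power_int_minus)
    finally show ?thesis .
  qed
  have N2: "1 \<le> N\<^sup>2" "N\<^sup>2 \<le> N ^ 6" using N1 by (auto intro: power_increasing)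
  have Nz: "N\<^sup>2 * z \<le> 1 / 100000" "z \<le> 1 / 100000"
  proof -
    have "N\<^sup>2 * 1 \<le> N ^ 6 * Dc" using N2 Dc2(1) by (intro mult_mono) auto
    hence "N\<^sup>2 * z \<le> N ^ 6 * Dc * z" using z by (intro mult_right_mono) auto
    thus 1: "N\<^sup>2 * z \<le> 1 / 100000" using big by linarith
    have "1 * z \<le> N\<^sup>2 * z" using N2 z by (intro mult_right_mono) auto
    thus "z \<le> 1 / 100000" using 1 by linarith
  qed
  have \<zeta>z: "\<zeta> \<le> z"
  proof -
    have "\<zeta> powr 1 \<le> \<zeta> powr \<kappa>" using \<zeta> \<kappa> by (intro powr_mono') auto
    thus ?thesis using \<zeta> by (simp add: z_def)
  qed
  have \<zeta>50: "\<zeta> \<le> 1 / 50" using \<zeta>z Nz(2) by linarith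
  have \<zeta>K: "\<zeta> * N\<^sup>2 \<le> 1 / 4"
  proof -
    have "\<zeta> * N\<^sup>2 \<le> z * N\<^sup>2" using \<zeta>z by (intro mult_right_mono) auto
    thus ?thesis using Nz(1) by (simp add: mult.commute)
  qed
  obtain B where VB: "\<And>x. \<bar>V x\<bar> \<le> B" using C_omega_real_bounded[OF V] by blast
  define x where "x n = \<theta> + real_of_int n *\<^sub>R \<alpha>" for n :: int
  have xs: "x (n + 1) = x n + \<alpha>" for n by (simp add: x_def algebra_simps)
  define W where "W n = V (x n)" for n
  have detX: "det (X y) = 1" for y using X by (simp add: C_omega_PSL_def)
  define step where "step n s \<longleftrightarrow> s * s = 1 \<and> (E - W n) * X (x n) $ 1 $ 1 - X (x n) $ 2 $ 1 = s * X (x (n + 1)) $ 1 $ 1 \<and>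
     (E - W n) * X (x n) $ 1 $ 2 - X (x n) $ 2 $ 2 = s * (\<zeta> * X (x (n + 1)) $ 1 $ 1 + X (x (n + 1)) $ 1 $ 2) \<and>
     X (x n) $ 1 $ 1 = s * X (x (n + 1)) $ 2 $ 1 \<and>
     X (x n) $ 1 $ 2 = s * (\<zeta> * X (x (n + 1)) $ 2 $ 1 + X (x (n + 1)) $ 2 $ 2)" for n and s :: real
  have "\<exists>s. step n s" for n
    using PSL_conjugacy_entries[OF detX conj[of "x n", unfolded cocycle_matrix_def]] unfolding step_def xs W_def .
  then obtain sg where st: "\<And>n. step n (sg n)" by metis
  have sg: "sg n * sg n = (1::real)" for n using st[of n] unfolding step_def by (elim conjE)
  have c1: "(E - W n) * X (x n) $ 1 $ 1 - X (x n) $ 2 $ 1 = sg n * X (x (n + 1)) $ 1 $ 1" for n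
    using st[of n] unfolding step_def by (elim conjE)
  have c2: "(E - W n) * X (x n) $ 1 $ 2 - X (x n) $ 2 $ 2 = sg n * (\<zeta> * X (x (n + 1)) $ 1 $ 1 + X (x (n + 1)) $ 1 $ 2)" for n
    using st[of n] unfolding step_def by (elim conjE)
  have c3: "X (x n) $ 1 $ 1 = sg n * X (x (n + 1)) $ 2 $ 1" for n
    using st[of n] unfolding step_def by (elim conjE)
  have c4: "X (x n) $ 1 $ 2 = sg n * (\<zeta> * X (x (n + 1)) $ 2 $ 1 + X (x (n + 1)) $ 2 $ 2)" for n
    using st[of n] unfolding step_def by (elim conjE)
  obtain \<sigma> where \<sigma>: "\<And>n. \<sigma> n * \<sigma> n = 1" "\<And>n. \<sigma> (n + 1) = sg n * \<sigma> n"
    by (rule sign_cocycle[of sg]) (use sg in blast)+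
  have \<sigma>abs: "\<bar>\<sigma> n\<bar> = 1" for n using \<sigma>(1)[of n] by (auto simp: square_eq_1_iff)
  \<comment> \<open>After normalisation of the signs the first row of \<open>X\<close> determines
    the second one at the next site, because the lower row of the Schroedinger matrix is
    \<open>(1, 0)\<close>.\<close>
  define a where "a n = \<sigma> n * X (x n) $ 1 $ 1" for n
  define b where "b n = \<sigma> n * X (x n) $ 1 $ 2" for n
  have a_shift: "a n = \<sigma> (n + 1) * X (x (n + 1)) $ 2 $ 1" for n
    unfolding a_def \<sigma>(2) c3[of n] by simp
  have b_shift: "b n - \<zeta> * a n = \<sigma> (n + 1) * X (x (n + 1)) $ 2 $ 2" for n
    unfolding a_shift b_def \<sigma>(2) c4[of n] by (simp add: algebra_simps)
  have a_shift': "a (n - 1) = \<sigma> n * X (x n) $ 2 $ 1" and b_shift': "b (n - 1) - \<zeta> * a (n - 1) = \<sigma> n * X (x n) $ 2 $ 2" for n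
    using a_shift[of "n - 1"] b_shift[of "n - 1"] by simp_all
  have prod: "a n * a n = X (x n) $ 1 $ 1 * X (x n) $ 1 $ 1" "a n * b n = X (x n) $ 1 $ 1 * X (x n) $ 1 $ 2"
    "b n * b n = X (x n) $ 1 $ 2 * X (x n) $ 1 $ 2" for n
  proof -
    have m: "\<sigma> n * u * (\<sigma> n * v) = u * v" for u v
    proof -
      have "\<sigma> n * u * (\<sigma> n * v) = (\<sigma> n * \<sigma> n) * (u * v)" by (simp add: mult_ac)
      thus ?thesis unfolding \<sigma>(1) by simp
    qed
    show "a n * a n = X (x n) $ 1 $ 1 * X (x n) $ 1 $ 1" "a n * b n = X (x n) $ 1 $ 1 * X (x n) $ 1 $ 2"
      "b n * b n = X (x n) $ 1 $ 2 * X (x n) $ 1 $ 2" unfolding a_def b_def by (rule m)+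
  qed
  have det: "a n * (b (n - 1) - \<zeta> * a (n - 1)) - b n * a (n - 1) = 1" for n
  proof -
    have "a n * (b (n - 1) - \<zeta> * a (n - 1)) - b n * a (n - 1) = (\<sigma> n * \<sigma> n) * det (X (x n))"
      unfolding b_shift' unfolding a_shift' unfolding a_def b_def det_2 by (simp add: algebra_simps)
    thus ?thesis by (simp add: \<sigma>(1) detX)
  qed
  have sol_a: "a (n + 1) = (E - W n) * a n - a (n - 1)" for n
  proof -
    have "a (n + 1) = \<sigma> n * ((E - W n) * X (x n) $ 1 $ 1 - X (x n) $ 2 $ 1)"
      unfolding c1 a_def \<sigma>(2) by simp
    thus ?thesis unfolding a_shift' unfolding a_def by (simp add: algebra_simps)
  qed
  have sol_b: "b (n + 1) = (E - W n) * b n - b (n - 1) + \<zeta> * a (n - 1) - \<zeta> * a (n + 1)" for n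
  proof -
    have "\<zeta> * a (n + 1) + b (n + 1) = \<sigma> n * ((E - W n) * X (x n) $ 1 $ 2 - X (x n) $ 2 $ 2)"
      unfolding c2 a_def b_def \<sigma>(2) by (simp add: algebra_simps)
    also have "\<dots> = (E - W n) * b n - (b (n - 1) - \<zeta> * a (n - 1))"
      unfolding b_shift' unfolding b_def by (simp add: algebra_simps)
    finally show ?thesis by simp
  qed
  have ab_bound: "\<bar>a n\<bar> \<le> N" "\<bar>b n\<bar> \<le> N" "\<bar>b n - \<zeta> * a n\<bar> \<le> N" for n
    unfolding b_shift unfolding a_def b_def abs_mult \<sigma>abs by (simp_all add: XN)
  have per: "periodic (\<lambda>y. X y $ i $ j * X y $ k $ l)" for i j k l
    by (rule PSL_periodic_product) (use X in \<open>simp add: C_omega_PSL_def\<close>)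
  have ext: "analytic_extension R (\<lambda>y. X y $ i $ j) (\<lambda>z. F z $ i $ j)" for i j
    using F by (simp add: matrix_analytic_extension_def)
  define M where "M = N\<^sup>2 * S"
  note cohom = cohomological_solution[OF \<alpha> R ext ext FN FN per s, where \<theta> = \<theta>, folded S_def x_def, folded M_def]
  obtain p f1 f2 f3 where p: "\<bar>p\<bar> \<le> N\<^sup>2"
    and f: "\<And>n::int. f1 (n + 1) = f1 n + a n * a n - p" "\<And>n::int. f2 (n + 1) = f2 n + f1 n"
      "\<And>n::int. f3 (n + 1) = f3 n + f2 n" "\<And>n. \<bar>f1 n\<bar> \<le> 4 * M" "\<And>n. \<bar>f2 n\<bar> \<le> 2 * M" "\<And>n. \<bar>f3 n\<bar> \<le> M"
    using cohom[of 1 1 1 1] unfolding prod by metis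
  obtain q g1 g2 where q: "\<bar>q\<bar> \<le> N\<^sup>2"
    and g: "\<And>n::int. g1 (n + 1) = g1 n + a n * b n - q" "\<And>n::int. g2 (n + 1) = g2 n + g1 n"
      "\<And>n. \<bar>g1 n\<bar> \<le> 4 * M" "\<And>n. \<bar>g2 n\<bar> \<le> 2 * M"
    using cohom[of 1 1 1 2] unfolding prod by metis
  obtain r h1 where r: "\<bar>r\<bar> \<le> N\<^sup>2"
    and h: "\<And>n::int. h1 (n + 1) = h1 n + b n * b n - r" "\<And>n. \<bar>h1 n\<bar> \<le> 4 * M"
    using cohom[of 1 2 1 2] unfolding prod by metis
  note lower = mean_lower_bounds[OF det f(1) g(1) h(1) f(4) g(3) h(2) N2(1) _ _ \<zeta>(1) \<zeta>K]
  have pr: "p \<le> N\<^sup>2" "r \<le> N\<^sup>2" using p r by auto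
  define y1 where "y1 n = \<zeta> * f2 n - g1 n + \<zeta> * f1 n" for n
  \<comment> \<open>The source \<open>y1 (n + 1) + y1 n\<close> is twice \<open>y1 n\<close> plus a
    difference of \<open>y1\<close>. The inner bracket has increment \<open>y1\<close>, and the
    terms after it are \<open>y1\<close> itself.\<close>
  define y2 where "y2 n = \<zeta> * g1 n - h1 n
      - \<zeta> * (2 * (\<zeta> * f3 n - g2 n + \<zeta> * f2 n) + \<zeta> * (f2 n + f1 n) - g1 n)" for n
  \<comment> \<open>The factor 40 in the constant gives \<open>5 * M \<le> Y\<close> despite the
    division by 3, and its summand 2 gives \<open>2 * N\<^sup>2 \<le> 3 * Y\<close>.\<close>
  define Y where "Y = N\<^sup>2 * Dc / 3"
  have M0: "0 \<le> M" using S0 by (simp add: M_def)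
  have MY: "5 * M \<le> Y"
  proof -
    have "M \<le> N\<^sup>2 * (Dc / 40)" unfolding M_def using Dc2(2) by (intro mult_left_mono) auto
    moreover have "0 \<le> N\<^sup>2 * Dc" using Dc2(1) by simp
    ultimately show ?thesis unfolding Y_def by simp
  qed
  have \<zeta>t: "\<bar>\<zeta> * t\<bar> \<le> c / 50" if "\<bar>t\<bar> \<le> c" for t c
    using mult_mono[OF \<zeta>50 that] \<zeta>(1) by (simp add: abs_mult)
  have y1_bound: "\<bar>y1 n\<bar> \<le> Y" for n
    using \<zeta>t[OF f(5)[of n]] \<zeta>t[OF f(4)[of n]] g(3)[of n] MY M0 unfolding y1_def by linarith
  have y2_bound: "\<bar>y2 n\<bar> \<le> Y" for n
  proof -
    have w: "\<bar>\<zeta> * (f2 n + f1 n)\<bar> \<le> 6 * M / 50"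
      using f(4)[of n] f(5)[of n] by (intro \<zeta>t) linarith
    have "\<bar>2 * (\<zeta> * f3 n - g2 n + \<zeta> * f2 n) + \<zeta> * (f2 n + f1 n) - g1 n\<bar> \<le> 10 * M"
    proof -
      have "\<bar>2 * (t1 - t2 + t3) + t4 - t5\<bar> \<le> 10 * M"
        if "\<bar>t1\<bar> \<le> M / 50" "\<bar>t2\<bar> \<le> 2 * M" "\<bar>t3\<bar> \<le> 2 * M / 50" "\<bar>t4\<bar> \<le> 6 * M / 50" "\<bar>t5\<bar> \<le> 4 * M"
        for t1 t2 t3 t4 t5
        using that M0 unfolding abs_le_iff by simp
      from this[OF \<zeta>t[OF f(6)] g(4) \<zeta>t[OF f(5)] w g(3)]
      show ?thesis .
    qed
    from \<zeta>t[OF this] show ?thesis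
      using \<zeta>t[OF g(3)[of n]] h(2)[of n] MY M0 unfolding y2_def by linarith
  qed
  have y3_bound: "\<bar>f1 n\<bar> \<le> Y" for n using f(4)[of n] MY M0 by linarith
  interpret av: averaged_cocycle W B a b y1 y2 f1 E \<zeta> N p q r Y
  proof
    show "y1 (n + 1) = y1 n + \<zeta> * f1 n - (a n * b n - \<zeta> * (a n * a n)) + (q - \<zeta> * p)" for n
      unfolding y1_def f(1,2) g(1) by (simp add: algebra_simps)
    show "y2 (n + 1) = y2 n - \<zeta> * (y1 (n + 1) + y1 n) - (b n * b n - \<zeta> * (a n * b n)) + (r - \<zeta> * q)" for n
      unfolding y1_def y2_def f(1-3) g(1,2) h(1) by (simp add: algebra_simps)
    have "N\<^sup>2 * 2 \<le> N\<^sup>2 * Dc" using Dc2(1) by (intro mult_left_mono) auto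
    thus "2 * N\<^sup>2 \<le> 3 * Y" unfolding Y_def by simp
    show "\<bar>W n\<bar> \<le> B" for n by (simp add: W_def VB)
    show "1 / (5 * N\<^sup>2) \<le> p" "1 / 8 \<le> p * r - q\<^sup>2" by (rule lower[OF pr])+
    show "\<bar>y1 n\<bar> \<le> Y" "\<bar>y2 n\<bar> \<le> Y" "\<bar>f1 n\<bar> \<le> Y" for n by (rule y1_bound y2_bound y3_bound)+
  qed (fact det sol_a sol_b ab_bound p q r f(1) N1 \<zeta>(1) \<zeta>50)+
  show ?thesis
  proof (rule av.gap_length[OF _ _ gap(2) \<kappa>])
    show "G \<in> components {e. bounded_below_at W e}" "bounded G"
      using gap(1) unfolding spectral_gap_def Sigma_spec_eq[of V B \<alpha> \<theta>, OF VB] W_def[abs_def] x_def by blast+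
    have "60000 * av.K\<^sup>2 * Y * \<zeta> powr \<kappa> = 20000 * (N ^ 6 * Dc * z)"
    proof -
      have "N ^ 6 = (N\<^sup>2)\<^sup>2 * N\<^sup>2" unfolding power_mult[symmetric] power_add[symmetric] by simp
      thus ?thesis unfolding av.K_def Y_def z_def by simp
    qed
    thus "60000 * av.K\<^sup>2 * Y * \<zeta> powr \<kappa> \<le> 3 / 10" using big by linarith
  qed
qed

theorem theorem6p1:
  fixes \<alpha> \<theta> :: "real^'d" and R \<kappa> E \<zeta> :: real
    and V :: "real^'d \<Rightarrow> real" and X :: "real^'d \<Rightarrow> real^2^2" and G :: "real set"
  assumes "rationally_independent_with_one \<alpha>"
    and "0 < R" "R < 1" "3 * beta \<alpha> < ereal R" "0 \<le> 3 * beta \<alpha>"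
    and "0 < \<kappa>" "\<kappa> < 1 / 4"
    and "V \<in> C_omega_real" "\<not> V constant_on UNIV"
    and "spectral_gap V \<alpha> \<theta> G" "E \<in> frontier G"
    and "0 < \<zeta>" "\<zeta> < 1 / 2"
    and "X \<in> C_omega_PSL R"
    and "\<forall>x. PSL_class (matrix_inv (X (x + \<alpha>)) ** cocycle_matrix V E x ** X x)
               = PSL_class (vector [vector [1, \<zeta>], vector [0, 1]])"
  shows "(strip_norm R X ^ 14 * \<zeta> powr \<kappa> \<le> 10 powi (- 5) * D_alpha \<alpha> R powi (- 4) \<longrightarrow>
            \<zeta> powr (1 + \<kappa>) \<le> measure lborel G \<and> measure lborel G \<le> \<zeta> powr (1 - \<kappa>)) \<and>
         (\<forall>\<gamma> \<tau>. \<gamma> > 0 \<longrightarrow> \<tau> > real CARD('d) - 1 \<longrightarrow> \<alpha> \<in> DC \<gamma> \<tau> \<longrightarrow>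
            strip_norm R X ^ 14 * \<zeta> powr \<kappa>
              \<le> 10 powi (- 5) * D_tau \<tau> powi (- 4) * \<gamma> ^ 12 * R powr (4 * (4 * \<tau> + 1)) \<longrightarrow>
            \<zeta> powr (1 + \<kappa>) \<le> measure lborel G \<and> measure lborel G \<le> \<zeta> powr (1 - \<kappa>))"
proof -
  note s = D_alpha_ge[OF assms(1,2,4,5)]
  have conj: "PSL_class (matrix_inv (X (x + \<alpha>)) ** cocycle_matrix V E x ** X x)
      = PSL_class (vector [vector [1, \<zeta>], vector [0, 1]])" for x
    using assms(15) by blast
  note est = gap_estimate[OF assms(1,2,6,7,8,10-14) conj s(1)]
  show ?thesis
  proof (intro conjI[OF impI] allI impI)
    assume "strip_norm R X ^ 14 * \<zeta> powr \<kappa> \<le> 10 powi (- 5) * D_alpha \<alpha> R powi (- 4)"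
    from est[OF s(2) this]
    show "\<zeta> powr (1 + \<kappa>) \<le> measure lborel G \<and> measure lborel G \<le> \<zeta> powr (1 - \<kappa>)" .
  next
    fix \<gamma> \<tau> :: real
    assume \<gamma>: "\<gamma> > 0" and \<tau>: "\<tau> > real CARD('d) - 1" and DC: "\<alpha> \<in> DC \<gamma> \<tau>"
      and small: "strip_norm R X ^ 14 * \<zeta> powr \<kappa>
              \<le> 10 powi (- 5) * D_tau \<tau> powi (- 4) * \<gamma> ^ 12 * R powr (4 * (4 * \<tau> + 1))"
    \<comment> \<open>The fourth power of \<open>u\<close> is the factor in the hypothesis, so
      taking \<open>D_tau \<tau> / u\<close> as the constant reduces the Diophantine case to the
      general estimate.\<close>
    define u where "u = \<gamma> ^ 3 * R powr (4 * \<tau> + 1)"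
    have u: "u > 0" using \<gamma> assms(2) by (simp add: u_def)
    have Dle: "2 + 40 * (\<Sum>\<^sub>\<infinity>n\<in>UNIV - {0}. small_divisor_term (2 * pi * R) \<alpha> n) \<le> D_tau \<tau> / u"
      unfolding pos_le_divide_eq[OF u] unfolding u_def by (rule D_tau_ge[OF assms(2,3) \<gamma> \<tau> DC s(1)])
    have "u ^ 4 = \<gamma> ^ 12 * R powr (4 * (4 * \<tau> + 1))"
    proof -
      have "(\<gamma> ^ 3) ^ 4 = \<gamma> ^ 12" unfolding power_mult[symmetric] by simp
      moreover have "(R powr (4 * \<tau> + 1)) ^ 4 = R powr (4 * (4 * \<tau> + 1))"
        using assms(2) by (simp add: powr_power mult.commute)
      ultimately show ?thesis unfolding u_def power_mult_distrib by simp
    qed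
    hence "10 powi (- 5) * D_tau \<tau> powi (- 4) * \<gamma> ^ 12 * R powr (4 * (4 * \<tau> + 1))
        = 10 powi (- 5) * D_tau \<tau> powi (- 4) * u ^ 4" by simp
    also have "\<dots> = 10 powi (- 5) * (D_tau \<tau> / u) powi (- 4)"
      by (simp add: power_int_minus power_divide) (simp only: divide_inverse mult.commute)
    finally have eq: "10 powi (- 5) * D_tau \<tau> powi (- 4) * \<gamma> ^ 12 * R powr (4 * (4 * \<tau> + 1))
        = 10 powi (- 5) * (D_tau \<tau> / u) powi (- 4)" .
    show "\<zeta> powr (1 + \<kappa>) \<le> measure lborel G \<and> measure lborel G \<le> \<zeta> powr (1 - \<kappa>)"
      by (rule est[OF Dle small[unfolded eq]])
  qed
qed

end
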